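(* Let $d\ge 3$. Let $\mathscr{G}\subset\mathbb{P}(S_{n,d})$ be the set of (classes of) polynomials $g$ such that either $g$ is of Sebastiani-Thom type or $V(g)$ has some singularities of multiplicity $d-1$, and let $\mathscr{U}=\mathbb{P}(S_{n,d})\setminus\mathscr{G}$. Then $\mathscr{U}$ is a nonempty Zariski open subset of $\mathbb{P}(S_{n,d})$. Moreover, for any $g\in\mathscr{U}$, there exists a basis $F_0,\dots,F_n$ of the vector space $E(g)$, unique up to a common nonzero multiple, satisfying $$\frac{\partial F_i}{\partial x_j}=\frac{\partial F_j}{\partial x_i}\qquad\text{for all } 0\le i<j\le n.$$
   Context: $S_{n,d}=\mathbb{C}[x_0,\dots,x_n]_d$ is the vector space of homogeneous polynomials of degree $d$ in $n+1$ variables, and $\mathbb{P}(S_{n,d})$ is the corresponding projective space. For $g\in S_{n,d}$, $E(g)$ is the vector space spanned by the first order partial derivatives $\partial g/\partial x_0,\dots,\partial g/\partial x_n$ (it depends only on the class of $g$ in $\mathbb{P}(S_{n,d})$). $V(g)\subset\mathbb{P}^n$ is the projective hypersurface $g=0$, with its scheme structure. A point $p\in V(g)$ has multiplicity $m$ if a local equation of $V(g)$ at $p$ lies in $\mathfrak{m}_p^m$ but not in $\mathfrak{m}_p^{m+1}$, where $\mathfrak{m}_p$ is the maximal ideal of the local ring of $\mathbb{P}^n$ at $p$; it is a singularity if $m\ge 2$. Bases are ordered, indexed as $F_0,\dots,F_n$. A homogeneous polynomial $f$ of degree $d$ is of Sebastiani-Thom type (ST type) if, for some choice of homogeneous (linear)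 coordinates $(x_0,\dots,x_n)$ of $\mathbb{P}^n$, some $0\le l\le n-1$, and some forms $p,q$, each either zero or homogeneous of degree $d$, one has $f(x_0,\dots,x_n)=p(x_0,\dots,x_l)+q(x_{l+1},\dots,x_n)$. The case $q=0$ is allowed (then $f$ is called a cone).
   Formalization: Nonemptiness of U is claimed only for (n,d) ≠ (1,3): every binary cubic is a sum of two cubes of independent linear forms, a cone, or has a double root (a singularity of multiplicity 2 = d−1), so U is empty there; openness and the basis claim are kept for all n. *)

theory Defs
  imports Complex_Main "HOL-Library.Poly_Mapping" "HOL-Computational_Algebra.Fraction_Field"
begin

section \<open>Polynomials over the complex numbers\<close>

text \<open>
  A polynomial with variables indexed by \<open>'x\<close> is a finitely supported map from monomials
  (exponent vectors) to coefficients; the library's product is the convolution product.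
\<close>

type_synonym 'x mpoly = "('x \<Rightarrow>\<^sub>0 nat) \<Rightarrow>\<^sub>0 complex"

definition monomials :: "'x set \<Rightarrow> nat \<Rightarrow> ('x \<Rightarrow>\<^sub>0 nat) set" where
  "monomials X d = {m. Poly_Mapping.keys m \<subseteq> X \<and>
    (\<Sum>i\<in>Poly_Mapping.keys m. Poly_Mapping.lookup m i) = d}"

text \<open>The zero polynomial belongs to \<open>forms X d\<close> for every \<open>d\<close>; \<open>forms {..n} d\<close> is $S_{n,d}$.\<close>

definition forms :: "'x set \<Rightarrow> nat \<Rightarrow> 'x mpoly set" where
  "forms X d = {f. Poly_Mapping.keys f \<subseteq> monomials X d}"

definition const :: "complex \<Rightarrow> 'x mpoly" where
  "const c = Poly_Mapping.single 0 c"

definition scale :: "complex \<Rightarrow> 'x mpoly \<Rightarrow> 'x mpoly" where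
  "scale c f = const c * f"

global_interpretation mpoly: vector_space "scale :: complex \<Rightarrow> 'x mpoly \<Rightarrow> 'x mpoly"
  by unfold_locales
    (simp_all add: scale_def const_def algebra_simps single_add mult_single
      flip: mult.assoc)

definition eval :: "('x \<Rightarrow> complex) \<Rightarrow> 'x mpoly \<Rightarrow> complex" where
  "eval a f =
    (\<Sum>m\<in>Poly_Mapping.keys f. Poly_Mapping.lookup f m *
      (\<Prod>i\<in>Poly_Mapping.keys m. a i ^ Poly_Mapping.lookup m i))"

definition subst :: "('x \<Rightarrow> 'y mpoly) \<Rightarrow> 'x mpoly \<Rightarrow> 'y mpoly" where
  "subst y f =
    (\<Sum>m\<in>Poly_Mapping.keys f. const (Poly_Mapping.lookup f m) *
      (\<Prod>i\<in>Poly_Mapping.keys m. y i ^ Poly_Mapping.lookup m i))"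

text \<open>
  The truncated subtraction of exponents is harmless: if $x_j$ does not occur in the
  monomial, the coefficient is zero.
\<close>

definition partial :: "'x \<Rightarrow> 'x mpoly \<Rightarrow> 'x mpoly" where
  "partial j f =
    (\<Sum>m\<in>Poly_Mapping.keys f.
      Poly_Mapping.single (m - Poly_Mapping.single j 1)
        (of_nat (Poly_Mapping.lookup m j) * Poly_Mapping.lookup f m))"

definition ordered_basis :: "nat \<Rightarrow> (nat \<Rightarrow> 'x mpoly) \<Rightarrow> 'x mpoly set \<Rightarrow> bool" where
  "ordered_basis n F W \<longleftrightarrow>
    inj_on F {..n} \<and> mpoly.independent (F ` {..n}) \<and> mpoly.span (F ` {..n}) = W"

definition jacobian_space :: "nat \<Rightarrow> nat mpoly \<Rightarrow> nat mpoly set" where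
  "jacobian_space n g = mpoly.span ((\<lambda>j. partial j g) ` {..n})"


section \<open>The projective space of forms and its Zariski topology\<close>

definition proj_class :: "'x mpoly \<Rightarrow> 'x mpoly set" where
  "proj_class g = {scale c g | c. c \<noteq> 0}"

definition proj_forms :: "nat \<Rightarrow> nat \<Rightarrow> nat mpoly set set" where
  "proj_forms n d = proj_class ` (forms {..n} d - {0})"

text \<open>
  The homogeneous coordinates of a class are the coefficients of a representative. Equations
  for closed sets are therefore forms whose variables are indexed by the monomials of
  degree \<open>d\<close>, evaluated at \<open>Poly_Mapping.lookup g\<close>.
\<close>

definition zariski_closed :: "nat \<Rightarrow> nat \<Rightarrow> nat mpoly set set \<Rightarrow> bool" where
  "zariski_closed n d Z \<longleftrightarrow>
    (\<exists>\<Phi> :: (nat \<Rightarrow>\<^sub>0 nat) mpoly set.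
      (\<forall>P\<in>\<Phi>. \<exists>k. P \<in> forms (monomials {..n} d) k) \<and>
      Z = {\<gamma> \<in> proj_forms n d. \<forall>g\<in>\<gamma>. \<forall>P\<in>\<Phi>. eval (Poly_Mapping.lookup g) P = 0})"

definition zariski_open :: "nat \<Rightarrow> nat \<Rightarrow> nat mpoly set set \<Rightarrow> bool" where
  "zariski_open n d U \<longleftrightarrow> U \<subseteq> proj_forms n d \<and> zariski_closed n d (proj_forms n d - U)"


section \<open>Sebastiani-Thom type\<close>

text \<open>
  Homogeneous coordinates of $\mathbb{P}^n$ are bases \<open>y\<^sub>0, \<dots>, y\<^sub>n\<close> of the space of linear forms.
\<close>

definition ST_type :: "nat \<Rightarrow> nat \<Rightarrow> nat mpoly \<Rightarrow> bool" where
  "ST_type n d f \<longleftrightarrow>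
    (\<exists>y l p q. ordered_basis n y (forms {..n} 1) \<and> l < n \<and>
      p \<in> forms {..l} d \<and> q \<in> forms {l<..n} d \<and>
      f = subst y p + subst y q)"


section \<open>Multiplicities of points of a hypersurface\<close>

text \<open>
  Points of $\mathbb{P}^n$ are given by homogeneous coordinate vectors \<open>a\<close>, of which only the
  entries with index at most \<open>n\<close> matter. The local ring at a point consists of the fractions
  of forms of equal degree whose denominator does not vanish there.
\<close>

definition proj_point :: "nat \<Rightarrow> (nat \<Rightarrow> complex) \<Rightarrow> bool" where
  "proj_point n a \<longleftrightarrow> (\<exists>i\<le>n. a i \<noteq> 0)"

definition local_ring :: "nat \<Rightarrow> (nat \<Rightarrow> complex) \<Rightarrow> nat mpoly fract set" where
  "local_ring n a =
    {Fract s t | s t k. s \<in> forms {..n} k \<and> t \<in> forms {..n} k \<and> eval a t \<noteq> 0}"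

definition max_ideal :: "nat \<Rightarrow> (nat \<Rightarrow> complex) \<Rightarrow> nat mpoly fract set" where
  "max_ideal n a =
    {Fract s t | s t k. s \<in> forms {..n} k \<and> t \<in> forms {..n} k \<and> eval a t \<noteq> 0 \<and> eval a s = 0}"

primrec max_ideal_power :: "nat \<Rightarrow> (nat \<Rightarrow> complex) \<Rightarrow> nat \<Rightarrow> nat mpoly fract set" where
  "max_ideal_power n a 0 = local_ring n a"
| "max_ideal_power n a (Suc m) =
    {(\<Sum>i<N. u i * v i) | (N :: nat) u v.
      \<forall>i<N. u i \<in> max_ideal n a \<and> v i \<in> max_ideal_power n a m}"

text \<open>
  Dividing a form \<open>g\<close> of degree \<open>d\<close> by a form of degree \<open>d\<close> that does not vanish at the point
  gives a local equation of $V(g)$; two such quotients differ by a unit of the local ring.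
\<close>

definition local_equation ::
    "nat \<Rightarrow> nat \<Rightarrow> nat mpoly \<Rightarrow> (nat \<Rightarrow> complex) \<Rightarrow> nat mpoly fract \<Rightarrow> bool" where
  "local_equation n d g a h \<longleftrightarrow> (\<exists>t \<in> forms {..n} d. eval a t \<noteq> 0 \<and> h = Fract g t)"

definition has_multiplicity ::
    "nat \<Rightarrow> nat \<Rightarrow> nat mpoly \<Rightarrow> (nat \<Rightarrow> complex) \<Rightarrow> nat \<Rightarrow> bool" where
  "has_multiplicity n d g a m \<longleftrightarrow>
    (\<exists>h. local_equation n d g a h \<and>
      h \<in> max_ideal_power n a m \<and> h \<notin> max_ideal_power n a (Suc m))"

definition has_singularity_of_multiplicity :: "nat \<Rightarrow> nat \<Rightarrow> nat mpoly \<Rightarrow> nat \<Rightarrow> bool" where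
  "has_singularity_of_multiplicity n d g m \<longleftrightarrow>
    2 \<le> m \<and> (\<exists>a. proj_point n a \<and> eval a g = 0 \<and> has_multiplicity n d g a m)"


section \<open>The exceptional locus and its complement\<close>

definition locus_G :: "nat \<Rightarrow> nat \<Rightarrow> nat mpoly set set" where
  "locus_G n d = proj_class ` {g \<in> forms {..n} d - {0}.
    ST_type n d g \<or> has_singularity_of_multiplicity n d g (d - 1)}"

text \<open>
  For \<open>n = 1\<close> and \<open>d = 3\<close> this set is empty: a binary cubic either has three distinct roots,
  and is then a sum of two cubes of independent linear forms, or it has a root of
  multiplicity two or three.
\<close>

definition locus_U :: "nat \<Rightarrow> nat \<Rightarrow> nat mpoly set set" where
  "locus_U n d = proj_forms n d - locus_G n d"

end

theory Submission
  imports "Jordan_Normal_Form.Spectral_Radius" "HOL-Analysis.Continuum_Not_Denumerable" Defs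
begin

text \<open>
  Let \<open>H\<close> be the Hessian matrix of \<open>g\<close>. If \<open>F = A \<nabla>g\<close> for a constant matrix \<open>A\<close>, then the condition
  \<open>\<partial>F\<^sub>i/\<partial>x\<^sub>j = \<partial>F\<^sub>j/\<partial>x\<^sub>i\<close> says that \<open>A H\<close> is symmetric, so uniqueness means that only scalar
  matrices \<open>A\<close> have this property. Suppose that a nonscalar \<open>A\<close> does; replace it by \<open>A - \<lambda>\<close> for an
  eigenvalue \<open>\<lambda>\<close> and let \<open>B\<close> be the transpose. As \<open>B\<close> is self-adjoint for the form \<open>H\<close>, its kernel
  and its image are orthogonal. If they meet in \<open>a \<noteq> 0\<close>, the second derivative of \<open>g\<close> along \<open>a\<close>
  is zero, which means that \<open>V(g)\<close> has multiplicity at least \<open>d - 1\<close> at \<open>a\<close>; otherwise they split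
  the space, and \<open>g\<close> is of Sebastiani-Thom type. Conversely, a Sebastiani-Thom decomposition
  provides a projection \<open>B\<close>. Hence \<open>g\<close> lies in the exceptional locus iff one of two systems has a
  nonzero solution: a linear one in \<open>A\<close>, and a quadratic one in \<open>a\<close>. The first is a condition on
  minors; by the projective Nullstellensatz the second is solvable iff for every \<open>k\<close> the quadrics
  fail to generate all forms of degree \<open>k\<close>, which again is a condition on minors. The form
  \<open>x\<^sub>0\<^sup>d + x\<^sub>0 x\<^sub>1\<^sup>d\<^sup>-\<^sup>1 + \<dots> + x\<^sub>n\<^sub>-\<^sub>1 x\<^sub>n\<^sup>d\<^sup>-\<^sup>1\<close> lies outside the locus.
\<close>

text \<open>Existence is the easy half: the gradient of g is symmetric because partial derivatives
  commute, and a linear relation among its entries would be a direction a with D_a g = 0, hence also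
  D_a D_a g = 0. An eigenvalue is subtracted so that the kernel of B is nonzero while B itself is
  not; both summands of a splitting are then nonzero. A point with D_a D_a g = 0 may have
  multiplicity larger than d - 1, but then D_a g = 0, and such a cone is of Sebastiani-Thom type; so
  asking for multiplicity exactly d - 1 does no harm. Scalar matrices always solve the linear system
  and are removed by normalising A_00 = 0. Closed sets may have infinitely many equations, so the
  conditions for all k can be imposed together; the union of the two loci is given by products of
  equations. A sum of d-th powers splits for n >= 1, hence neighbouring variables are coupled in the
  form outside the locus. For d = 3 its Hessian has fewer monomials than for d >= 4, so cubics need
  their own computation, and for (n, d) = (1, 3) no such form exists.\<close>

abbreviation (input) "lookup \<equiv> Poly_Mapping.lookup"
abbreviation (input) "keys \<equiv> Poly_Mapping.keys"
abbreviation (input) "single \<equiv> Poly_Mapping.single"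

section \<open>Polynomial evaluation\<close>

definition monom_eval :: "('x \<Rightarrow> 'r::comm_ring_1) \<Rightarrow> ('x \<Rightarrow>\<^sub>0 nat) \<Rightarrow> 'r" where
  "monom_eval y m = (\<Prod>i\<in>keys m. y i ^ lookup m i)"

lemma monom_eval_superset:
  assumes "finite S" "keys m \<subseteq> S"
  shows "monom_eval y m = (\<Prod>i\<in>S. y i ^ lookup m i)"
  unfolding monom_eval_def
  by (rule prod.mono_neutral_left) (use assms in \<open>auto simp: in_keys_iff\<close>)

lemma monom_eval_zero [simp]: "monom_eval y 0 = 1"
  by (simp add: monom_eval_def)

lemma monom_eval_single [simp]: "monom_eval y (single i k) = y i ^ k"
  by (cases "k = 0") (simp_all add: monom_eval_def)

lemma monom_eval_add: "monom_eval y (m + m') = monom_eval y m * monom_eval y m'"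
proof -
  let ?S = "keys m \<union> keys m'"
  have "finite ?S" "keys (m + m') \<subseteq> ?S"
    by (auto simp: in_keys_iff lookup_add)
  then show ?thesis
    by (simp add: monom_eval_superset[of ?S] lookup_add power_add prod.distrib)
qed

text \<open>The coefficient map \<phi> is a parameter so that the homomorphism laws are proved once
  and serve \<open>eval\<close> (identity), \<open>subst\<close> (\<open>const\<close>) and
  \<open>leval\<close> (constant univariate polynomials).\<close>

definition insertion :: "(complex \<Rightarrow> 'r::comm_ring_1) \<Rightarrow> ('x \<Rightarrow> 'r) \<Rightarrow> 'x mpoly \<Rightarrow> 'r" where
  "insertion \<phi> y f =
    (\<Sum>m\<in>keys f. \<phi> (lookup f m) * monom_eval y m)"

lemma poly_mapping_eq_sum_single:
  fixes f :: "'a \<Rightarrow>\<^sub>0 'b::comm_monoid_add"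
  shows "f = (\<Sum>m\<in>keys f. single m (lookup f m))"
proof (rule poly_mapping_eqI)
  fix k
  show "lookup f k = lookup
    (\<Sum>m\<in>keys f. single m (lookup f m)) k"
    by (simp add: lookup_sum lookup_single when_def sum.delta in_keys_iff)
qed

definition Var :: "'x \<Rightarrow> 'x mpoly" where
  "Var i = single (single i 1) 1"

lemma const_add: "const (a + b) = const a + const b"
  by (simp add: const_def single_add)

lemma const_mult: "const (a * b) = const a * const b"
  by (simp add: const_def mult_single)

lemma const_0 [simp]: "const 0 = 0" and const_1 [simp]: "const 1 = 1"
  by (simp_all add: const_def)

lemma Var_power: "Var i ^ k = single (single i k) 1"
  by (induction k) (simp_all add: Var_def mult_single flip: single_add)

lemma single_eq_monom: "single m c = const c * monom_eval Var m"
proof -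
  have pr: "(\<Prod>i\<in>S. single (h i) (1::complex)) = single (\<Sum>i\<in>S. h i) 1"
    if "finite S" for S :: "'a set" and h :: "'a \<Rightarrow> 'a \<Rightarrow>\<^sub>0 nat"
    using that by (induction S) (simp_all add: mult_single)
  have "monom_eval Var m = single
      (\<Sum>i\<in>keys m. single i (lookup m i)) 1"
    by (simp add: monom_eval_def Var_power pr)
  also have "\<dots> = single m 1"
    by (simp flip: poly_mapping_eq_sum_single)
  finally show ?thesis by (simp add: const_def mult_single)
qed

lemma mpoly_induct [case_names const Var add mult]:
  assumes "\<And>c. P (const c)" "\<And>i. P (Var i)"
    and "\<And>f g. P f \<Longrightarrow> P g \<Longrightarrow> P (f + g)" "\<And>f g. P f \<Longrightarrow> P g \<Longrightarrow> P (f * g)"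
  shows "P f"
proof -
  have pw: "P (Var i ^ k)" for i k
    by (induction k) (use assms(1)[of 1] assms(2,4) in auto)
  have pr: "P (\<Prod>i\<in>S. Var i ^ g i)" if "finite S" for S g
    using that by (induction S rule: finite_induct) (use assms(1)[of 1] assms(4) pw in auto)
  have sg: "P (single m c)" for m c
    unfolding single_eq_monom monom_eval_def by (intro assms pr) simp
  have "P (\<Sum>m\<in>S. single m (lookup f m))" if "finite S" for S
    using that by (induction S rule: finite_induct) (use assms(1)[of 0] assms(3) sg in auto)
  from this[of "keys f"] show ?thesis
    by (simp flip: poly_mapping_eq_sum_single)
qed

locale coeff_hom =
  fixes \<phi> :: "complex \<Rightarrow> 'r::comm_ring_1"
  assumes hom_add: "\<phi> (a + b) = \<phi> a + \<phi> b"
    and hom_mult: "\<phi> (a * b) = \<phi> a * \<phi> b"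
    and hom_one: "\<phi> 1 = 1"
begin

lemma hom_zero: "\<phi> 0 = 0"
  using hom_add[of 0 0] by simp

lemma insertion_superset:
  assumes "finite S" "keys f \<subseteq> S"
  shows "insertion \<phi> y f = (\<Sum>m\<in>S. \<phi> (lookup f m) * monom_eval y m)"
  unfolding insertion_def
  by (rule sum.mono_neutral_left) (use assms in \<open>auto simp: in_keys_iff hom_zero\<close>)

lemma insertion_single: "insertion \<phi> y (single m c) = \<phi> c * monom_eval y m"
  by (cases "c = 0") (simp_all add: insertion_def hom_zero)

lemma insertion_add: "insertion \<phi> y (f + g) = insertion \<phi> y f + insertion \<phi> y g"
proof -
  let ?S = "keys f \<union> keys g"
  have "finite ?S" "keys (f + g) \<subseteq> ?S"
    by (auto simp: in_keys_iff lookup_add)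
  then show ?thesis
    by (simp add: insertion_superset[of ?S] lookup_add hom_add algebra_simps sum.distrib)
qed

lemma insertion_zero [simp]: "insertion \<phi> y 0 = 0"
  by (simp add: insertion_def)

lemma insertion_sum: "insertion \<phi> y (sum h S) = (\<Sum>i\<in>S. insertion \<phi> y (h i))"
  by (induction S rule: infinite_finite_induct) (simp_all add: insertion_add)

lemma insertion_mult: "insertion \<phi> y (f * g) = insertion \<phi> y f * insertion \<phi> y g"
proof -
  have "insertion \<phi> y (f * g) =
    insertion \<phi> y ((\<Sum>m\<in>keys f. single m (lookup f m)) *
      (\<Sum>m\<in>keys g. single m (lookup g m)))"
    by (simp flip: poly_mapping_eq_sum_single)
  also have "\<dots> = insertion \<phi> y f * insertion \<phi> y g"
    unfolding sum_product
    unfolding insertion_sum mult_single insertion_single hom_mult monom_eval_add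
    by (simp add: insertion_def sum_product mult_ac)
  finally show ?thesis .
qed

lemma insertion_const [simp]: "insertion \<phi> y (const c) = \<phi> c"
  by (simp add: const_def insertion_single)

lemma insertion_Var [simp]: "insertion \<phi> y (Var i) = y i"
  by (simp add: Var_def insertion_single hom_one)

lemma insertion_one [simp]: "insertion \<phi> y 1 = 1"
  using insertion_const[of y 1] by (simp add: hom_one)

lemma insertion_uminus: "insertion \<phi> y (- f) = - insertion \<phi> y f"
  using insertion_add[of y f "- f"] by (simp add: eq_neg_iff_add_eq_0 add.commute)

lemma insertion_diff: "insertion \<phi> y (f - g) = insertion \<phi> y f - insertion \<phi> y g"
  using insertion_add[of y f "- g"] by (simp add: insertion_uminus)

lemma insertion_power: "insertion \<phi> y (f ^ k) = insertion \<phi> y f ^ k"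
  by (induction k) (simp_all add: insertion_mult)

lemma insertion_prod: "insertion \<phi> y (prod h S) = (\<Prod>i\<in>S. insertion \<phi> y (h i))"
  by (induction S rule: infinite_finite_induct) (simp_all add: insertion_mult)

lemma insertion_scale: "insertion \<phi> y (scale c f) = \<phi> c * insertion \<phi> y f"
  by (simp add: scale_def insertion_mult)

end

global_interpretation eval: coeff_hom "\<lambda>c. c"
  rewrites "insertion (\<lambda>c. c) y f = eval y f"
  by unfold_locales (simp_all add: insertion_def eval_def monom_eval_def)

global_interpretation subst: coeff_hom const
  rewrites "insertion const y f = subst y f"
  by unfold_locales (simp_all add: insertion_def subst_def monom_eval_def const_add const_mult)

text \<open>This is f restricted to the line through a with direction b, kept as a polynomial in the
  line parameter so that its degree, its derivative and its divisibility by powers of the parameter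
  can be used.\<close>

definition leval :: "('x \<Rightarrow> complex) \<Rightarrow> ('x \<Rightarrow> complex) \<Rightarrow> 'x mpoly \<Rightarrow> complex poly" where
  "leval a b f = insertion (\<lambda>c. [:c:]) (\<lambda>i. [:a i, b i:]) f"

global_interpretation lv: coeff_hom "\<lambda>c. [:c:]"
  by unfold_locales simp_all

lemma leval_simps:
  "leval a b (f + g) = leval a b f + leval a b g" "leval a b (f * g) = leval a b f * leval a b g"
  "leval a b (const c) = [:c:]" "leval a b (Var i) = [:a i, b i:]"
  "leval a b 0 = 0" "leval a b 1 = 1"
  by (simp_all add: leval_def lv.insertion_add lv.insertion_mult)

lemma poly_leval: "poly (leval a b f) t = eval (\<lambda>i. a i + t * b i) f"
  by (induction f rule: mpoly_induct)
    (simp_all add: leval_simps eval.insertion_add eval.insertion_mult algebra_simps)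

lemma eval_subst: "eval a (subst y f) = eval (\<lambda>i. eval a (y i)) f"
  by (induction f rule: mpoly_induct)
    (simp_all add: eval.insertion_add eval.insertion_mult subst.insertion_add subst.insertion_mult)

lemma subst_Var [simp]: "subst Var f = f"
  by (induction f rule: mpoly_induct)
    (simp_all add: subst.insertion_add subst.insertion_mult)

section \<open>Degrees and forms\<close>

definition deg :: "('x \<Rightarrow>\<^sub>0 nat) \<Rightarrow> nat" where
  "deg m = (\<Sum>i\<in>keys m. lookup m i)"

lemma deg_superset:
  assumes "finite S" "keys m \<subseteq> S"
  shows "deg m = (\<Sum>i\<in>S. lookup m i)"
  unfolding deg_def
  by (rule sum.mono_neutral_left) (use assms in \<open>auto simp: in_keys_iff\<close>)

lemma deg_zero [simp]: "deg 0 = 0"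
  by (simp add: deg_def)

lemma deg_single [simp]: "deg (single i k) = k"
  by (cases "k = 0") (simp_all add: deg_def)

lemma deg_add: "deg (m + m') = deg m + deg m'"
proof -
  let ?S = "keys m \<union> keys m'"
  have "finite ?S" "keys (m + m') \<subseteq> ?S"
    by (auto simp: in_keys_iff lookup_add)
  then show ?thesis
    by (simp add: deg_superset[of ?S] lookup_add sum.distrib)
qed

lemma deg_eq_0_iff [simp]: "deg m = 0 \<longleftrightarrow> m = 0"
  by (auto simp: deg_def in_keys_iff simp flip: keys_eq_empty)

lemma keys_add_nat: "keys (m + m' :: 'x \<Rightarrow>\<^sub>0 nat) = keys m \<union> keys m'"
  by (auto simp: in_keys_iff lookup_add)

lemma monomials_iff: "m \<in> monomials X d \<longleftrightarrow> keys m \<subseteq> X \<and> deg m = d"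
  by (simp add: monomials_def deg_def)

lemma monomials_add: "m \<in> monomials X d \<Longrightarrow> m' \<in> monomials X e \<Longrightarrow> m + m' \<in> monomials X (d + e)"
  by (auto simp: monomials_iff deg_add keys_add_nat)

lemma single_in_monomials: "i \<in> X \<Longrightarrow> single i k \<in> monomials X k"
  by (cases "k = 0") (simp_all add: monomials_iff)

lemma monomials_factor:
  assumes "m \<in> monomials X (Suc d)"
  obtains m' i where "m = m' + single i 1" "i \<in> X" "m' \<in> monomials X d"
proof -
  have "m \<noteq> 0" using assms by (auto simp: monomials_iff)
  then obtain i where i: "i \<in> keys m"
    using keys_eq_empty by blast
  define m' where "m' = m - single i 1"
  have m: "m = m' + single i 1"
    unfolding m'_def using i
    by (intro poly_mapping_eqI) (auto simp: lookup_add lookup_minus lookup_single when_def in_keys_iff)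
  show thesis
    by (rule that[OF m])
      (use assms i in \<open>auto simp: monomials_iff m keys_add_nat deg_add\<close>)
qed

lemma finite_monomials:
  assumes "finite X"
  shows "finite (monomials X d)"
proof (induction d)
  case 0
  show ?case by (rule finite_subset[of _ "{0}"]) (auto simp: monomials_iff)
next
  case (Suc d)
  have "monomials X (Suc d) \<subseteq> (\<lambda>(m, i). m + single i 1) ` (monomials X d \<times> X)"
    by (auto elim!: monomials_factor)
  then show ?case
    using Suc assms by (auto intro: finite_subset)
qed

lemma forms_iff: "f \<in> forms X d \<longleftrightarrow> (\<forall>m. lookup f m \<noteq> 0 \<longrightarrow> m \<in> monomials X d)"
  by (auto simp: forms_def in_keys_iff)

lemma lookup_scale [simp]: "lookup (scale c f) m = c * lookup f m"
proof -
  have "scale c f = single 0 c *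
      (\<Sum>m\<in>keys f. single m (lookup f m))"
    by (simp add: scale_def const_def flip: poly_mapping_eq_sum_single)
  then show ?thesis
    by (auto simp: sum_distrib_left mult_single lookup_sum lookup_single when_def in_keys_iff)
qed

lemma forms_0 [simp, intro]: "0 \<in> forms X d"
  by (simp add: forms_def)

lemma forms_add: "f \<in> forms X d \<Longrightarrow> g \<in> forms X d \<Longrightarrow> f + g \<in> forms X d"
  by (auto simp: forms_iff lookup_add) (metis add_0)

lemma forms_sum: "(\<And>i. i \<in> S \<Longrightarrow> h i \<in> forms X d) \<Longrightarrow> sum h S \<in> forms X d"
  by (induction S rule: infinite_finite_induct) (auto intro: forms_add)

lemma forms_scale: "f \<in> forms X d \<Longrightarrow> scale c f \<in> forms X d"
  by (auto simp: forms_iff)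

lemma forms_single: "m \<in> monomials X d \<Longrightarrow> single m c \<in> forms X d"
  by (auto simp: forms_iff lookup_single when_def)

lemma forms_const: "const c \<in> forms X 0"
  unfolding const_def by (rule forms_single) (simp add: monomials_iff)

lemma forms_Var: "i \<in> X \<Longrightarrow> Var i \<in> forms X 1"
  unfolding Var_def by (intro forms_single single_in_monomials)

lemma forms_mult: "f \<in> forms X d \<Longrightarrow> g \<in> forms X e \<Longrightarrow> f * g \<in> forms X (d + e)"
  using keys_mult[of f g] by (force simp: forms_def intro: monomials_add)

lemma forms_power: "f \<in> forms X d \<Longrightarrow> f ^ k \<in> forms X (k * d)"
  by (induction k) (use forms_const[of 1 X] in \<open>auto intro: forms_mult\<close>)

lemma forms_prod:
  "(\<And>i. i \<in> S \<Longrightarrow> h i \<in> forms X (e i)) \<Longrightarrow> finite S \<Longrightarrow> prod h S \<in> forms X (sum e S)"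
  by (induction S rule: infinite_finite_induct)
    (use forms_const[of 1 X] in \<open>auto intro: forms_mult\<close>)

lemma forms_mono: "X \<subseteq> Y \<Longrightarrow> f \<in> forms X d \<Longrightarrow> f \<in> forms Y d"
  by (auto simp: forms_iff monomials_iff)

lemma forms_subst:
  assumes "f \<in> forms X d" "\<And>i. i \<in> X \<Longrightarrow> y i \<in> forms Y 1"
  shows "subst y f \<in> forms Y d"
proof -
  have "const c * monom_eval y m \<in> forms Y d" if "m \<in> monomials X d" for m c
  proof -
    have "monom_eval y m \<in> forms Y (\<Sum>i\<in>keys m. lookup m i * 1)"
      unfolding monom_eval_def
      by (intro forms_prod forms_power assms) (use that in \<open>auto simp: monomials_iff\<close>)
    then show ?thesis
      using that by (auto simp: monomials_def simp flip: scale_def intro: forms_scale)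
  qed
  then show ?thesis
    using assms(1) unfolding subst_def
    by (intro forms_sum) (auto simp: forms_def simp flip: monom_eval_def)
qed

lemma monom_eval_cong:
  "(\<And>i. i \<in> keys m \<Longrightarrow> y i = z i) \<Longrightarrow> monom_eval y m = monom_eval z m"
  by (simp add: monom_eval_def)

lemma insertion_cong:
  assumes "f \<in> forms X d" "\<And>i. i \<in> X \<Longrightarrow> y i = z i"
  shows "insertion \<phi> y f = insertion \<phi> z f"
  unfolding insertion_def
proof (intro sum.cong refl arg_cong[where f = "times _"] monom_eval_cong assms(2))
  fix m i assume "m \<in> keys f" "i \<in> keys m"
  then show "i \<in> X" using assms(1) by (auto simp: forms_def monomials_def)
qed

lemma eval_eq_insertion: "eval y f = insertion (\<lambda>c. c) y f"
  by (simp add: insertion_def eval_def monom_eval_def)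

lemma subst_eq_insertion: "subst y f = insertion const y f"
  by (simp add: insertion_def subst_def monom_eval_def)

lemmas eval_cong = insertion_cong[where \<phi> = "\<lambda>c. c", folded eval_eq_insertion]
lemmas subst_cong = insertion_cong[where \<phi> = const, folded subst_eq_insertion]

lemma eval_homogeneous:
  assumes "f \<in> forms X d"
  shows "eval (\<lambda>i. c * a i) f = c ^ d * eval a f"
proof -
  have "monom_eval (\<lambda>i. c * a i) m = c ^ deg m * monom_eval a m" for m
    by (simp add: monom_eval_def deg_def power_mult_distrib prod.distrib power_sum)
  with assms show ?thesis
    unfolding eval_eq_insertion insertion_def sum_distrib_left
    by (intro sum.cong) (auto simp: forms_def monomials_iff)
qed

lemma degree_leval:
  assumes "f \<in> forms X d"
  shows "degree (leval a b f) \<le> d"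
  unfolding leval_def insertion_def
proof (rule degree_sum_le)
  fix m assume m: "m \<in> keys f"
  have "degree (\<Prod>i\<in>keys m. [:a i, b i:] ^ lookup m i)
      \<le> (\<Sum>i\<in>keys m. degree ([:a i, b i:] ^ lookup m i))"
    by (rule order_trans[OF degree_prod_sum_le]) (simp_all add: o_def)
  also have "\<dots> \<le> (\<Sum>i\<in>keys m. lookup m i)"
    by (intro sum_mono order_trans[OF degree_power_le]) simp
  finally show "degree ([:lookup f m:] * monom_eval (\<lambda>i. [:a i, b i:]) m) \<le> d"
    using m assms by (auto simp: forms_def monomials_def monom_eval_def)
qed simp

lemma linear_form_expand:
  assumes "f \<in> forms X 1" "finite X"
  shows "f = (\<Sum>i\<in>X. scale (lookup f (single i 1)) (Var i))"
proof (rule poly_mapping_eqI)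
  fix m
  have "inj_on (\<lambda>i::'a. single i (1::nat)) X"
    by (auto simp: inj_on_def dest: arg_cong[of _ _ keys])
  show "lookup f m = lookup
    (\<Sum>i\<in>X. scale (lookup f (single i 1)) (Var i)) m"
  proof (cases "m \<in> monomials X 1")
    case True
    then obtain m' i where m: "m = m' + single i 1" "i \<in> X" "m' \<in> monomials X 0"
      using monomials_factor by (metis One_nat_def)
    then have m': "m = single i 1" by (simp add: monomials_iff)
    have "single j (1::nat) = single i 1 \<longleftrightarrow> j = i" for j
      by (auto dest: arg_cong[of _ _ keys])
    then show ?thesis
      using assms m(2) by (auto simp: m' lookup_sum Var_def lookup_single when_def if_distrib cong: if_cong)
  next
    case False
    then have "m \<noteq> single i 1" if "i \<in> X" for i
      using that single_in_monomials by metis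
    then have "lookup (single (single i 1) (1::complex)) m = 0"
      if "i \<in> X" for i
      using that by (metis lookup_single_not_eq)
    then have "lookup (\<Sum>i\<in>X. scale (lookup f (single i 1)) (Var i)) m = 0"
      unfolding lookup_sum lookup_scale Var_def by (intro sum.neutral ballI) simp
    then show ?thesis using False assms by (auto simp: forms_iff)
  qed
qed

section \<open>Partial derivatives\<close>

lemma lookup_partial:
  "lookup (partial j f) m =
    of_nat (lookup m j + 1) * lookup f (m + single j 1)"
proof -
  \<comment> \<open>Truncated subtraction of \<open>single j 1\<close> is injective only on
    monomials that contain x_j, hence the second conjunct; the monomials that it excludes contribute
    a zero coefficient.\<close>
  have *: "(k - single j 1 = m \<and> lookup k j \<noteq> 0) \<longleftrightarrow> k = m + single j 1"
    for k :: "'a \<Rightarrow>\<^sub>0 nat"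
  proof
    assume "k - single j 1 = m \<and> lookup k j \<noteq> 0"
    then show "k = m + single j 1"
      by (intro poly_mapping_eqI)
        (auto simp: lookup_add lookup_minus lookup_single when_def)
  qed (simp add: lookup_add)
  have "lookup (partial j f) m = (\<Sum>k\<in>keys f.
      of_nat (lookup k j) * lookup f k when k - single j 1 = m)"
    unfolding partial_def lookup_sum lookup_single ..
  also have "\<dots> = (\<Sum>k\<in>keys f. if k = m + single j 1
      then of_nat (lookup m j + 1) * lookup f (m + single j 1) else 0)"
  proof (intro sum.cong refl)
    fix k
    show "(of_nat (lookup k j) * lookup f k when k - single j 1 = m) =
      (if k = m + single j 1
        then of_nat (lookup m j + 1) * lookup f (m + single j 1) else 0)"
      by (cases "lookup k j = 0"; cases "k = m + single j 1")
        (use *[of k] in \<open>simp_all add: when_def lookup_add del: One_nat_def\<close>)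
  qed
  also have "\<dots> = of_nat (lookup m j + 1) * lookup f (m + single j 1)"
    by (auto simp: in_keys_iff)
  finally show ?thesis .
qed

lemma partial_add: "partial j (f + g) = partial j f + partial j g"
  by (rule poly_mapping_eqI) (simp add: lookup_partial lookup_add algebra_simps)

lemma partial_scale: "partial j (scale c f) = scale c (partial j f)"
  by (rule poly_mapping_eqI) (simp add: lookup_partial algebra_simps)

lemma partial_0 [simp]: "partial j 0 = 0"
  by (rule poly_mapping_eqI) (simp add: lookup_partial)

lemma partial_sum: "partial j (sum h S) = (\<Sum>i\<in>S. partial j (h i))"
  by (induction S rule: infinite_finite_induct) (simp_all add: partial_add)

lemma partial_commute: "partial i (partial j f) = partial j (partial i f)"
  by (cases "i = j", simp, rule poly_mapping_eqI)
    (simp add: lookup_partial lookup_add lookup_single when_def algebra_simps)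

lemma partial_single:
  "partial j (single m c) =
    single (m - single j 1) (of_nat (lookup m j) * c)"
  by (cases "c = 0") (simp_all add: partial_def)

lemma partial_const [simp]: "partial j (const c) = 0"
  by (simp add: const_def partial_single)

lemma partial_Var: "partial j (Var i) = (if i = j then 1 else 0)"
  by (auto simp: Var_def partial_single lookup_single)

lemma partial_single_mult:
  "partial j (single m c * single m' c') =
    partial j (single m c) * single m' c' +
    single m c * partial j (single m' c')"
proof -
  let ?e = "single j (1::nat)"
  \<comment> \<open>With truncated subtraction this needs x_j to occur in \<open>k\<close>; if it
    does not, the corresponding term of the product rule is 0.\<close>
  have *: "k + k' - ?e = (k - ?e) + k'" if "lookup k j \<noteq> 0" for k k' :: "'a \<Rightarrow>\<^sub>0 nat"
    using that by (intro poly_mapping_eqI) (auto simp: lookup_add lookup_minus lookup_single when_def)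
  show ?thesis
    using *[of m m'] *[of m' m]
    by (cases "lookup m j = 0"; cases "lookup m' j = 0")
      (simp_all add: mult_single partial_single lookup_add algebra_simps flip: single_add)
qed

lemma partial_mult: "partial j (f * g) = partial j f * g + f * partial j g"
proof -
  let ?s = "\<lambda>f m. single m (lookup f m)"
  have "partial j ((\<Sum>m\<in>keys f. ?s f m) * (\<Sum>m\<in>keys g. ?s g m)) =
    partial j (\<Sum>m\<in>keys f. ?s f m) * (\<Sum>m\<in>keys g. ?s g m) +
    (\<Sum>m\<in>keys f. ?s f m) * partial j (\<Sum>m\<in>keys g. ?s g m)"
    unfolding sum_product partial_sum
    by (simp add: partial_single_mult sum.distrib)
  then show ?thesis
    by (simp flip: poly_mapping_eq_sum_single)
qed

lemma forms_partial:
  assumes "f \<in> forms X d"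
  shows "partial j f \<in> forms X (d - 1)"
  unfolding forms_iff
proof (intro allI impI)
  fix m assume "lookup (partial j f) m \<noteq> 0"
  then have "m + single j 1 \<in> monomials X d"
    using assms by (auto simp: lookup_partial forms_iff)
  then show "m \<in> monomials X (d - 1)"
    by (auto simp: monomials_iff keys_add_nat deg_add)
qed

lemma monom_eval_0: "monom_eval (\<lambda>_. 0 :: complex) m = (if m = 0 then 1 else 0)"
proof (cases "m = 0")
  case False
  then obtain i where "i \<in> keys m"
    using keys_eq_empty by blast
  with False show ?thesis
    by (auto simp: monom_eval_def in_keys_iff intro!: prod_zero bexI[of _ i])
qed simp

lemma eval_0: "eval (\<lambda>_. 0) f = lookup f 0"
  by (auto simp: eval_eq_insertion insertion_def monom_eval_0 if_distrib in_keys_iff cong: if_cong)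

text \<open>\<open>Dir n u (Dir n v f)\<close> is the value u^T H v of the bilinear form given by
  the Hessian H of f, so two vectors are orthogonal for H iff this polynomial vanishes.\<close>

definition Dir :: "nat \<Rightarrow> (nat \<Rightarrow> complex) \<Rightarrow> nat mpoly \<Rightarrow> nat mpoly" where
  "Dir n u f = (\<Sum>i\<le>n. scale (u i) (partial i f))"

lemma Dir_add: "Dir n u (f + g) = Dir n u f + Dir n u g"
  by (simp add: Dir_def partial_add mpoly.scale_right_distrib sum.distrib)

lemma Dir_0 [simp]: "Dir n u 0 = 0"
  by (simp add: Dir_def)

lemma Dir_sum: "Dir n u (sum h S) = (\<Sum>i\<in>S. Dir n u (h i))"
  by (induction S rule: infinite_finite_induct) (simp_all add: Dir_add)

lemma Dir_scale: "Dir n u (scale c f) = scale c (Dir n u f)"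
  by (simp add: Dir_def partial_scale mpoly.scale_sum_right mult.commute)

lemma Dir_mult: "Dir n u (f * g) = Dir n u f * g + f * Dir n u g"
  by (simp add: Dir_def partial_mult scale_def algebra_simps sum.distrib sum_distrib_left sum_distrib_right)

lemma Dir_commute: "Dir n u (Dir n v f) = Dir n v (Dir n u f)"
proof -
  have "Dir n u (Dir n v f) = (\<Sum>i\<le>n. \<Sum>j\<le>n. scale (u i * v j) (partial i (partial j f)))"
    by (simp add: Dir_def partial_sum partial_scale mpoly.scale_sum_right)
  also have "\<dots> = (\<Sum>j\<le>n. \<Sum>i\<le>n. scale (v j * u i) (partial j (partial i f)))"
    by (subst sum.swap) (simp add: mult.commute partial_commute)
  also have "\<dots> = Dir n v (Dir n u f)"
    by (simp add: Dir_def partial_sum partial_scale mpoly.scale_sum_right)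
  finally show ?thesis .
qed

lemma Dir_lincomb: "Dir n (\<lambda>i. \<Sum>k\<in>S. c k * w k i) f = (\<Sum>k\<in>S. scale (c k) (Dir n (w k) f))"
  unfolding Dir_def mpoly.scale_sum_right
  by (subst sum.swap) (simp add: mpoly.scale_sum_left)

lemma Dir_unit: "j \<le> n \<Longrightarrow> Dir n (\<lambda>i. if i = j then 1 else 0) f = partial j f"
  by (simp add: Dir_def if_distrib[where f = "\<lambda>c. scale c _"] cong: if_cong)

lemma Dir_cong: "(\<And>i. i \<le> n \<Longrightarrow> u i = v i) \<Longrightarrow> Dir n u f = Dir n v f"
  by (simp add: Dir_def)

lemma forms_Dir: "f \<in> forms X d \<Longrightarrow> Dir n u f \<in> forms X (d - 1)"
  unfolding Dir_def by (intro forms_sum forms_scale forms_partial)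

text \<open>Chain rule along a line. The entries of \<open>u\<close> beyond \<open>n\<close> must be
  0, since \<open>f\<close> may contain variables beyond \<open>n\<close>, in which
  \<open>Dir n u\<close> does not differentiate.\<close>

lemma pderiv_leval:
  assumes "\<And>i. i > n \<Longrightarrow> u i = 0"
  shows "pderiv (leval a u f) = leval a u (Dir n u f)"
proof (induction f rule: mpoly_induct)
  case (const c)
  then show ?case by (simp add: leval_simps Dir_def)
next
  case (Var i)
  have "Dir n u (Var i) = const (u i)"
    using assms by (auto simp: Dir_def partial_Var scale_def if_distrib not_le cong: if_cong)
  then show ?case by (simp add: leval_simps pderiv_pCons)
next
  case (add f g)
  then show ?case by (simp add: leval_simps Dir_add pderiv_add)
next
  case (mult f g)
  then show ?case by (simp add: leval_simps Dir_mult pderiv_mult algebra_simps)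
qed

text \<open>If a polynomial vanishes on every line, so do its partial derivatives. Differentiating
  therefore moves any coefficient, up to a positive integer factor, into the constant term, which is
  the value at the origin.\<close>

lemma eval_eq_0_imp:
  fixes f :: "nat mpoly"
  assumes "\<And>a. eval a f = 0"
  shows "f = 0"
proof -
  have "lookup f m = 0" for m
    using assms
  proof (induction "deg m" arbitrary: m f)
    case 0
    then show ?case using eval_0[of f] by simp
  next
    case (Suc k)
    then have "m \<in> monomials UNIV (Suc k)" by (simp add: monomials_iff)
    then obtain m' j where m: "m = m' + single j 1" "m' \<in> monomials UNIV k"
      by (rule monomials_factor)
    let ?e = "\<lambda>i. if i = j then 1 else 0 :: complex"
    have "eval a (partial j f) = 0" for a
    proof -
      have "leval a ?e f = 0"
        using Suc.prems by (intro poly_all_0_iff_0[THEN iffD1]) (simp add: poly_leval)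
      then have "leval a ?e (partial j f) = 0"
        using pderiv_leval[of j ?e a f] by (simp add: Dir_unit)
      then show ?thesis
        using poly_leval[of a ?e "partial j f" 0] by simp
    qed
    then have "lookup (partial j f) m' = 0"
      using Suc.hyps(1)[of m'] m(2) by (simp add: monomials_iff)
    then have "of_nat (lookup m' j + 1) * lookup f m = 0"
      by (simp only: lookup_partial m(1))
    then show ?case by (simp only: mult_eq_0_iff of_nat_eq_0_iff) simp
  qed
  then show ?thesis by (intro poly_mapping_eqI) simp
qed

lemma mpoly_eqI:
  fixes f g :: "nat mpoly"
  assumes "\<And>a. eval a f = eval a g"
  shows "f = g"
  using eval_eq_0_imp[of "f - g"] assms by (simp add: eval.insertion_diff)

text \<open>A zero derivative along u makes f constant on each line with direction u. With its
  converse below, this turns conditions on derivatives into statements about values.\<close>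

lemma Dir_eq_0_imp_invariant:
  assumes "Dir n u f = 0" "\<And>i. i > n \<Longrightarrow> u i = 0"
  shows "eval (\<lambda>i. a i + t * u i) f = eval a f"
proof -
  have "pderiv (leval a u f) = 0"
    using assms(1) by (simp add: pderiv_leval[where n = n and u = u, OF assms(2)] leval_simps)
  then obtain c where "leval a u f = [:c:]"
    by (metis degree_eq_zeroE pderiv_eq_0_iff)
  then show ?thesis
    using poly_leval[of a u f t] poly_leval[of a u f 0] by simp
qed

lemma invariant_imp_Dir_eq_0:
  assumes "\<And>a t. eval (\<lambda>i. a i + t * u i) f = eval a f" "\<And>i. i > n \<Longrightarrow> u i = 0"
  shows "Dir n u f = 0"
proof (rule eval_eq_0_imp)
  fix a
  have "leval a u f = [:eval a f:]"
    unfolding poly_eq_poly_eq_iff[symmetric] fun_eq_iff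
    by (simp add: poly_leval assms(1))
  then show "eval a (Dir n u f) = 0"
    using poly_leval[of a u "Dir n u f" 0] pderiv_leval[where n = n and u = u and a = a and f = f, OF assms(2)] by simp
qed

text \<open>On each line with direction u the second derivative is 0, so f is affine there; value
  and slope at the parameter 0 are the two coefficients.\<close>

lemma Dir_Dir_eq_0_expand:
  assumes "Dir n u (Dir n u f) = 0" "\<And>i. i > n \<Longrightarrow> u i = 0"
  shows "eval (\<lambda>i. a i + t * u i) f = eval a f + t * eval a (Dir n u f)"
proof -
  let ?p = "leval a u f"
  have "pderiv (pderiv ?p) = 0"
    using assms(1) by (simp add: pderiv_leval[where n = n and u = u, OF assms(2)] leval_simps)
  then have "degree ?p \<le> 1"
    by (simp add: pderiv_eq_0_iff degree_pderiv)
  then obtain b c where p: "?p = [:b, c:]"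
    by (cases ?p, rename_tac c q, case_tac q) (auto split: if_splits)
  have "eval a f = b" using poly_leval[of a u f 0] p by simp
  moreover have "eval a (Dir n u f) = c"
    using poly_leval[of a u "Dir n u f" 0] pderiv_leval[where n = n and u = u and a = a and f = f, OF assms(2)]
    unfolding p by (auto simp: pderiv_pCons dest: arg_cong[of _ _ "\<lambda>p. poly p 0"])
  ultimately show ?thesis
    using poly_leval[of a u f t] p by simp
qed

section \<open>Sebastiani-Thom type in terms of second derivatives\<close>

lemma left_inverse_imp_right_inverse:
  fixes P Q :: "nat \<Rightarrow> nat \<Rightarrow> complex"
  assumes "\<And>i j. i \<le> n \<Longrightarrow> j \<le> n \<Longrightarrow> (\<Sum>k\<le>n. P i k * Q k j) = (if i = j then 1 else 0)"
    and "i \<le> n" "j \<le> n"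
  shows "(\<Sum>k\<le>n. Q i k * P k j) = (if i = j then 1 else 0)"
proof -
  define M where "M P = mat (Suc n) (Suc n) (\<lambda>(i, j). P i j)" for P :: "nat \<Rightarrow> nat \<Rightarrow> complex"
  have car: "M P \<in> carrier_mat (Suc n) (Suc n)" for P by (simp add: M_def)
  have prod: "(M P * M Q) $$ (i, j) = (\<Sum>k\<le>n. P i k * Q k j)" if "i \<le> n" "j \<le> n" for P Q i j
    using that by (simp add: M_def scalar_prod_def lessThan_Suc_atMost atLeast0LessThan)
  have "M P * M Q = 1\<^sub>m (Suc n)"
    by (rule eq_matI) (use assms(1) in \<open>auto simp: prod less_Suc_eq_le\<close>, simp_all add: M_def)
  then have "M Q * M P = 1\<^sub>m (Suc n)"
    by (rule mat_mult_left_right_inverse[OF car car])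
  with prod[OF assms(2,3), of Q P] assms(2,3) show ?thesis by simp
qed

section \<open>Linear forms, bases and dual bases\<close>

definition lin :: "nat \<Rightarrow> (nat \<Rightarrow> complex) \<Rightarrow> nat mpoly" where
  "lin n u = (\<Sum>i\<le>n. scale (u i) (Var i))"

text \<open>Vectors with n + 1 entries are carried by linear forms, so that span, independence and
  dimension counts in the vector space of polynomials apply to them; \<open>lin\<close> and
  \<open>coef\<close> translate between the two.\<close>

definition coef :: "nat mpoly \<Rightarrow> nat \<Rightarrow> complex" where
  "coef f i = lookup f (single i 1)"

lemma lin_coef: "f \<in> forms {..n} 1 \<Longrightarrow> lin n (coef f) = f"
  using linear_form_expand[of f "{..n}"] by (simp add: lin_def coef_def)

lemma coef_Var [simp]: "coef (Var i) j = (if i = j then 1 else 0)"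
  by (auto simp: coef_def Var_def lookup_single when_def dest: arg_cong[of _ _ keys])

lemma coef_add [simp]: "coef (f + g) i = coef f i + coef g i"
  by (simp add: coef_def lookup_add)

lemma coef_scale [simp]: "coef (scale c f) i = c * coef f i"
  by (simp add: coef_def)

lemma coef_sum [simp]: "coef (sum h S) i = (\<Sum>k\<in>S. coef (h k) i)"
  by (simp add: coef_def lookup_sum)

lemma coef_lin [simp]: "coef (lin n u) i = (if i \<le> n then u i else 0)"
  by (simp add: lin_def if_distrib cong: if_cong)

lemma eval_lin: "eval a (lin n u) = (\<Sum>i\<le>n. u i * a i)"
  by (simp add: lin_def eval.insertion_sum eval.insertion_scale)

lemma lin_in_forms: "lin n u \<in> forms {..n} 1"
  unfolding lin_def by (intro forms_sum forms_scale forms_Var) simp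

lemma inj_Var: "inj (Var :: nat \<Rightarrow> nat mpoly)"
proof (rule injI)
  fix x y :: nat assume "Var x = (Var y :: nat mpoly)"
  then have "coef (Var x) y = coef (Var y) y" by simp
  then show "x = y" by (simp split: if_splits)
qed

lemma sum_scale_reindex:
  "inj_on y S \<Longrightarrow> (\<Sum>v\<in>y ` S. scale (c v) v) = (\<Sum>i\<in>S. scale (c (y i)) (y i))"
  by (simp add: sum.reindex)

lemma subspace_forms: "mpoly.subspace (forms X d)"
  by (auto simp: mpoly.subspace_def intro: forms_add forms_scale)

lemma span_Var: "mpoly.span (Var ` {..n::nat}) = forms {..n} 1"
proof
  show "mpoly.span (Var ` {..n}) \<subseteq> forms {..n} 1"
    using forms_Var[of _ "{..n}"] by (intro mpoly.span_minimal subspace_forms) auto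
  show "forms {..n} 1 \<subseteq> mpoly.span (Var ` {..n})"
  proof
    fix f :: "nat mpoly" assume "f \<in> forms {..n} 1"
    moreover have "lin n (coef f) \<in> mpoly.span (Var ` {..n})"
      unfolding lin_def by (intro mpoly.span_sum mpoly.span_scale mpoly.span_base) auto
    ultimately show "f \<in> mpoly.span (Var ` {..n})" by (simp add: lin_coef)
  qed
qed

lemma independent_Var: "mpoly.independent (Var ` {..n::nat})"
proof -
  have "c v = 0" if "(\<Sum>v\<in>Var ` {..n}. scale (c v) v) = 0" and v: "v \<in> Var ` {..n}" for c v
  proof -
    have "(\<Sum>i\<le>n. scale (c (Var i)) (Var i)) = 0"
      using that(1) by (simp add: sum_scale_reindex inj_on_subset[OF inj_Var])
    moreover obtain j where j: "v = Var j" "j \<le> n" using v by auto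
    moreover from j have "coef (\<Sum>i\<le>n. scale (c (Var i)) (Var i)) j = c v"
      by (simp add: if_distrib cong: if_cong)
    ultimately show ?thesis by (simp add: coef_def)
  qed
  then show ?thesis
    using mpoly.dependent_finite[of "Var ` {..n}"] by auto
qed

lemma card_Var: "card (Var ` {..n::nat}) = Suc n"
  by (simp add: card_image inj_on_subset[OF inj_Var])

text \<open>Dimension count: a basis chosen among the \<open>y i\<close> has at least n + 1
  elements, because it spans all variables, and at most n + 1; so it consists of all
  \<open>y i\<close>, and these are distinct.\<close>

lemma spanning_imp_ordered_basis:
  assumes "\<And>i. i \<le> n \<Longrightarrow> y i \<in> forms {..n} 1" "\<And>i. i \<le> n \<Longrightarrow> Var i \<in> mpoly.span (y ` {..n})"
  shows "ordered_basis n y (forms {..n} 1)"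
proof -
  obtain B where B: "B \<subseteq> y ` {..n}" "mpoly.independent B" "y ` {..n} \<subseteq> mpoly.span B"
    using mpoly.maximal_independent_subset by blast
  have fB: "finite B" using B(1) finite_subset by blast
  have "mpoly.span (y ` {..n}) \<subseteq> mpoly.span B"
    using B(3) by (simp add: mpoly.span_minimal)
  then have "Var ` {..n} \<subseteq> mpoly.span B" using assms(2) by auto
  then have "Suc n \<le> card B"
    using mpoly.independent_span_bound[OF fB independent_Var] by (simp add: card_Var)
  moreover have "card (y ` {..n}) \<le> Suc n"
    using card_image_le[of "{..n}" y] by simp
  ultimately have eq: "B = y ` {..n}"
    by (intro card_subset_eq) (use B(1) card_mono[OF _ B(1)] in auto)
  then have "card (y ` {..n}) = card {..n}"
    using \<open>Suc n \<le> card B\<close> \<open>card (y ` {..n}) \<le> Suc n\<close> by simp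
  then have "inj_on y {..n}" by (rule eq_card_imp_inj_on[OF finite_atMost])
  moreover have "mpoly.span (y ` {..n}) = forms {..n} 1"
  proof
    show "mpoly.span (y ` {..n}) \<subseteq> forms {..n} 1"
      using assms(1) by (intro mpoly.span_minimal subspace_forms) auto
    show "forms {..n} 1 \<subseteq> mpoly.span (y ` {..n})"
      unfolding span_Var[symmetric] using assms(2) by (intro mpoly.span_minimal) auto
  qed
  ultimately show ?thesis using B(2) eq by (simp add: ordered_basis_def)
qed

text \<open>\<open>Y j\<close> is the j-th coordinate form and \<open>w j\<close> the j-th basis
  vector. The condition is the resolution of the identity by the pairs (Y_j, w_j), from which the
  pairing relations follow because the matrices are square. The vectors are 0 beyond
  \<open>n\<close> in order to be admissible directions in the chain rule.\<close>

definition dual_bases :: "nat \<Rightarrow> (nat \<Rightarrow> nat \<Rightarrow> complex) \<Rightarrow> (nat \<Rightarrow> nat \<Rightarrow> complex) \<Rightarrow> bool" where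
  "dual_bases n Y w \<longleftrightarrow> (\<forall>k>n. \<forall>j. w j k = 0) \<and>
    (\<forall>i\<le>n. \<forall>k\<le>n. (\<Sum>j\<le>n. Y j i * w j k) = (if i = k then 1 else 0))"

lemma dual_bases_pairing:
  assumes "dual_bases n Y w" "j \<le> n" "k \<le> n"
  shows "(\<Sum>i\<le>n. Y j i * w k i) = (if j = k then 1 else 0)"
proof -
  have "(\<Sum>i\<le>n. w k i * Y j i) = (if k = j then 1 else 0)"
    by (rule left_inverse_imp_right_inverse[where P = "\<lambda>i j. Y j i"])
      (use assms in \<open>auto simp: dual_bases_def\<close>)
  then show ?thesis by (simp add: mult.commute eq_commute[of j])
qed

lemma dual_bases_imp_ordered_basis:
  assumes "dual_bases n Y w"
  shows "ordered_basis n (\<lambda>j. lin n (Y j)) (forms {..n} 1)"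
proof (rule spanning_imp_ordered_basis)
  fix i assume i: "i \<le> n"
  have "Var i = (\<Sum>j\<le>n. scale (w j i) (lin n (Y j)))"
  proof -
    have "(\<Sum>j\<le>n. scale (w j i) (lin n (Y j))) = lin n (\<lambda>k. \<Sum>j\<le>n. Y j k * w j i)"
      unfolding lin_def mpoly.scale_sum_right mpoly.scale_sum_left
      by (subst sum.swap) (simp add: mult.commute)
    also have "\<dots> = lin n (coef (Var i))"
      using assms i by (simp add: lin_def dual_bases_def eq_commute[of i])
    also have "\<dots> = Var i"
      using i by (intro lin_coef forms_Var) simp
    finally show ?thesis by simp
  qed
  also have "\<dots> \<in> mpoly.span ((\<lambda>j. lin n (Y j)) ` {..n})"
    by (intro mpoly.span_sum mpoly.span_scale mpoly.span_base) auto
  finally show "Var i \<in> mpoly.span ((\<lambda>j. lin n (Y j)) ` {..n})" .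
qed (rule lin_in_forms)

lemma ordered_basis_imp_dual_bases:
  assumes "ordered_basis n y (forms {..n} 1)"
  obtains w where "dual_bases n (\<lambda>j. coef (y j)) w"
proof -
  have y: "inj_on y {..n}" "mpoly.span (y ` {..n}) = forms {..n} 1"
    using assms by (auto simp: ordered_basis_def)
  have "\<exists>c. Var i = (\<Sum>k\<le>n. scale (c k) (y k))" if "i \<le> n" for i
  proof -
    have "Var i \<in> mpoly.span (y ` {..n})" using that y(2) forms_Var[of i "{..n}"] by simp
    then obtain u where "Var i = (\<Sum>v\<in>y ` {..n}. scale (u v) v)"
      by (auto simp: mpoly.span_finite)
    then show ?thesis using sum_scale_reindex[OF y(1), of u] by (auto intro!: exI[of _ "\<lambda>k. u (y k)"])
  qed
  then obtain c where c: "Var i = (\<Sum>k\<le>n. scale (c i k) (y k))" if "i \<le> n" for i by metis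
  have "dual_bases n (\<lambda>j. coef (y j)) (\<lambda>j k. if k \<le> n then c k j else 0)"
    unfolding dual_bases_def
  proof (intro conjI allI impI)
    fix i k assume "i \<le> n" "k \<le> n"
    then have "coef (Var k) i = (\<Sum>j\<le>n. c k j * coef (y j) i)"
      by (subst c) simp_all
    then show "(\<Sum>j\<le>n. coef (y j) i * (if k \<le> n then c k j else 0)) = (if i = k then 1 else 0)"
      using \<open>k \<le> n\<close> by (simp add: mult.commute eq_commute[of i])
  qed simp
  then show thesis by (rule that)
qed

section \<open>Decompositions as orthogonal splittings of the Hessian form\<close>

lemma ST_type_imp_splitting:
  assumes "ST_type n d f"
  obtains Y w l where "dual_bases n Y w" "l < n"
    "\<forall>a\<le>l. \<forall>b\<le>n. l < b \<longrightarrow> Dir n (w a) (Dir n (w b) f) = 0"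
proof -
  from assms obtain y l p q where y: "ordered_basis n y (forms {..n} 1)" and l: "l < n"
    and p: "p \<in> forms {..l} d" and q: "q \<in> forms {l<..n} d" and f: "f = subst y p + subst y q"
    unfolding ST_type_def by blast
  obtain w where w: "dual_bases n (\<lambda>j. coef (y j)) w"
    using ordered_basis_imp_dual_bases[OF y] .
  have supp: "w j k = 0" if "k > n" for j k
    using w that unfolding dual_bases_def by blast
  have ylin: "y j = lin n (coef (y j))" if "j \<le> n" for j
  proof -
    have "y j \<in> mpoly.span (y ` {..n})"
      using that by (intro mpoly.span_base) simp
    then have "y j \<in> forms {..n} 1"
      using y unfolding ordered_basis_def by blast
    then show ?thesis by (rule lin_coef[symmetric])
  qed
  have shift: "eval (\<lambda>i. a i + t * w b i) (y j) = eval a (y j)"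
    if "j \<le> n" "b \<le> n" "j \<noteq> b" for a t b j
  proof -
    have "(\<Sum>i\<le>n. coef (y j) i * (a i + t * w b i)) =
      (\<Sum>i\<le>n. coef (y j) i * a i) + t * (\<Sum>i\<le>n. coef (y j) i * w b i)"
      by (simp add: algebra_simps sum.distrib sum_distrib_left)
    then show ?thesis
      using that by (subst (1 2) ylin) (simp_all add: eval_lin dual_bases_pairing[OF w])
  qed
  \<comment> \<open>Moving along \<open>w b\<close> changes only the coordinate y_b, which does not
    occur in \<open>r\<close>.\<close>
  have inv: "Dir n (w b) (subst y r) = 0"
    if "r \<in> forms X d" "b \<le> n" "b \<notin> X" "X \<subseteq> {..n}" for X b r
  proof (rule invariant_imp_Dir_eq_0)
    fix a t
    show "eval (\<lambda>i. a i + t * w b i) (subst y r) = eval a (subst y r)"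
      unfolding eval_subst using that by (intro eval_cong[OF that(1)] shift) auto
  qed (rule supp)
  have "\<forall>a\<le>l. \<forall>b\<le>n. l < b \<longrightarrow> Dir n (w a) (Dir n (w b) f) = 0"
  proof (intro allI impI)
    fix a b assume that: "a \<le> l" "b \<le> n" "l < b"
    \<comment> \<open>The mixed derivative kills one summand through each of its two
      directions.\<close>
    have "Dir n (w b) (subst y p) = 0" "Dir n (w a) (subst y q) = 0"
      using that l by (auto intro!: inv[OF p] inv[OF q])
    then show "Dir n (w a) (Dir n (w b) f) = 0"
      unfolding f Dir_add by (simp add: Dir_commute[of n "w a"])
  qed
  with w l show thesis by (rule that)
qed

text \<open>As the mixed derivative along u and v vanishes, t -> f(u + t v) and t -> f(t v) have the
  same derivative and differ by a constant; comparing t = 0 with t = 1 gives the identity, where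
  \<open>lookup f 0\<close> is f(0).\<close>

lemma eval_split:
  assumes "Dir n u (Dir n v f) = 0" "\<And>i. i > n \<Longrightarrow> u i = 0" "\<And>i. i > n \<Longrightarrow> v i = 0"
  shows "eval (\<lambda>i. u i + v i) f + lookup f 0 = eval u f + eval v f"
proof -
  let ?p = "leval u v f" and ?q = "leval (\<lambda>_. 0) v f"
  have "leval u v (Dir n v f) = leval (\<lambda>_. 0) v (Dir n v f)"
    unfolding poly_eq_poly_eq_iff[symmetric] fun_eq_iff poly_leval
    using Dir_eq_0_imp_invariant[OF assms(1,2), where t = 1]
    by (metis (no_types, lifting) ext add.commute add_0 mult_1)
  then have "pderiv (?p - ?q) = 0"
    by (simp add: pderiv_diff pderiv_leval[where n = n and u = v, OF assms(3)])
  then obtain c where "?p - ?q = [:c:]"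
    by (metis degree_eq_zeroE pderiv_eq_0_iff)
  then have "poly (?p - ?q) 1 = poly (?p - ?q) 0" by simp
  then show ?thesis
    by (simp add: poly_leval eval_0 algebra_simps)
qed

text \<open>Every vector is u + v with u in the span of w_0, ..., w_l and v in the span of the other
  basis vectors, and then f(u + v) = f(u) + f(v). The summands p and q are the restrictions of f to
  these two subspaces, written in the coordinates dual to \<open>w\<close>.\<close>

lemma splitting_imp_ST_type:
  assumes f: "f \<in> forms {..n} d" "d \<ge> 1" and w: "dual_bases n Y w" and l: "l < n"
    and split: "\<And>a b. a \<le> l \<Longrightarrow> l < b \<Longrightarrow> b \<le> n \<Longrightarrow> Dir n (w a) (Dir n (w b) f) = 0"
  shows "ST_type n d f"
proof -
  define y where "y j = lin n (Y j)" for j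
  define p where "p = subst (\<lambda>i. \<Sum>k\<le>l. scale (w k i) (Var k)) f"
  define q where "q = subst (\<lambda>i. \<Sum>k\<in>{l<..n}. scale (w k i) (Var k)) f"
  have p: "p \<in> forms {..l} d" and q: "q \<in> forms {l<..n} d"
    unfolding p_def q_def
    by (auto intro!: forms_subst[OF f(1)] forms_sum forms_scale forms_Var[simplified])
  have supp: "w j k = 0" if "k > n" for j k
    using w that unfolding dual_bases_def by blast
  have "f = subst y p + subst y q"
  proof (rule mpoly_eqI)
    fix a
    let ?c = "\<lambda>k. eval a (y k)"
    let ?u = "\<lambda>i. \<Sum>k\<le>l. ?c k * w k i" and ?v = "\<lambda>i. \<Sum>k\<in>{l<..n}. ?c k * w k i"
    have un: "{..n} = {..l} \<union> {l<..n}" using l by auto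
    have uv: "?u i + ?v i = a i" if "i \<le> n" for i
    proof -
      have "?u i + ?v i = (\<Sum>k\<le>n. ?c k * w k i)"
        unfolding un by (subst sum.union_disjoint) auto
      also have "\<dots> = (\<Sum>j\<le>n. a j * (\<Sum>k\<le>n. Y k j * w k i))"
        unfolding y_def eval_lin sum_distrib_left sum_distrib_right
        by (subst sum.swap) (simp add: mult_ac)
      also have "\<dots> = (\<Sum>j\<le>n. if j = i then a j else 0)"
        using w that by (intro sum.cong) (auto simp: dual_bases_def)
      finally show ?thesis using that by simp
    qed
    have "Dir n ?u (Dir n ?v f) = 0"
      by (simp add: Dir_lincomb Dir_sum Dir_scale split)
    then have "eval (\<lambda>i. ?u i + ?v i) f + lookup f 0 = eval ?u f + eval ?v f"
      by (rule eval_split) (simp_all add: supp)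
    \<comment> \<open>The constant term, which the splitting would count twice, is 0 because d >=
      1.\<close>
    moreover have "lookup f 0 = 0"
      using f by (fastforce simp: forms_iff monomials_iff)
    moreover have "eval (\<lambda>i. ?u i + ?v i) f = eval a f"
      by (rule eval_cong[OF f(1)]) (simp add: uv)
    ultimately have "eval a f = eval ?u f + eval ?v f" by simp
    also have "\<dots> = eval a (subst y p + subst y q)"
      by (simp add: p_def q_def eval_subst eval.insertion_add eval.insertion_sum eval.insertion_scale mult.commute)
    finally show "eval a f = eval a (subst y p + subst y q)" .
  qed
  moreover have "ordered_basis n y (forms {..n} 1)"
    unfolding y_def using w by (rule dual_bases_imp_ordered_basis)
  ultimately show ?thesis
    unfolding ST_type_def using p q l by blast
qed

text \<open>With \<open>H\<close> the Hessian matrix of \<open>f\<close>, this says that \<open>A H\<close> is symmetric.\<close>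

definition self_adjoint :: "nat \<Rightarrow> (nat \<Rightarrow> nat \<Rightarrow> complex) \<Rightarrow> nat mpoly \<Rightarrow> bool" where
  "self_adjoint n A f \<longleftrightarrow>
    (\<forall>i\<le>n. \<forall>j\<le>n. partial j (Dir n (A i) f) = partial i (Dir n (A j) f))"

definition scalar_matrix :: "nat \<Rightarrow> (nat \<Rightarrow> nat \<Rightarrow> complex) \<Rightarrow> bool" where
  "scalar_matrix n A \<longleftrightarrow> (\<exists>c. \<forall>i\<le>n. \<forall>j\<le>n. A i j = (if i = j then c else 0))"

text \<open>The witness is the transpose of the projection onto the span of w_0, ..., w_l along the
  remaining basis vectors. It is self-adjoint because the two subspaces are orthogonal for the
  Hessian form, and it is not scalar because both are nonzero.\<close>

lemma ST_type_imp_self_adjoint: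
  assumes "ST_type n d f"
  shows "\<exists>A. self_adjoint n A f \<and> \<not> scalar_matrix n A"
proof -
  obtain Y w l where w: "dual_bases n Y w" and l: "l < n"
    and split: "\<forall>a\<le>l. \<forall>b\<le>n. l < b \<longrightarrow> Dir n (w a) (Dir n (w b) f) = 0"
    using ST_type_imp_splitting[OF assms] .
  define A where "A i j = (\<Sum>m\<le>l. Y m i * w m j)" for i j
  have part: "partial j F = (\<Sum>m\<le>n. scale (Y m j) (Dir n (w m) F))" if "j \<le> n" for j F
  proof -
    have "partial j F = Dir n (\<lambda>i. \<Sum>m\<le>n. Y m j * w m i) F"
      unfolding Dir_unit[OF that, symmetric] using w that
      by (intro Dir_cong) (auto simp: dual_bases_def)
    then show ?thesis by (simp add: Dir_lincomb)
  qed
  have split': "Dir n (w b) (Dir n (w a) f) = 0" if "a \<le> l" "\<not> b \<le> l" "b \<le> n" for a b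
    using split that by (subst Dir_commute) auto
  \<comment> \<open>After expansion in the basis \<open>w\<close> the mixed terms drop out, and what
    is left is symmetric in i and j.\<close>
  have *: "partial j (Dir n (A i) f) =
    (\<Sum>m'\<le>l. \<Sum>m\<le>l. scale (Y m' j * Y m i) (Dir n (w m') (Dir n (w m) f)))" if "j \<le> n" for i j
  proof -
    have "partial j (Dir n (A i) f) =
      (\<Sum>m'\<le>n. \<Sum>m\<le>l. scale (Y m' j * Y m i) (Dir n (w m') (Dir n (w m) f)))"
      unfolding part[OF that] A_def
      by (simp add: Dir_lincomb Dir_sum Dir_scale mpoly.scale_sum_right)
    also have "\<dots> = (\<Sum>m'\<le>l. \<Sum>m\<le>l. scale (Y m' j * Y m i) (Dir n (w m') (Dir n (w m) f)))"
      using l split'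
      by (intro sum.mono_neutral_right) (auto intro!: sum.neutral)
    finally show ?thesis .
  qed
  have "self_adjoint n A f"
    unfolding self_adjoint_def
  proof (intro allI impI)
    fix i j assume "i \<le> n" "j \<le> n"
    then show "partial j (Dir n (A i) f) = partial i (Dir n (A j) f)"
      using * by (subst (1 2) *) (simp_all, subst sum.swap, simp add: Dir_commute mult.commute)
  qed
  moreover have "\<not> scalar_matrix n A"
  proof
    assume "scalar_matrix n A"
    then obtain c where c: "\<And>i j. i \<le> n \<Longrightarrow> j \<le> n \<Longrightarrow> A i j = (if i = j then c else 0)"
      unfolding scalar_matrix_def by blast
    \<comment> \<open>Pairing \<open>A\<close> with \<open>w k\<close> and \<open>Y k\<close> gives
      1 on the first subspace and 0 on the second, whereas a scalar matrix would give the same value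
      for k = 0 and k = n.\<close>
    have s1: "(\<Sum>i\<le>n. \<Sum>j\<le>n. w k i * A i j * Y k j) = (if k \<le> l then 1 else 0)" if "k \<le> n" for k
    proof -
      have "(\<Sum>i\<le>n. \<Sum>j\<le>n. w k i * A i j * Y k j) =
        (\<Sum>i\<le>n. \<Sum>j\<le>n. \<Sum>m\<le>l. (Y m i * w k i) * (Y k j * w m j))"
        by (simp add: A_def sum_distrib_left sum_distrib_right mult_ac)
      also have "\<dots> = (\<Sum>m\<le>l. (\<Sum>i\<le>n. Y m i * w k i) * (\<Sum>j\<le>n. Y k j * w m j))"
        unfolding sum_product by (subst sum.swap, subst (2) sum.swap, subst sum.swap) (intro sum.cong refl sum.swap)
      also have "\<dots> = (\<Sum>m\<le>l. if m = k then 1 else 0)"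
        using l that by (intro sum.cong) (auto simp: dual_bases_pairing[OF w])
      finally show ?thesis by simp
    qed
    have s2: "(\<Sum>i\<le>n. \<Sum>j\<le>n. w k i * A i j * Y k j) = c" if "k \<le> n" for k
    proof -
      have "(\<Sum>i\<le>n. \<Sum>j\<le>n. w k i * A i j * Y k j) = (\<Sum>i\<le>n. \<Sum>j\<le>n. if i = j then c * (Y k i * w k i) else 0)"
        by (intro sum.cong refl) (auto simp: c)
      also have "\<dots> = c * (\<Sum>i\<le>n. Y k i * w k i)"
        by (simp add: sum_distrib_left)
      finally show ?thesis using dual_bases_pairing[OF w that that] by simp
    qed
    have e: "c = (if k \<le> l then 1 else 0)" if "k \<le> n" for k
      using s1[OF that] s2[OF that] by (rule trans[OF sym, rotated])
    show False using e[of 0] e[of n] l by simp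
  qed
  ultimately show ?thesis by blast
qed

section \<open>Self-adjoint matrices that are not scalar\<close>

text \<open>This is B u, with B the transpose of A. Setting the entries beyond \<open>n\<close> to 0
  makes it equal, as a function, to the coefficient vector of a linear form.\<close>

definition vecmul :: "nat \<Rightarrow> (nat \<Rightarrow> nat \<Rightarrow> complex) \<Rightarrow> (nat \<Rightarrow> complex) \<Rightarrow> nat \<Rightarrow> complex" where
  "vecmul n A u j = (if j \<le> n then \<Sum>i\<le>n. u i * A i j else 0)"

lemma Dir_vecmul: "Dir n (vecmul n A u) f = (\<Sum>i\<le>n. scale (u i) (Dir n (A i) f))"
proof -
  have "Dir n (vecmul n A u) f = Dir n (\<lambda>j. \<Sum>i\<le>n. u i * A i j) f"
    by (rule Dir_cong) (simp add: vecmul_def)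
  then show ?thesis by (simp add: Dir_lincomb)
qed

text \<open>\<open>self_adjoint\<close> is this identity for unit vectors; the general case follows
  by bilinearity.\<close>

lemma self_adjoint_Dir:
  assumes "self_adjoint n A f"
  shows "Dir n (vecmul n A u) (Dir n v f) = Dir n u (Dir n (vecmul n A v) f)"
proof -
  have "Dir n (vecmul n A u) (Dir n v f) = Dir n v (Dir n (vecmul n A u) f)"
    by (rule Dir_commute)
  also have "\<dots> = (\<Sum>j\<le>n. \<Sum>i\<le>n. scale (v j * u i) (partial j (Dir n (A i) f)))"
    by (simp add: Dir_vecmul Dir_def[of n v] partial_sum partial_scale mpoly.scale_sum_right)
  also have "\<dots> = (\<Sum>j\<le>n. \<Sum>i\<le>n. scale (u i * v j) (partial i (Dir n (A j) f)))"
    using assms by (intro sum.cong refl) (simp add: self_adjoint_def mult.commute)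
  also have "\<dots> = (\<Sum>i\<le>n. \<Sum>j\<le>n. scale (u i * v j) (partial i (Dir n (A j) f)))"
    by (rule sum.swap)
  also have "\<dots> = Dir n u (Dir n (vecmul n A v) f)"
    by (simp add: Dir_vecmul Dir_def[of n u] partial_sum partial_scale mpoly.scale_sum_right)
  finally show ?thesis .
qed

lemma self_adjoint_shift:
  assumes "self_adjoint n A f"
  shows "self_adjoint n (\<lambda>i j. A i j - (if i = j then c else 0)) f"
proof -
  have *: "Dir n (\<lambda>j. A i j - (if i = j then c else 0)) f = Dir n (A i) f - scale c (partial i f)"
    if "i \<le> n" for i
  proof -
    have "Dir n (\<lambda>j. A i j - (if i = j then c else 0)) f =
      Dir n (A i) f - Dir n (\<lambda>j. if i = j then c else 0) f"
      by (simp add: Dir_def mpoly.scale_left_diff_distrib sum_subtractf)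
    also have "Dir n (\<lambda>j. if i = j then c else 0) f = scale c (partial i f)"
      using that by (simp add: Dir_def if_distrib[where f = "\<lambda>c. scale c _"] cong: if_cong)
    finally show ?thesis .
  qed
  have pd: "partial j (g - h) = partial j g - partial j h" for j and g h :: "nat mpoly"
    using partial_add[of j "g - h" h] by (simp add: algebra_simps)
  show ?thesis
    using assms unfolding self_adjoint_def
    by (auto simp: * pd partial_scale partial_commute)
qed

lemma left_eigenvector_exists:
  fixes A :: "nat \<Rightarrow> nat \<Rightarrow> complex"
  obtains c u k where "k \<le> n" "u k \<noteq> 0" "\<forall>j\<le>n. (\<Sum>i\<le>n. u i * A i j) = c * u j"
proof -
  define M where "M = mat (Suc n) (Suc n) (\<lambda>(j, i). A i j)"
  have car: "M \<in> carrier_mat (Suc n) (Suc n)" by (simp add: M_def)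
  obtain c where "eigenvalue M c"
    using spectrum_non_empty[OF car] by (auto simp: spectrum_def)
  then obtain v where v: "v \<in> carrier_vec (Suc n)" "v \<noteq> 0\<^sub>v (Suc n)" "M *\<^sub>v v = c \<cdot>\<^sub>v v"
    using car by (auto simp: eigenvalue_def eigenvector_def)
  obtain k where k: "k \<le> n" "v $ k \<noteq> 0"
    using v(1,2) by (metis carrier_vecD eq_vecI index_zero_vec less_Suc_eq_le)
  have "(\<Sum>i\<le>n. v $ i * A i j) = c * v $ j" if "j \<le> n" for j
  proof -
    have "(M *\<^sub>v v) $ j = (\<Sum>i\<le>n. v $ i * A i j)"
      using that v(1) by (simp add: M_def scalar_prod_def atLeast0LessThan lessThan_Suc_atMost mult.commute)
    then show ?thesis using v(1,3) that by simp
  qed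
  with k show thesis using that[of k "\<lambda>i. v $ i" c] by blast
qed

text \<open>The coordinate forms \<open>Y j\<close> are the rows of the inverse of the matrix with
  columns \<open>w j\<close>.\<close>

lemma independent_imp_dual_bases:
  assumes "\<And>k j. k > n \<Longrightarrow> w j k = 0"
    and "\<And>c j. (\<And>k. k \<le> n \<Longrightarrow> (\<Sum>j\<le>n. c j * w j k) = 0) \<Longrightarrow> j \<le> n \<Longrightarrow> c j = 0"
  obtains Y where "dual_bases n Y w"
proof -
  define M where "M = mat (Suc n) (Suc n) (\<lambda>(k, j). w j k)"
  have car: "M \<in> carrier_mat (Suc n) (Suc n)" by (simp add: M_def)
  have "det M \<noteq> 0"
  proof
    assume "det M = 0"
    then obtain v where v: "v \<in> carrier_vec (Suc n)" "v \<noteq> 0\<^sub>v (Suc n)" "M *\<^sub>v v = 0\<^sub>v (Suc n)"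
      using det_0_iff_vec_prod_zero[OF car] by auto
    have "(\<Sum>j\<le>n. v $ j * w j k) = 0" if "k \<le> n" for k
    proof -
      have "(M *\<^sub>v v) $ k = (\<Sum>j\<le>n. v $ j * w j k)"
        using that v(1) by (simp add: M_def scalar_prod_def atLeast0LessThan lessThan_Suc_atMost mult.commute)
      then show ?thesis using v(3) that by simp
    qed
    then have "v $ j = 0" if "j \<le> n" for j
      using assms(2)[of "\<lambda>j. v $ j"] that by blast
    then show False
      using v(1,2) by (metis carrier_vecD eq_vecI index_zero_vec less_Suc_eq_le)
  qed
  then obtain N where N: "N \<in> carrier_mat (Suc n) (Suc n)" "M * N = 1\<^sub>m (Suc n)"
    using det_non_zero_imp_unit[OF car] car by (auto simp: Units_def ring_mat_def)
  have "(\<Sum>j\<le>n. N $$ (j, i) * w j k) = (if i = k then 1 else 0)" if "i \<le> n" "k \<le> n" for i k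
  proof -
    have "(M * N) $$ (k, i) = (\<Sum>j\<le>n. N $$ (j, i) * w j k)"
      using that N(1)
      by (simp add: M_def scalar_prod_def atLeast0LessThan lessThan_Suc_atMost mult.commute)
    then show ?thesis using N(2) that by auto
  qed
  with assms(1) have "dual_bases n (\<lambda>j i. N $$ (j, i)) w"
    by (simp add: dual_bases_def)
  then show thesis by (rule that)
qed

lemma coef_form_zero: "f \<in> forms {..n} 1 \<Longrightarrow> k > n \<Longrightarrow> coef f k = 0"
  unfolding coef_def by (rule ccontr) (auto simp: forms_iff monomials_iff)

text \<open>An endomorphism T whose kernel and image meet only in 0 splits the space into kernel and
  image. A basis of the kernel is extended to a basis of all linear forms, and T is applied to the
  added vectors only. The number l is the dimension of the kernel minus 1: \<open>f0\<close> makes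
  it exist, and \<open>f1\<close> makes it smaller than n.\<close>

lemma kernel_image_dual_bases:
  assumes add: "\<And>f g. T (f + g) = T f + T g" and sc: "\<And>c f. T (scale c f) = scale c (T f)"
    and T: "\<And>f. T f \<in> forms {..n} 1"
    and ker: "\<And>f. f \<in> forms {..n} 1 \<Longrightarrow> T (T f) = 0 \<Longrightarrow> T f = 0"
    and sing: "f0 \<in> forms {..n} 1" "f0 \<noteq> 0" "T f0 = 0" and nz: "f1 \<in> forms {..n} 1" "T f1 \<noteq> 0"
  obtains Y w l where "dual_bases n Y w" "l < n" "\<forall>a\<le>l. T (lin n (w a)) = 0"
    "\<forall>b\<le>n. l < b \<longrightarrow> (\<exists>f. lin n (w b) = T f)"
proof -
  let ?V = "forms {..n} 1 :: nat mpoly set"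
  have T0: "T 0 = 0" using sc[of 0 0] by simp
  have Tsum: "T (sum h S) = (\<Sum>i\<in>S. T (h i))" for h :: "nat \<Rightarrow> nat mpoly" and S
    by (induction S rule: infinite_finite_induct) (simp_all add: T0 add)
  define N where "N = {f \<in> ?V. T f = 0}"
  have sN: "mpoly.subspace N"
    using subspace_forms[of "{..n}" 1] by (auto simp: N_def mpoly.subspace_def T0 add sc)
  obtain K where K: "K \<subseteq> N" "mpoly.independent K" "N \<subseteq> mpoly.span K"
    using mpoly.maximal_independent_subset by blast
  have NK: "mpoly.span K = N" using K sN by (simp add: mpoly.span_eq mpoly.span_subspace)
  have "K \<subseteq> ?V" using K(1) by (auto simp: N_def)
  then obtain B where B: "K \<subseteq> B" "B \<subseteq> ?V" "mpoly.independent B" "?V \<subseteq> mpoly.span B"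
    using mpoly.maximal_independent_subset_extend K(2) by blast
  have BX: "B \<subseteq> mpoly.span (Var ` {..n})" using B(2) by (simp add: span_Var)
  have fB: "finite B" and "card B \<le> Suc n"
    using mpoly.independent_span_bound[OF _ B(3) BX] card_Var[of n] by auto
  moreover have "Suc n \<le> card B"
    using mpoly.independent_span_bound[OF fB independent_Var[of n]] B(4) card_Var[of n]
      forms_Var[of _ "{..n}"] by auto
  ultimately have cB: "card B = Suc n" by simp
  have fK: "finite K" using B(1) fB finite_subset by blast
  have "K \<noteq> {}" using K(3) sing by (auto simp: N_def)
  then have "card K \<noteq> 0" using fK by simp
  then obtain l where l: "card K = Suc l" using not0_implies_Suc by blast
  have "K \<noteq> B"
  proof
    assume "K = B"
    then have "f1 \<in> N" using B(4) nz(1) NK by auto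
    then show False using nz(2) by (simp add: N_def)
  qed
  then have "card K < card B" using B(1) fB by (simp add: psubset_card_mono psubsetI)
  then have ln: "l < n" using l cB by simp
  have cC: "card (B - K) = n - l" using l cB fK B(1) by (simp add: card_Diff_subset)
  obtain e1 where e1: "bij_betw e1 {..l} K"
    using finite_same_card_bij[of "{..l}" K] fK l by auto
  obtain e2 where e2: "bij_betw e2 {l<..n} (B - K)"
    using finite_same_card_bij[of "{l<..n}" "B - K"] fB cC by auto
  define e where "e j = (if j \<le> l then e1 j else e2 j)" for j
  have un: "{..n} = {..l} \<union> {l<..n}" using ln by auto
  have b1: "bij_betw e {..l} K"
    using e1 by (rule bij_betw_cong[THEN iffD1, rotated]) (simp add: e_def)
  have b2: "bij_betw e {l<..n} (B - K)"
    using e2 by (rule bij_betw_cong[THEN iffD1, rotated]) (simp add: e_def)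
  have be: "bij_betw e {..n} B"
    using bij_betw_combine[OF b1 b2] B(1) un by (simp add: Un_absorb1)
  have indep: "c j = 0" if "(\<Sum>j\<le>n. scale (c j) (e j)) = 0" "j \<le> n" for c j
  proof -
    have inj: "inj_on e {..n}" and im: "e ` {..n} = B" using be by (auto simp: bij_betw_def)
    let ?u = "\<lambda>v. c (the_inv_into {..n} e v)"
    have "(\<Sum>v\<in>B. scale (?u v) v) = (\<Sum>j\<le>n. scale (?u (e j)) (e j))"
      unfolding im[symmetric] by (rule sum_scale_reindex[OF inj])
    also have "\<dots> = (\<Sum>j\<le>n. scale (c j) (e j))"
      by (intro sum.cong refl) (simp add: the_inv_into_f_f[OF inj])
    finally have "?u (e j) = 0"
      using mpoly.independentD[OF B(3) fB order_refl, of ?u "e j"] that im by auto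
    then show ?thesis using that(2) by (simp add: the_inv_into_f_f[OF inj])
  qed
  define w where "w j = coef (if j \<le> l then e j else T (e j))" for j
  have eV: "e j \<in> ?V" if "j \<le> n" for j
    using be B(2) that by (auto simp: bij_betw_def)
  have eN: "e j \<in> N" if "j \<le> l" for j
    using b1 K(1) that by (auto simp: bij_betw_def)
  have wl: "lin n (w j) = (if j \<le> l then e j else T (e j))" if "j \<le> n" for j
    using that eV T unfolding w_def by (intro lin_coef) auto
  \<comment> \<open>Applying \<open>T\<close> to a relation removes its kernel part, so T(T h) = 0
    for the combination h of the added vectors. Then T h = 0, so h lies in the span of
    \<open>K\<close>, and independence of the extended basis makes all coefficients vanish.\<close>
  have ind: "c j = 0" if c: "\<And>k. k \<le> n \<Longrightarrow> (\<Sum>j\<le>n. c j * w j k) = 0" and j: "j \<le> n" for c j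
  proof -
    let ?k = "\<Sum>j\<le>l. scale (c j) (e j)" and ?h = "\<Sum>j\<in>{l<..n}. scale (c j) (e j)"
    have "lin n (\<lambda>k. \<Sum>j\<le>n. c j * w j k) = (\<Sum>j\<le>n. scale (c j) (lin n (w j)))"
      unfolding lin_def mpoly.scale_sum_right mpoly.scale_sum_left
      by (subst sum.swap) simp
    also have "\<dots> = (\<Sum>j\<le>n. scale (c j) (if j \<le> l then e j else T (e j)))"
      by (simp add: wl)
    also have "\<dots> = ?k + T ?h"
      unfolding un by (subst sum.union_disjoint) (auto simp: Tsum sc)
    finally have kh: "?k + T ?h = 0" using c by (simp add: lin_def)
    have "T ?k = 0" using eN by (simp add: Tsum sc N_def)
    with arg_cong[OF kh, of T] have "T (T ?h) = 0" by (simp add: add T0)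
    moreover have hV: "?h \<in> ?V" using eV by (intro forms_sum forms_scale) auto
    ultimately have Th: "T ?h = 0" using ker by blast
    then have "?h \<in> mpoly.span K" using hV by (simp add: NK N_def)
    then obtain r where "?h = (\<Sum>v\<in>K. scale (r v) v)"
      using fK by (auto simp: mpoly.span_finite)
    also have "\<dots> = (\<Sum>j\<le>l. scale (r (e j)) (e j))"
      using sum_scale_reindex[of e "{..l}" r] b1 by (simp add: bij_betw_def)
    finally have h: "?h = (\<Sum>j\<le>l. scale (r (e j)) (e j))" .
    have "(\<Sum>j\<le>n. scale (if j \<le> l then - r (e j) else c j) (e j)) =
      (\<Sum>j\<le>l. - scale (r (e j)) (e j)) + ?h"
      unfolding un by (subst sum.union_disjoint) auto
    also have "\<dots> = 0" by (simp add: h sum_negf)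
    finally have c2: "c j = 0" if "j \<le> n" "\<not> j \<le> l" for j
      using indep[of "\<lambda>j. if j \<le> l then - r (e j) else c j" j] that by simp
    have "?k = 0" using kh Th by simp
    then have "(\<Sum>j\<le>n. scale (c j) (e j)) = 0"
      unfolding un by (subst sum.union_disjoint) (auto simp: c2)
    then show ?thesis using indep j by blast
  qed
  have supp: "w j k = 0" if "k > n" for j k
  proof (cases "j \<le> l")
    case True
    then show ?thesis using eV[of j] ln that by (simp add: w_def coef_form_zero)
  next
    case False
    then show ?thesis using T[of "e j"] that by (simp add: w_def coef_form_zero)
  qed
  obtain Y where Y: "dual_bases n Y w"
    by (rule independent_imp_dual_bases[of n w]) (auto intro: supp ind)
  show thesis
  proof (rule that[OF Y ln])
    show "\<forall>a\<le>l. T (lin n (w a)) = 0"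
      using ln eN by (auto simp: wl N_def)
    show "\<forall>b\<le>n. l < b \<longrightarrow> (\<exists>f. lin n (w b) = T f)"
      by (auto simp: wl)
  qed
qed

lemma self_adjoint_imp_ST_type_or_isotropic:
  assumes f: "f \<in> forms {..n} d" "d \<ge> 1"
    and A: "self_adjoint n A f" "\<not> scalar_matrix n A"
  shows "ST_type n d f \<or> (\<exists>a. proj_point n a \<and> Dir n a (Dir n a f) = 0)"
proof (rule disjCI)
  assume no: "\<not> (\<exists>a. proj_point n a \<and> Dir n a (Dir n a f) = 0)"
  obtain c u k where u: "k \<le> n" "u k \<noteq> 0" "\<forall>j\<le>n. (\<Sum>i\<le>n. u i * A i j) = c * u j"
    by (rule left_eigenvector_exists[of n A])
  define A' where "A' i j = A i j - (if i = j then c else 0)" for i j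
  have sa: "self_adjoint n A' f"
    unfolding A'_def[abs_def] by (rule self_adjoint_shift[OF A(1)])
  \<comment> \<open>\<open>T\<close> is the singular matrix B acting on vectors, which are
    represented by linear forms with these coefficients.\<close>
  define T where "T h = lin n (vecmul n A' (coef h))" for h
  have coefT: "coef (T h) = vecmul n A' (coef h)" for h
    by (auto simp: T_def vecmul_def fun_eq_iff)
  have "\<exists>i\<le>n. \<exists>j\<le>n. A i j \<noteq> (if i = j then c else 0)"
    using A(2) unfolding scalar_matrix_def by blast
  then obtain i0 j0 where "i0 \<le> n" "j0 \<le> n" "A i0 j0 \<noteq> (if i0 = j0 then c else 0)"
    by blast
  then have ij: "i0 \<le> n" "j0 \<le> n" "A' i0 j0 \<noteq> 0"
    by (simp_all only: A'_def right_minus_eq not_False_eq_True)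
  have T0: "T h = 0 \<longleftrightarrow> (\<forall>j\<le>n. vecmul n A' (coef h) j = 0)" for h
  proof
    assume "T h = 0"
    then have "coef (T h) j = 0" for j by (simp add: coef_def)
    then show "\<forall>j\<le>n. vecmul n A' (coef h) j = 0" by (simp add: coefT)
  qed (simp add: T_def lin_def)
  have zero: "Dir n (vecmul n A' (coef h)) g = 0" if "T h = 0" for h g
    using that by (simp add: T0 Dir_def)
  have ker: "T h = 0" if "T (T h) = 0" for h
  proof (rule ccontr)
    assume "T h \<noteq> 0"
    let ?a = "vecmul n A' (coef h)"
    have "Dir n ?a (Dir n ?a f) = Dir n (coef h) (Dir n (vecmul n A' ?a) f)"
      by (rule self_adjoint_Dir[OF sa])
    also have "\<dots> = 0" using zero[OF that] by (simp add: coefT)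
    finally show False using no \<open>T h \<noteq> 0\<close> unfolding T0 proj_point_def by blast
  qed
  \<comment> \<open>The eigenvector \<open>u\<close> lies in the kernel; the unit vector at
    \<open>i0\<close> does not, since its image is row \<open>i0\<close> of \<open>A'\<close>, whose
    entry at \<open>j0\<close> is nonzero.\<close>
  obtain Y w l where w: "dual_bases n Y w" and l: "l < n" and wk: "\<forall>a\<le>l. T (lin n (w a)) = 0"
    and wi: "\<forall>b\<le>n. l < b \<longrightarrow> (\<exists>h. lin n (w b) = T h)"
  proof (rule kernel_image_dual_bases[of T n "lin n u" "Var i0"])
    show "T (g + h) = T g + T h" for g h
      by (simp add: T_def lin_def vecmul_def distrib_right sum.distrib mpoly.scale_left_distrib)
    show "T (scale c g) = scale c (T g)" for c g
      by (simp add: T_def lin_def vecmul_def mpoly.scale_sum_right sum_distrib_left mult.assoc)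
    show "T h \<in> forms {..n} 1" for h by (simp add: T_def lin_in_forms del: One_nat_def)
    show "T h = 0" if "T (T h) = 0" for h by (rule ker[OF that])
    show "lin n u \<in> forms {..n} 1" by (rule lin_in_forms)
    show "lin n u \<noteq> 0"
    proof
      assume "lin n u = 0"
      then have "coef (lin n u) k = 0" by (simp add: coef_def)
      then show False using u by simp
    qed
    show "T (lin n u) = 0"
      unfolding T0
    proof (intro allI impI)
      fix j assume "j \<le> n"
      have "(\<Sum>i\<le>n. u i * A' i j) = (\<Sum>i\<le>n. u i * A i j) - (\<Sum>i\<le>n. if i = j then c * u j else 0)"
        unfolding sum_subtractf[symmetric] A'_def by (intro sum.cong refl) (auto simp: algebra_simps)
      then show "vecmul n A' (coef (lin n u)) j = 0"
        using u(3) \<open>j \<le> n\<close> by (simp add: vecmul_def)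
    qed
    show "Var i0 \<in> forms {..n} 1" using ij by (intro forms_Var) simp
    show "T (Var i0) \<noteq> 0"
      unfolding T0 using ij by (auto simp: vecmul_def if_distrib[where f = "\<lambda>x. x * _"] cong: if_cong intro!: exI[of _ j0])
  qed auto
  have lw: "Dir n (w j) g = Dir n (coef (lin n (w j))) g" for j g
    by (rule Dir_cong) simp
  have "Dir n (w a) (Dir n (w b) f) = 0" if "a \<le> l" "l < b" "b \<le> n" for a b
  proof -
    obtain h where h: "lin n (w b) = T h" using wi \<open>l < b\<close> \<open>b \<le> n\<close> by blast
    have "Dir n (w a) (Dir n (w b) f) = Dir n (w b) (Dir n (w a) f)" by (rule Dir_commute)
    also have "\<dots> = Dir n (vecmul n A' (coef h)) (Dir n (coef (lin n (w a))) f)"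
      by (simp only: lw h coefT)
    also have "\<dots> = Dir n (coef h) (Dir n (vecmul n A' (coef (lin n (w a)))) f)"
      by (rule self_adjoint_Dir[OF sa])
    also have "\<dots> = 0" using zero wk \<open>a \<le> l\<close> by simp
    finally show ?thesis .
  qed
  then show "ST_type n d f"
    by (rule splitting_imp_ST_type[OF f w l])
qed

section \<open>Multiplicities in terms of second derivatives\<close>

text \<open>Only lines through a are tested. For the numerator of a local equation this follows from
  membership in the k-th power of the maximal ideal, and it suffices to bound the degree of g in the
  direction a.\<close>

definition vanishes_to_order :: "nat \<Rightarrow> (nat \<Rightarrow> complex) \<Rightarrow> nat mpoly \<Rightarrow> bool" where
  "vanishes_to_order k a s \<longleftrightarrow> (\<forall>b. [:0, 1:] ^ k dvd leval a b s)"

lemma poly_leval_0 [simp]: "poly (leval a b f) 0 = eval a f"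
  by (simp add: poly_leval)

lemma vanishes_add: "vanishes_to_order k a s \<Longrightarrow> vanishes_to_order k a t \<Longrightarrow> vanishes_to_order k a (s + t)"
  by (simp add: vanishes_to_order_def leval_simps)

lemma vanishes_mult_left: "vanishes_to_order k a s \<Longrightarrow> vanishes_to_order k a (s * t)"
  by (simp add: vanishes_to_order_def leval_simps(2))

lemma vanishes_mult_Suc:
  assumes "eval a s = 0" "vanishes_to_order k a t"
  shows "vanishes_to_order (Suc k) a (s * t)"
  unfolding vanishes_to_order_def leval_simps(2) power_Suc
proof
  fix b
  have "[:0, 1:] dvd leval a b s"
    using assms(1) by (simp add: dvd_iff_poly_eq_0)
  then show "[:0, 1:] * [:0, 1:] ^ k dvd leval a b s * leval a b t"
    using assms(2) by (intro mult_dvd_mono) (auto simp: vanishes_to_order_def)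
qed

text \<open>Orders of vanishing at 0 of univariate polynomials add up, and the factor
  \<open>t\<close> has order 0 there.\<close>

lemma vanishes_cancel:
  assumes "vanishes_to_order k a (s * t)" "eval a t \<noteq> 0"
  shows "vanishes_to_order k a s"
  unfolding vanishes_to_order_def
proof
  fix b
  let ?p = "leval a b s" and ?q = "leval a b t"
  show "[:0, 1:] ^ k dvd ?p"
  proof (cases "?p = 0")
    case False
    have q: "poly ?q 0 \<noteq> 0" using assms(2) by simp
    then have "?q \<noteq> 0" by (metis poly_0)
    then have pq: "?p * ?q \<noteq> 0" using False by simp
    have "[:- 0, 1:] ^ k dvd ?p * ?q"
      using assms(1) by (simp add: vanishes_to_order_def leval_simps(2))
    then have "k \<le> order 0 (?p * ?q)" using pq by (simp only: order_divides) simp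
    also have "\<dots> = order 0 ?p" using order_mult[OF pq] order_0I[OF q] by simp
    finally have "[:- 0, 1:] ^ k dvd ?p" by (simp only: order_divides) simp
    then show ?thesis by simp
  qed simp
qed

lemma Fract_add_same: "t \<noteq> 0 \<Longrightarrow> Fract s t + Fract s' t = Fract (s + s') t"
  by (simp add: eq_fract algebra_simps)

lemma max_ideal_power_SucE:
  assumes "h \<in> max_ideal_power n a (Suc k)"
  obtains u v and N :: nat where "h = (\<Sum>i<N. u i * v i)"
    "\<forall>i<N. u i \<in> max_ideal n a \<and> v i \<in> max_ideal_power n a k"
  using assms[unfolded max_ideal_power.simps mem_Collect_eq] by (elim exE conjE) (rule that)

lemma Var_neq_0 [simp]: "Var i \<noteq> (0 :: 'x mpoly)"
proof
  assume "Var i = (0 :: 'x mpoly)"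
  then have "lookup (Var i :: 'x mpoly) (single i 1) = 0" by simp
  then show False by (simp add: Var_def)
qed

text \<open>Each factor from the maximal ideal raises the order of the numerator by one. Sums are
  treated one term at a time: a common denominator multiplies the numerators by further factors,
  which cannot lower the order.\<close>

lemma max_ideal_power_vanishes:
  "h \<in> max_ideal_power n a k \<Longrightarrow>
    \<exists>s t. h = Fract s t \<and> eval a t \<noteq> 0 \<and> vanishes_to_order k a s"
proof (induction k arbitrary: h)
  case 0
  then show ?case by (auto simp: local_ring_def vanishes_to_order_def)
next
  case (Suc k)
  obtain u v and N :: nat where h: "h = (\<Sum>i<N. u i * v i)"
    and uv: "\<forall>i<N. u i \<in> max_ideal n a \<and> v i \<in> max_ideal_power n a k"
    using max_ideal_power_SucE[OF Suc.prems] .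
  note IH = Suc.IH
  have one: "eval a 1 \<noteq> 0" by (simp add: eval.insertion_one)
  have "\<exists>s t. (\<Sum>i<M. u i * v i) = Fract s t \<and> eval a t \<noteq> 0 \<and> vanishes_to_order (Suc k) a s"
    if "M \<le> N" for M
    using that
  proof (induction M)
    case 0
    show ?case
      by (rule exI[of _ 0], rule exI[of _ 1])
        (simp add: Zero_fract_def one vanishes_to_order_def leval_simps)
  next
    case (Suc M)
    then obtain s t where st: "(\<Sum>i<M. u i * v i) = Fract s t" "eval a t \<noteq> 0"
      "vanishes_to_order (Suc k) a s" by auto
    have "u M \<in> max_ideal n a" using uv Suc.prems by simp
    then obtain s1 t1 where 1: "u M = Fract s1 t1" "eval a t1 \<noteq> 0" "eval a s1 = 0"
      by (auto simp: max_ideal_def)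
    obtain s2 t2 where 2: "v M = Fract s2 t2" "eval a t2 \<noteq> 0" "vanishes_to_order k a s2"
      using IH[of "v M"] uv Suc.prems by auto
    have nz: "t \<noteq> 0" "t1 \<noteq> 0" "t2 \<noteq> 0"
      using st 1 2 by (auto simp: eval.insertion_zero)
    have "(\<Sum>i<Suc M. u i * v i) = Fract (s * (t1 * t2) + (s1 * s2) * t) (t * (t1 * t2))"
      using nz by (simp add: st 1 2)
    moreover have "eval a (t * (t1 * t2)) \<noteq> 0"
      using st 1 2 by (simp add: eval.insertion_mult)
    moreover have "vanishes_to_order (Suc k) a (s * (t1 * t2) + (s1 * s2) * t)"
      by (intro vanishes_add vanishes_mult_left vanishes_mult_Suc st 1 2)
    ultimately show ?case by blast
  qed
  then show ?case using h by blast
qed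

lemma local_equation_vanishes:
  assumes "Fract g t \<in> max_ideal_power n a k" "eval a t \<noteq> 0"
  shows "vanishes_to_order k a g"
proof -
  obtain s t' where s: "Fract g t = Fract s t'" "eval a t' \<noteq> 0" "vanishes_to_order k a s"
    using max_ideal_power_vanishes[OF assms(1)] by blast
  have "t \<noteq> 0" "t' \<noteq> 0" using assms(2) s(2) by (auto simp: eval.insertion_zero)
  then have "g * t' = s * t" using s(1) by (simp add: eq_fract)
  then have "vanishes_to_order k a (g * t')" using s(3) by (simp add: vanishes_mult_left)
  then show ?thesis using s(2) by (rule vanishes_cancel)
qed

text \<open>By homogeneity, \<open>t \<mapsto> g (b + t a)\<close> is the reversal of \<open>t \<mapsto> g (a + t b)\<close>.\<close>

lemma vanishes_imp_degree_le:
  assumes g: "g \<in> forms {..n} d" and v: "vanishes_to_order (d - e) a g" and e: "e \<le> d"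
  shows "degree (leval b a g) \<le> e"
proof -
  obtain q where q: "leval a b g = [:0, 1:] ^ (d - e) * q"
    using v by (auto simp: vanishes_to_order_def dvd_def)
  have dq: "degree q \<le> e"
  proof (cases "q = 0")
    case False
    then have "degree (leval a b g) = (d - e) + degree q"
      unfolding q by (subst degree_mult_eq) (simp_all add: degree_power_eq)
    then show ?thesis using degree_leval[OF g, of a b] e by simp
  qed simp
  \<comment> \<open>Substituting 1/t in t^(d-e) q(t) and multiplying by t^d gives t^e q(1/t), which
    is \<open>r\<close>.\<close>
  define r where "r = (\<Sum>i\<le>e. monom (coeff q i) (e - i))"
  have "degree r \<le> e"
    unfolding r_def by (rule degree_sum_le) (auto intro: order_trans[OF degree_monom_le])
  moreover have "leval b a g = r"
  proof -
    have "poly (leval b a g) t = poly r t" if "t \<noteq> 0" for t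
    proof -
      have td: "t ^ d = t ^ e * t ^ (d - e)" using e by (simp flip: power_add)
      have "poly (leval b a g) t = eval (\<lambda>i. t * (a i + (1 / t) * b i)) g"
        using that by (simp add: poly_leval algebra_simps)
      also have "\<dots> = t ^ d * poly (leval a b g) (1 / t)"
        by (simp add: eval_homogeneous[OF g] poly_leval)
      also have "\<dots> = t ^ e * poly q (1 / t)"
        using that by (simp add: q td power_divide)
      also have "\<dots> = (\<Sum>i\<le>e. coeff q i * t ^ (e - i))"
        unfolding poly_altdef sum_distrib_left
        by (rule sum.mono_neutral_cong_left)
          (use dq that in \<open>auto simp: coeff_eq_0 power_diff power_divide\<close>)
      also have "\<dots> = poly r t" by (simp add: r_def poly_sum poly_monom)
      finally show ?thesis .
    qed
    \<comment> \<open>Equality is known only for nonzero t, so the difference is multiplied by t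
      before polynomials are compared.\<close>
    then have "\<forall>t. poly ([:0, 1:] * (leval b a g - r)) t = 0" by auto
    then have "[:0, 1:] * (leval b a g - r) = 0" by (simp only: poly_all_0_iff_0)
    then show ?thesis by simp
  qed
  ultimately show ?thesis by simp
qed

lemma vanishes_cong:
  assumes "g \<in> forms {..n} d" "\<And>i. i \<le> n \<Longrightarrow> a i = a' i"
  shows "vanishes_to_order k a g = vanishes_to_order k a' g"
proof -
  have "leval a b g = leval a' b g" for b
    unfolding leval_def by (rule insertion_cong[OF assms(1)]) (simp add: assms(2))
  then show ?thesis by (simp add: vanishes_to_order_def)
qed

lemma leval_eq_0_imp:
  fixes f :: "nat mpoly"
  assumes "\<And>b. leval b a f = 0"
  shows "f = 0"
proof (rule eval_eq_0_imp)
  show "eval b f = 0" for b using assms[of b] poly_leval_0[of b a f] by simp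
qed

lemma vanishes_imp_Dir_Dir_eq_0:
  assumes g: "g \<in> forms {..n} d" and v: "vanishes_to_order (d - 1) a g" and d: "d \<ge> 1"
  shows "Dir n a (Dir n a g) = 0"
proof -
  \<comment> \<open>A point is given by its entries up to \<open>n\<close>, the others being
    arbitrary, whereas the chain rule needs a direction that is 0 beyond \<open>n\<close>.\<close>
  define a' where "a' i = (if i \<le> n then a i else 0)" for i
  have "vanishes_to_order (d - 1) a' g"
    using v by (subst vanishes_cong[OF g, of a' a]) (simp_all add: a'_def)
  then have "degree (leval b a' g) \<le> 1" for b
    by (rule vanishes_imp_degree_le[OF g]) (use d in simp)
  then have "pderiv (pderiv (leval b a' g)) = 0" for b
    by (simp add: pderiv_eq_0_iff degree_pderiv)
  then have "leval b a' (Dir n a' (Dir n a' g)) = 0" for b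
    by (simp add: pderiv_leval[where n = n] a'_def)
  then have "Dir n a' (Dir n a' g) = 0" by (rule leval_eq_0_imp)
  then show ?thesis by (simp add: a'_def Dir_def)
qed

text \<open>Vanishing to order d leaves g constant in the direction a: the hypersurface is a cone
  with vertex a.\<close>

lemma vanishes_imp_Dir_eq_0:
  assumes g: "g \<in> forms {..n} d" and v: "vanishes_to_order d a g"
  shows "Dir n a g = 0"
proof -
  define a' where "a' i = (if i \<le> n then a i else 0)" for i
  have "vanishes_to_order (d - 0) a' g"
    using v by (subst vanishes_cong[OF g, of a' a]) (simp_all add: a'_def)
  then have "degree (leval b a' g) \<le> 0" for b
    by (rule vanishes_imp_degree_le[OF g]) simp
  then have "pderiv (leval b a' g) = 0" for b
    by (simp add: pderiv_eq_0_iff)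
  then have "leval b a' (Dir n a' g) = 0" for b
    by (simp add: pderiv_leval[where n = n] a'_def)
  then have "Dir n a' g = 0" by (rule leval_eq_0_imp)
  then show ?thesis by (simp add: a'_def Dir_def)
qed

section \<open>Powers of the maximal ideal\<close>

lemma local_ring_add: "h \<in> local_ring n a \<Longrightarrow> h' \<in> local_ring n a \<Longrightarrow> h + h' \<in> local_ring n a"
proof -
  assume "h \<in> local_ring n a" "h' \<in> local_ring n a"
  then obtain s t k s' t' k' where h: "h = Fract s t" "h' = Fract s' t'"
    and f: "s \<in> forms {..n} k" "t \<in> forms {..n} k" "s' \<in> forms {..n} k'" "t' \<in> forms {..n} k'"
    and e: "eval a t \<noteq> 0" "eval a t' \<noteq> 0"
    unfolding local_ring_def by blast
  have nz: "t \<noteq> 0" "t' \<noteq> 0" using e by (auto simp: eval.insertion_zero)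
  have "s' * t \<in> forms {..n} (k + k')" using forms_mult[OF f(3,2)] by (simp add: add.commute)
  then have "s * t' + s' * t \<in> forms {..n} (k + k')" "t * t' \<in> forms {..n} (k + k')"
    using f by (auto intro: forms_add forms_mult)
  moreover have "eval a (t * t') \<noteq> 0" using e by (simp add: eval.insertion_mult)
  ultimately show "h + h' \<in> local_ring n a"
    unfolding local_ring_def h add_fract[OF nz] by blast
qed

lemma local_ring_mult: "h \<in> local_ring n a \<Longrightarrow> h' \<in> local_ring n a \<Longrightarrow> h * h' \<in> local_ring n a"
proof -
  assume "h \<in> local_ring n a" "h' \<in> local_ring n a"
  then obtain s t k s' t' k' where h: "h = Fract s t" "h' = Fract s' t'"
    and f: "s \<in> forms {..n} k" "t \<in> forms {..n} k" "s' \<in> forms {..n} k'" "t' \<in> forms {..n} k'"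
    and e: "eval a t \<noteq> 0" "eval a t' \<noteq> 0"
    unfolding local_ring_def by blast
  have "s * s' \<in> forms {..n} (k + k')" "t * t' \<in> forms {..n} (k + k')"
    using f by (auto intro: forms_mult)
  moreover have "eval a (t * t') \<noteq> 0" using e by (simp add: eval.insertion_mult)
  ultimately show "h * h' \<in> local_ring n a"
    unfolding local_ring_def h mult_fract by blast
qed

lemma Fract_const_in_local_ring: "Fract (const c) 1 \<in> local_ring n a"
  unfolding local_ring_def mem_Collect_eq using forms_const[of c "{..n}"] forms_const[of 1 "{..n}"]
  by (intro exI[of _ "const c"] exI[of _ "1 :: nat mpoly"] exI[of _ "0 :: nat"])
    (simp add: eval.insertion_one)

lemma zero_in_max_ideal_power: "0 \<in> max_ideal_power n a k"
proof (cases k)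
  case 0
  then show ?thesis using Fract_const_in_local_ring[of 0 n a] by (simp add: Zero_fract_def)
next
  case (Suc m)
  show ?thesis
    unfolding Suc max_ideal_power.simps mem_Collect_eq by (rule exI[of _ "0 :: nat"]) simp
qed

lemma max_ideal_power_add:
  assumes "h \<in> max_ideal_power n a k" "h' \<in> max_ideal_power n a k"
  shows "h + h' \<in> max_ideal_power n a k"
proof (cases k)
  case 0
  then show ?thesis using assms local_ring_add by simp
next
  case (Suc m)
  obtain u v and N :: nat where h: "h = (\<Sum>i<N. u i * v i)"
    "\<forall>i<N. u i \<in> max_ideal n a \<and> v i \<in> max_ideal_power n a m"
    using max_ideal_power_SucE[OF assms(1)[unfolded Suc]] .
  obtain u' v' and N' :: nat where h': "h' = (\<Sum>i<N'. u' i * v' i)"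
    "\<forall>i<N'. u' i \<in> max_ideal n a \<and> v' i \<in> max_ideal_power n a m"
    using max_ideal_power_SucE[OF assms(2)[unfolded Suc]] .
  define U where "U i = (if i < N then u i else u' (i - N))" for i
  define V where "V i = (if i < N then v i else v' (i - N))" for i
  have "(\<Sum>i<N + N'. U i * V i) = (\<Sum>i<N. U i * V i) + (\<Sum>i<N'. U (N + i) * V (N + i))"
    by (induction N') (simp_all add: add.assoc)
  also have "\<dots> = h + h'" by (simp add: h(1) h'(1) U_def V_def)
  finally have "h + h' = (\<Sum>i<N + N'. U i * V i)" ..
  moreover have "\<forall>i<N + N'. U i \<in> max_ideal n a \<and> V i \<in> max_ideal_power n a m"
    using h(2) h'(2) by (auto simp: U_def V_def)
  ultimately show ?thesis
    unfolding Suc max_ideal_power.simps mem_Collect_eq by blast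
qed

lemma max_ideal_power_sum:
  "(\<And>i. i \<in> S \<Longrightarrow> h i \<in> max_ideal_power n a k) \<Longrightarrow> sum h S \<in> max_ideal_power n a k"
  by (induction S rule: infinite_finite_induct)
    (auto intro: max_ideal_power_add zero_in_max_ideal_power)

lemma max_ideal_power_mult:
  assumes "u \<in> max_ideal n a" "v \<in> max_ideal_power n a k"
  shows "u * v \<in> max_ideal_power n a (Suc k)"
  unfolding max_ideal_power.simps mem_Collect_eq
  by (rule exI[of _ "1 :: nat"], rule exI[of _ "\<lambda>_. u"], rule exI[of _ "\<lambda>_. v"]) (simp add: assms)

lemma max_ideal_subset_local_ring: "max_ideal n a \<subseteq> local_ring n a"
  unfolding max_ideal_def local_ring_def by blast

lemma max_ideal_power_Suc_subset: "max_ideal_power n a (Suc k) \<subseteq> max_ideal_power n a k"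
proof (induction k)
  case 0
  show ?case
  proof
    fix h assume hh: "h \<in> max_ideal_power n a (Suc 0)"
    obtain u v and N :: nat where h: "h = (\<Sum>i<N. u i * v i)"
      "\<forall>i<N. u i \<in> max_ideal n a \<and> v i \<in> max_ideal_power n a 0"
      using max_ideal_power_SucE[OF hh] .
    have "u i * v i \<in> max_ideal_power n a 0" if "i \<in> {..<N}" for i
      using that h(2) max_ideal_subset_local_ring[of n a] by (auto intro!: local_ring_mult)
    then show "h \<in> max_ideal_power n a 0"
      unfolding h(1) by (rule max_ideal_power_sum)
  qed
next
  case (Suc k)
  show ?case
  proof
    fix h assume hh: "h \<in> max_ideal_power n a (Suc (Suc k))"
    obtain u v and N :: nat where h: "h = (\<Sum>i<N. u i * v i)"
      "\<forall>i<N. u i \<in> max_ideal n a \<and> v i \<in> max_ideal_power n a (Suc k)"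
      using max_ideal_power_SucE[OF hh] .
    show "h \<in> max_ideal_power n a (Suc k)"
      unfolding h(1) by (intro max_ideal_power_sum max_ideal_power_mult)
        (use h(2) Suc in blast)+
  qed
qed

text \<open>The linear forms \<open>ell j\<close> vanish at a, so their quotients by x_i0 lie in the
  maximal ideal. A form of degree k in them, divided by x_i0^k, is a combination of k-fold products
  of such quotients.\<close>

lemma subst_in_max_ideal_power:
  assumes p: "p \<in> forms {..n} k" and i0: "i0 \<le> n" "a i0 \<noteq> 0"
  defines "ell \<equiv> \<lambda>j. Var j - scale (a j / a i0) (Var i0)"
  shows "Fract (subst ell p) (Var i0 ^ k) \<in> max_ideal_power n a k"
proof -
  have x: "eval a (Var i0) \<noteq> 0" using i0 by simp
  have x0: "Var i0 \<noteq> (0 :: nat mpoly)" by simp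
  have lin: "Fract (ell j) (Var i0) \<in> max_ideal n a" if "j \<le> n" for j
  proof -
    have "Var j + scale (- (a j / a i0)) (Var i0) \<in> forms {..n} 1"
      using that i0 by (intro forms_add forms_scale forms_Var) auto
    moreover have "Var j + scale (- (a j / a i0)) (Var i0) = ell j"
      unfolding ell_def by simp
    ultimately have "ell j \<in> forms {..n} 1" by simp
    moreover have "eval a (ell j) = 0"
      using i0 by (simp add: ell_def eval.insertion_diff eval.insertion_scale)
    moreover have "Var i0 \<in> forms {..n} 1" using i0 by (intro forms_Var) simp
    ultimately show ?thesis unfolding max_ideal_def using x by blast
  qed
  have mon: "Fract (const c * monom_eval ell m) (Var i0 ^ k) \<in> max_ideal_power n a k"
    if "m \<in> monomials {..n} k" for m c k
    using that
  proof (induction k arbitrary: m)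
    case 0
    then show ?case using Fract_const_in_local_ring by (simp add: monomials_iff)
  next
    case (Suc k)
    from Suc.prems obtain m' i where m: "m = m' + single i 1" "i \<in> {..n}" "m' \<in> monomials {..n} k"
      by (rule monomials_factor)
    have "Fract (const c * monom_eval ell m) (Var i0 ^ Suc k) =
      Fract (ell i) (Var i0) * Fract (const c * monom_eval ell m') (Var i0 ^ k)"
      by (simp add: m(1) monom_eval_add mult_ac)
    then show ?case
      using max_ideal_power_mult[OF lin Suc.IH[OF m(3)], of i] m(2) by (simp del: max_ideal_power.simps)
  qed
  have sum: "Fract (sum h S) (Var i0 ^ k) = (\<Sum>i\<in>S. Fract (h i) (Var i0 ^ k))"
    for h :: "(nat \<Rightarrow>\<^sub>0 nat) \<Rightarrow> nat mpoly" and S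
    using x0 by (induction S rule: infinite_finite_induct)
      (simp_all add: Fract_add_same[symmetric] rat_number_collapse Zero_fract_def eq_fract)
  show ?thesis
    unfolding subst_def sum
    by (rule max_ideal_power_sum) (use p mon in \<open>auto simp: forms_def monom_eval_def[symmetric]\<close>)
qed

text \<open>With s = x_i0 / a_i0 the vector of variables is ell + s a. Since g is affine along a, g
  = g(ell) + s (D_a g)(ell). After division by x_i0^d the first term lies in the d-th power of the
  maximal ideal and the second in the (d-1)-st.\<close>

lemma Dir_Dir_eq_0_imp_in_max_ideal_power:
  assumes g: "g \<in> forms {..n} d" "d \<ge> 1" and i0: "i0 \<le> n" "a i0 \<noteq> 0"
    and supp: "\<And>i. i > n \<Longrightarrow> a i = 0" and D: "Dir n a (Dir n a g) = 0"
  shows "Fract g (Var i0 ^ d) \<in> max_ideal_power n a (d - 1)"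
proof -
  define ell where "ell = (\<lambda>j. Var j - scale (a j / a i0) (Var i0))"
  let ?D = "scale (1 / a i0) (Dir n a g)"
  have expand: "g = subst ell g + Var i0 * subst ell ?D"
  proof (rule mpoly_eqI)
    fix b
    let ?l = "\<lambda>j. eval b (ell j)"
    have l: "?l j = b j - a j / a i0 * b i0" for j
      by (simp add: ell_def eval.insertion_diff eval.insertion_scale)
    have "eval b g = eval (\<lambda>i. ?l i + (b i0 / a i0) * a i) g"
      by (simp add: l)
    also have "\<dots> = eval ?l g + (b i0 / a i0) * eval ?l (Dir n a g)"
      by (rule Dir_Dir_eq_0_expand[OF D supp])
    also have "\<dots> = eval b (subst ell g + Var i0 * subst ell ?D)"
      by (simp add: eval.insertion_add eval.insertion_mult eval_subst eval.insertion_scale)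
    finally show "eval b g = eval b (subst ell g + Var i0 * subst ell ?D)" .
  qed
  have d: "d = Suc (d - 1)" using g(2) by simp
  have "Fract (subst ell g) (Var i0 ^ d) \<in> max_ideal_power n a d"
    unfolding ell_def by (rule subst_in_max_ideal_power[where a = a, OF g(1) i0])
  then have 1: "Fract (subst ell g) (Var i0 ^ d) \<in> max_ideal_power n a (d - 1)"
    using max_ideal_power_Suc_subset[of n a "d - 1"] d by auto
  have "Fract (subst ell ?D) (Var i0 ^ (d - 1)) \<in> max_ideal_power n a (d - 1)"
    unfolding ell_def by (intro subst_in_max_ideal_power i0 forms_scale forms_Dir g)
  moreover have "Fract (subst ell ?D) (Var i0 ^ (d - 1)) = Fract (Var i0 * subst ell ?D) (Var i0 ^ d)"
    by (subst (2) d) (simp add: eq_fract)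
  ultimately have "Fract (subst ell g) (Var i0 ^ d) + Fract (Var i0 * subst ell ?D) (Var i0 ^ d)
      \<in> max_ideal_power n a (d - 1)"
    using 1 by (intro max_ideal_power_add) simp_all
  then show ?thesis
    using expand Fract_add_same[of "Var i0 ^ d" "subst ell g" "Var i0 * subst ell ?D"] by simp
qed

text \<open>\<open>T\<close> is the projection along a onto the vectors with k-th entry 0, so its
  kernel consists of the multiples of a. In a basis adapted to kernel and image the derivatives of g
  along the kernel vectors vanish, hence so do the mixed ones.\<close>

lemma cone_imp_ST_type:
  assumes g: "g \<in> forms {..n} d" "d \<ge> 1" "g \<noteq> 0" and a: "proj_point n a" and D: "Dir n a g = 0"
  shows "ST_type n d g"
proof -
  obtain k where k: "k \<le> n" "a k \<noteq> 0" using a by (auto simp: proj_point_def)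
  define T where "T h = lin n (\<lambda>i. coef h i - coef h k / a k * a i)" for h
  \<comment> \<open>A second axis exists: otherwise g would be constant on the only axis and, having
    no constant term, would be 0.\<close>
  have "\<exists>i\<le>n. i \<noteq> k"
  proof (rule ccontr)
    assume no: "\<not> (\<exists>i\<le>n. i \<noteq> k)"
    define a' where "a' i = (if i \<le> n then a i else 0)" for i
    have "Dir n a' g = 0" using D by (simp add: a'_def Dir_def)
    then have inv: "eval (\<lambda>i. 0 + t * a' i) g = eval (\<lambda>_. 0) g" for t
      by (rule Dir_eq_0_imp_invariant) (simp add: a'_def)
    have e: "eval b g = eval (\<lambda>i. 0 + b k / a k * a' i) g" for b
      by (rule eval_cong[OF g(1)]) (use no k in \<open>auto simp: a'_def\<close>)
    have "eval (\<lambda>_. 0) g = 0"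
      using g(1,2) by (fastforce simp: eval_0 forms_iff monomials_iff)
    then have "eval b g = 0" for b
      by (simp only: e[of b] inv)
    then have "g = 0" by (rule eval_eq_0_imp)
    then show False using g(3) by simp
  qed
  then obtain i where i: "i \<le> n" "i \<noteq> k" by blast
  have TT: "T (T h) = T h" for h
  proof -
    have "coef (T h) k = 0" using k by (simp add: T_def)
    then show ?thesis unfolding T_def[of "T h"]
      by (simp add: T_def) (simp add: lin_def)
  qed
  have T0: "coef (T h) j = 0" if "T h = 0" for h j using that by (simp add: coef_def)
  obtain Y w l where w: "dual_bases n Y w" "l < n" "\<forall>a\<le>l. T (lin n (w a)) = 0"
  proof (rule kernel_image_dual_bases[of T n "lin n a" "Var i"])
    show "T (g + h) = T g + T h" for g h
      by (simp add: T_def lin_def add_divide_distrib algebra_simps flip: sum.distrib mpoly.scale_left_distrib)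
    show "T (scale c g) = scale c (T g)" for c g
      by (simp add: T_def lin_def mpoly.scale_sum_right right_diff_distrib mult.assoc)
    show "T h \<in> forms {..n} 1" for h unfolding T_def by (rule lin_in_forms)
    show "T h = 0" if "T (T h) = 0" for h using that by (simp add: TT)
    show "lin n a \<in> forms {..n} 1" by (rule lin_in_forms)
    show "lin n a \<noteq> 0"
    proof
      assume "lin n a = 0"
      then have "coef (lin n a) k = 0" by (simp add: coef_def)
      then show False using k by simp
    qed
    show "T (lin n a) = 0" using k unfolding T_def by (subst lin_def) simp
    show "Var i \<in> forms {..n} 1" using i by (intro forms_Var) simp
    show "T (Var i) \<noteq> 0"
    proof
      assume "T (Var i) = 0"
      then have "coef (T (Var i)) i = 0" by (rule T0)
      then show False using i by (simp add: T_def)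
    qed
  qed auto
  have Dw: "Dir n (w b) g = 0" if "b \<le> l" for b
  proof -
    have "coef (T (lin n (w b))) j = 0" for j using w(3) that by (intro T0) simp
    then have *: "coef (T (lin n (w b))) j = 0" for j .
    have "w b j = (w b k / a k) * a j" if "j \<le> n" for j
      using *[of j] that k by (simp add: T_def)
    then have "Dir n (w b) g = Dir n (\<lambda>j. (w b k / a k) * a j) g" by (intro Dir_cong)
    also have "\<dots> = scale (w b k / a k) (Dir n a g)"
      by (simp add: Dir_def mpoly.scale_sum_right)
    finally show ?thesis using D by simp
  qed
  show ?thesis
    by (rule splitting_imp_ST_type[OF g(1,2) w(1,2)], subst Dir_commute) (simp add: Dw)
qed

text \<open>The local equation lies in the (d-1)-st power of the maximal ideal. If it also lies in
  the d-th, then D_a g = 0 and g is a cone; if not, the multiplicity is exactly d - 1, which is at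
  least 2 because d >= 3.\<close>

lemma isotropic_imp_exceptional:
  assumes g: "g \<in> forms {..n} d" "g \<noteq> 0" and d: "d \<ge> 3"
    and a: "proj_point n a" and D: "Dir n a (Dir n a g) = 0"
  shows "ST_type n d g \<or> has_singularity_of_multiplicity n d g (d - 1)"
proof (rule disjCI)
  assume no: "\<not> has_singularity_of_multiplicity n d g (d - 1)"
  define a' where "a' i = (if i \<le> n then a i else 0)" for i
  have supp: "a' i = 0" if "i > n" for i using that by (simp add: a'_def)
  have D': "Dir n a' (Dir n a' g) = 0" using D by (simp add: a'_def Dir_def)
  have a': "proj_point n a'" using a by (auto simp: a'_def proj_point_def)
  then obtain i0 where i0: "i0 \<le> n" "a' i0 \<noteq> 0" by (auto simp: proj_point_def)
  let ?h = "Fract g (Var i0 ^ d)"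
  have in1: "?h \<in> max_ideal_power n a' (d - 1)"
    using d by (intro Dir_Dir_eq_0_imp_in_max_ideal_power g i0 supp D') simp_all
  have x: "eval a' (Var i0 ^ d) \<noteq> 0" using i0 by (simp add: eval.insertion_power)
  have "Var i0 ^ d \<in> forms {..n} (d * 1)" using i0 by (intro forms_power forms_Var) simp
  then have le: "local_equation n d g a' ?h"
    unfolding local_equation_def using x by auto
  \<comment> \<open>Expansion from the origin with parameter 1: the right-hand side consists of
    values at 0 of forms of positive degree, so a lies on the hypersurface.\<close>
  have ev: "eval (\<lambda>i. 0 + 1 * a' i) g = eval (\<lambda>_. 0) g + 1 * eval (\<lambda>_. 0) (Dir n a' g)"
    by (rule Dir_Dir_eq_0_expand[OF D' supp])
  have "eval (\<lambda>_. 0) g = 0" "eval (\<lambda>_. 0) (Dir n a' g) = 0"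
    using g(1) forms_Dir[OF g(1), of n a'] d by (auto simp: eval_0 forms_iff monomials_iff)
  with ev have ev0: "eval a' g = 0" by simp
  have "?h \<in> max_ideal_power n a' d"
  proof (rule ccontr)
    assume "?h \<notin> max_ideal_power n a' d"
    then have "has_multiplicity n d g a' (d - 1)"
      unfolding has_multiplicity_def using in1 le d
      by (intro exI[of _ ?h]) (simp del: max_ideal_power.simps)
    then show False
      using no a' ev0 d unfolding has_singularity_of_multiplicity_def by auto
  qed
  then have "vanishes_to_order d a' g" using x by (rule local_equation_vanishes)
  then have "Dir n a' g = 0" by (rule vanishes_imp_Dir_eq_0[OF g(1)])
  then show "ST_type n d g"
    using d by (intro cone_imp_ST_type[OF g(1) _ g(2) a']) simp_all
qed

lemma singularity_imp_isotropic:
  assumes g: "g \<in> forms {..n} d" and d: "d \<ge> 1"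
    and s: "has_singularity_of_multiplicity n d g (d - 1)"
  shows "\<exists>a. proj_point n a \<and> Dir n a (Dir n a g) = 0"
proof -
  obtain a t where a: "proj_point n a" "Fract g t \<in> max_ideal_power n a (d - 1)" "eval a t \<noteq> 0"
    using s unfolding has_singularity_of_multiplicity_def has_multiplicity_def local_equation_def
    by blast
  have "vanishes_to_order (d - 1) a g"
    by (rule local_equation_vanishes[OF a(2,3)])
  then have "Dir n a (Dir n a g) = 0"
    by (rule vanishes_imp_Dir_Dir_eq_0[OF g _ d])
  with a(1) show ?thesis by blast
qed

text \<open>A criterion purely in terms of the Hessian form, invariant under scaling of g; the
  equations and the explicit example are both obtained from it.\<close>

definition exceptional :: "nat \<Rightarrow> nat mpoly \<Rightarrow> bool" where
  "exceptional n g \<longleftrightarrow> (\<exists>A. self_adjoint n A g \<and> \<not> scalar_matrix n A) \<or>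
    (\<exists>a. proj_point n a \<and> Dir n a (Dir n a g) = 0)"

lemma exceptional_iff:
  assumes "g \<in> forms {..n} d" "g \<noteq> 0" "d \<ge> 3"
  shows "ST_type n d g \<or> has_singularity_of_multiplicity n d g (d - 1) \<longleftrightarrow> exceptional n g"
proof -
  have "d \<ge> 1" using assms(3) by simp
  then show ?thesis
    using ST_type_imp_self_adjoint[of n d g] singularity_imp_isotropic[OF assms(1)]
      self_adjoint_imp_ST_type_or_isotropic[OF assms(1)] isotropic_imp_exceptional[OF assms]
    unfolding exceptional_def by blast
qed

section \<open>Singular systems of linear equations\<close>

text \<open>Gaussian elimination: some row has a nonzero entry at the unknown k, since otherwise the
  k-th unit vector would be a solution. That row is the pivot, and the eliminated system has one
  unknown less. The chosen rows are indexed by \<open>J\<close>, so they form a square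
  matrix.\<close>

lemma trivial_kernel_selection:
  fixes M :: "'r \<Rightarrow> 'j \<Rightarrow> complex"
  assumes "finite J"
    and "\<And>x. \<forall>r\<in>R. (\<Sum>j\<in>J. M r j * x j) = 0 \<Longrightarrow> \<forall>j\<in>J. x j = 0"
  shows "\<exists>\<rho>. (\<forall>j\<in>J. \<rho> j \<in> R) \<and>
    (\<forall>x. (\<forall>i\<in>J. (\<Sum>j\<in>J. M (\<rho> i) j * x j) = 0) \<longrightarrow> (\<forall>j\<in>J. x j = 0))"
  using assms
proof (induction J arbitrary: M rule: finite_induct)
  case empty
  then show ?case by simp
next
  case (insert k J)
  have "\<exists>r\<in>R. M r k \<noteq> 0"
  proof (rule ccontr)
    assume "\<not> (\<exists>r\<in>R. M r k \<noteq> 0)"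
    then have "\<forall>r\<in>R. (\<Sum>j\<in>insert k J. M r j * (if j = k then 1 else 0)) = 0"
      using insert.hyps by (auto intro!: sum.neutral)
    from insert.prems[OF this] show False by simp
  qed
  then obtain r0 where r0: "r0 \<in> R" "M r0 k \<noteq> 0" by blast
  define M' where "M' r j = M r j - M r k / M r0 k * M r0 j" for r j
  have M': "(\<Sum>j\<in>J. M' r j * x j) = (\<Sum>j\<in>insert k J. M r j * x j) - M r k / M r0 k * (\<Sum>j\<in>insert k J. M r0 j * x j)"
    for r x
    using insert.hyps r0
    by (simp add: M'_def left_diff_distrib sum_subtractf sum_distrib_left distrib_left mult.assoc)
  have "\<forall>j\<in>J. x j = 0" if x: "\<forall>r\<in>R. (\<Sum>j\<in>J. M' r j * x j) = 0" for x
  proof -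
    \<comment> \<open>A solution of the eliminated system is extended by solving the pivot row for
      the unknown \<open>k\<close>.\<close>
    define x' where "x' = x(k := - (\<Sum>j\<in>J. M r0 j * x j) / M r0 k)"
    have x'J: "x' j = x j" if "j \<in> J" for j using that insert.hyps by (auto simp: x'_def)
    have "(\<Sum>j\<in>J. M r j * x' j) = (\<Sum>j\<in>J. M r j * x j)" for r
      by (intro sum.cong refl) (simp add: x'J)
    then have z: "(\<Sum>j\<in>insert k J. M r0 j * x' j) = 0"
      using insert.hyps r0 by (simp add: x'_def)
    have "\<forall>r\<in>R. (\<Sum>j\<in>insert k J. M r j * x' j) = 0"
    proof
      fix r assume "r \<in> R"
      have "(\<Sum>j\<in>J. M' r j * x' j) = (\<Sum>j\<in>J. M' r j * x j)"
        by (intro sum.cong refl) (simp add: x'J)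
      then show "(\<Sum>j\<in>insert k J. M r j * x' j) = 0"
        using x \<open>r \<in> R\<close> M'[of r x'] z by simp
    qed
    from insert.prems[OF this] show ?thesis using x'J by simp
  qed
  from insert.IH[of M', OF this] obtain \<rho> where \<rho>: "\<forall>j\<in>J. \<rho> j \<in> R"
    "\<And>x. \<forall>i\<in>J. (\<Sum>j\<in>J. M' (\<rho> i) j * x j) = 0 \<Longrightarrow> \<forall>j\<in>J. x j = 0" by blast
  define \<rho>' where "\<rho>' = \<rho>(k := r0)"
  have \<rho>'J: "\<rho>' j = \<rho> j" if "j \<in> J" for j using that insert.hyps by (auto simp: \<rho>'_def)
  have "\<forall>j\<in>insert k J. x j = 0"
    if x: "\<forall>i\<in>insert k J. (\<Sum>j\<in>insert k J. M (\<rho>' i) j * x j) = 0" for x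
  proof -
    have z: "(\<Sum>j\<in>insert k J. M r0 j * x j) = 0"
      using x by (simp add: \<rho>'_def)
    have "\<forall>i\<in>J. (\<Sum>j\<in>J. M' (\<rho> i) j * x j) = 0"
    proof
      fix i assume "i \<in> J"
      then have "(\<Sum>j\<in>insert k J. M (\<rho> i) j * x j) = 0" using x \<rho>'J by simp
      then show "(\<Sum>j\<in>J. M' (\<rho> i) j * x j) = 0" using M'[of "\<rho> i" x] z by simp
    qed
    from \<rho>(2)[OF this] have xJ: "\<forall>j\<in>J. x j = 0" .
    then have "(\<Sum>j\<in>J. M r0 j * x j) = 0" by simp
    then show ?thesis using z r0 insert.hyps xJ by simp
  qed
  moreover have "\<forall>j\<in>insert k J. \<rho>' j \<in> R" using \<rho>(1) r0(1) by (auto simp: \<rho>'_def)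
  ultimately show ?case by blast
qed

lemma det_eq_0_iff_kernel:
  fixes M :: "'j \<Rightarrow> 'j \<Rightarrow> complex"
  assumes e: "bij_betw e {..<N} J"
  shows "det (mat N N (\<lambda>(i, j). M (e i) (e j))) = 0 \<longleftrightarrow>
    (\<exists>x. (\<exists>j\<in>J. x j \<noteq> 0) \<and> (\<forall>i\<in>J. (\<Sum>j\<in>J. M i j * x j) = 0))"
proof -
  let ?A = "mat N N (\<lambda>(i, j). M (e i) (e j))"
  have car: "?A \<in> carrier_mat N N" by simp
  have im: "e ` {..<N} = J" and inj: "inj_on e {..<N}" using e by (auto simp: bij_betw_def)
  have mv: "(?A *\<^sub>v v) $ i = (\<Sum>j<N. M (e i) (e j) * v $ j)" if "i < N" "v \<in> carrier_vec N" for i v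
    using that by (simp add: scalar_prod_def atLeast0LessThan)
  have re: "(\<Sum>j\<in>J. h j) = (\<Sum>j<N. h (e j))" for h :: "'j \<Rightarrow> complex"
    unfolding im[symmetric] by (simp add: sum.reindex[OF inj])
  show ?thesis
    unfolding det_0_iff_vec_prod_zero[OF car]
  proof
    assume "\<exists>v. v \<in> carrier_vec N \<and> v \<noteq> 0\<^sub>v N \<and> ?A *\<^sub>v v = 0\<^sub>v N"
    then obtain v where v: "v \<in> carrier_vec N" "v \<noteq> 0\<^sub>v N" "?A *\<^sub>v v = 0\<^sub>v N" by blast
    define x where "x j = v $ (the_inv_into {..<N} e j)" for j
    have x: "x (e j) = v $ j" if "j < N" for j
      using that by (simp add: x_def the_inv_into_f_f[OF inj])
    obtain k where k: "k < N" "v $ k \<noteq> 0" using v by (metis carrier_vecD eq_vecI index_zero_vec)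
    have "(\<Sum>j\<in>J. M i j * x j) = 0" if i: "i \<in> J" for i
    proof -
      obtain i' where i': "i = e i'" "i' < N" using i im by blast
      show ?thesis
        unfolding re using mv[OF i'(2) v(1)] v(3) i' by (simp add: x)
    qed
    moreover have "x (e k) \<noteq> 0" "e k \<in> J" using k im by (auto simp: x)
    ultimately show "\<exists>x. (\<exists>j\<in>J. x j \<noteq> 0) \<and> (\<forall>i\<in>J. (\<Sum>j\<in>J. M i j * x j) = 0)" by blast
  next
    assume "\<exists>x. (\<exists>j\<in>J. x j \<noteq> 0) \<and> (\<forall>i\<in>J. (\<Sum>j\<in>J. M i j * x j) = 0)"
    then obtain x j where x: "j \<in> J" "x j \<noteq> 0" "\<forall>i\<in>J. (\<Sum>j\<in>J. M i j * x j) = 0" by blast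
    define v where "v = vec N (\<lambda>i. x (e i))"
    obtain k where k: "j = e k" "k < N" using x(1) im by blast
    have "v $ k \<noteq> 0" using x(2) k by (simp add: v_def)
    then have "v \<noteq> 0\<^sub>v N" using k by auto
    moreover have "?A *\<^sub>v v = 0\<^sub>v N"
    proof (rule eq_vecI)
      fix i assume i: "i < dim_vec (0\<^sub>v N :: complex vec)"
      then have "e i \<in> J" using im by auto
      then show "(?A *\<^sub>v v) $ i = 0\<^sub>v N $ i"
        using i x(3) by (simp add: mv v_def re scalar_prod_def atLeast0LessThan)
    qed simp
    moreover have "v \<in> carrier_vec N" by (simp add: v_def)
    ultimately show "\<exists>v. v \<in> carrier_vec N \<and> v \<noteq> 0\<^sub>v N \<and> ?A *\<^sub>v v = 0\<^sub>v N" by blast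
  qed
qed

lemma forms_uminus: "f \<in> forms X d \<Longrightarrow> - f \<in> forms X d"
  by (simp add: forms_iff)

lemma det_in_forms:
  assumes "\<And>i j. i < N \<Longrightarrow> j < N \<Longrightarrow> P i j \<in> forms X 1"
  shows "det (mat N N (\<lambda>(i, j). P i j)) \<in> forms X N"
proof -
  have car: "mat N N (\<lambda>(i, j). P i j) \<in> carrier_mat N N" by simp
  have "signof p * (\<Prod>i = 0..<N. mat N N (\<lambda>(i, j). P i j) $$ (i, p i)) \<in> forms X N"
    if p: "p permutes {0..<N}" for p
  proof -
    have "(\<Prod>i = 0..<N. mat N N (\<lambda>(i, j). P i j) $$ (i, p i)) \<in> forms X (\<Sum>i = 0..<N. 1)"
      by (rule forms_prod) (use assms p permutes_in_image[OF p] in auto)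
    then show ?thesis by (auto simp: sign_def intro: forms_uminus)
  qed
  then show ?thesis
    unfolding det_def'[OF car] by (intro forms_sum) simp
qed

lemma eval_det:
  "eval b (det (mat N N (\<lambda>(i, j). P i j))) = det (mat N N (\<lambda>(i, j). eval b (P i j)))"
proof -
  have car: "mat N N (\<lambda>(i, j). h i j) \<in> carrier_mat N N" for h :: "nat \<Rightarrow> nat \<Rightarrow> 'r" by simp
  have "eval b (signof p * (\<Prod>i = 0..<N. mat N N (\<lambda>(i, j). P i j) $$ (i, p i))) =
    signof p * (\<Prod>i = 0..<N. mat N N (\<lambda>(i, j). eval b (P i j)) $$ (i, p i))"
    if p: "p permutes {0..<N}" for p
  proof -
    have "eval b (\<Prod>i = 0..<N. mat N N (\<lambda>(i, j). P i j) $$ (i, p i)) =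
      (\<Prod>i = 0..<N. mat N N (\<lambda>(i, j). eval b (P i j)) $$ (i, p i))"
      unfolding eval.insertion_prod
      by (intro prod.cong refl) (use permutes_in_image[OF p] in auto)
    then show ?thesis by (auto simp: sign_def eval.insertion_uminus)
  qed
  then show ?thesis
    unfolding det_def'[OF car] eval.insertion_sum by (intro sum.cong) auto
qed

definition solvable :: "'r set \<Rightarrow> 'j set \<Rightarrow> ('r \<Rightarrow> 'j \<Rightarrow> complex) \<Rightarrow> bool" where
  "solvable R J M \<longleftrightarrow> (\<exists>x. (\<exists>j\<in>J. x j \<noteq> 0) \<and> (\<forall>r\<in>R. (\<Sum>j\<in>J. M r j * x j) = 0))"

text \<open>The equations are the maximal minors, one for each choice \<rho> of rows: a system with
  only the zero solution contains a square subsystem with the same property, whose determinant is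
  then nonzero. As the entries are linear forms, each minor is a form of degree
  \<open>card J\<close>.\<close>

lemma solvable_system_equations:
  fixes P :: "'r \<Rightarrow> 'j \<Rightarrow> 'x mpoly"
  assumes J: "finite J" and P: "\<And>r j. r \<in> R \<Longrightarrow> j \<in> J \<Longrightarrow> P r j \<in> forms X 1"
  obtains \<Phi> where "\<forall>F\<in>\<Phi>. \<exists>k. F \<in> forms X k"
    "\<forall>b. (\<forall>F\<in>\<Phi>. eval b F = 0) \<longleftrightarrow> solvable R J (\<lambda>r j. eval b (P r j))"
proof -
  obtain e where e: "bij_betw e {..<card J} J"
    using ex_bij_betw_nat_finite[OF J] by (auto simp: atLeast0LessThan)
  define D where "D \<rho> = det (mat (card J) (card J) (\<lambda>(i, j). P (\<rho> (e i)) (e j)))" for \<rho>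
  define \<Phi> where "\<Phi> = D ` {\<rho>. \<forall>j\<in>J. \<rho> j \<in> R}"
  have eJ: "e i \<in> J" if "i < card J" for i using e that by (auto simp: bij_betw_def)
  have ev: "eval b (D \<rho>) = 0 \<longleftrightarrow>
    (\<exists>x. (\<exists>j\<in>J. x j \<noteq> 0) \<and> (\<forall>i\<in>J. (\<Sum>j\<in>J. eval b (P (\<rho> i) j) * x j) = 0))" for b \<rho>
    unfolding D_def eval_det by (rule det_eq_0_iff_kernel[OF e, of "\<lambda>i j. eval b (P (\<rho> i) j)"])
  show thesis
  proof (rule that)
    show "\<forall>F\<in>\<Phi>. \<exists>k. F \<in> forms X k"
      unfolding \<Phi>_def D_def using P eJ by (auto intro!: exI[of _ "card J"] det_in_forms)
    show "\<forall>b. (\<forall>F\<in>\<Phi>. eval b F = 0) \<longleftrightarrow> solvable R J (\<lambda>r j. eval b (P r j))"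
    proof (intro allI iffI)
      fix b assume van: "\<forall>F\<in>\<Phi>. eval b F = 0"
      show "solvable R J (\<lambda>r j. eval b (P r j))"
      proof (rule ccontr)
        assume "\<not> solvable R J (\<lambda>r j. eval b (P r j))"
        then obtain \<rho> where "\<forall>j\<in>J. \<rho> j \<in> R"
          "\<forall>x. (\<forall>i\<in>J. (\<Sum>j\<in>J. eval b (P (\<rho> i) j) * x j) = 0) \<longrightarrow> (\<forall>j\<in>J. x j = 0)"
          using trivial_kernel_selection[OF J, of R "\<lambda>r j. eval b (P r j)"]
          unfolding solvable_def by blast
        moreover from this(1) have "eval b (D \<rho>) = 0" using van by (auto simp: \<Phi>_def)
        ultimately show False unfolding ev by blast
      qed
    next
      fix b assume "solvable R J (\<lambda>r j. eval b (P r j))"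
      then show "\<forall>F\<in>\<Phi>. eval b F = 0"
        unfolding solvable_def \<Phi>_def by (auto simp: ev)
    qed
  qed
qed

section \<open>The projective Nullstellensatz\<close>

definition is_ideal :: "'x mpoly set \<Rightarrow> bool" where
  "is_ideal I \<longleftrightarrow> 0 \<in> I \<and> (\<forall>f\<in>I. \<forall>g\<in>I. f + g \<in> I) \<and> (\<forall>f\<in>I. \<forall>h. h * f \<in> I)"

lemma ideal_add: "is_ideal I \<Longrightarrow> f \<in> I \<Longrightarrow> g \<in> I \<Longrightarrow> f + g \<in> I"
  by (simp add: is_ideal_def)

lemma ideal_mult: "is_ideal I \<Longrightarrow> f \<in> I \<Longrightarrow> h * f \<in> I"
  by (simp add: is_ideal_def)

lemma ideal_mult2: "is_ideal I \<Longrightarrow> f \<in> I \<Longrightarrow> f * h \<in> I"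
  by (simp add: is_ideal_def mult.commute[of f])

lemma ideal_sum: "is_ideal I \<Longrightarrow> (\<And>i. i \<in> S \<Longrightarrow> h i \<in> I) \<Longrightarrow> sum h S \<in> I"
  by (induction S rule: infinite_finite_induct) (auto simp: is_ideal_def)

lemma ideal_diff: "is_ideal I \<Longrightarrow> f \<in> I \<Longrightarrow> g \<in> I \<Longrightarrow> f - g \<in> I"
  using ideal_add[of I f "-1 * g"] ideal_mult[of I g "-1"] by simp

lemma ideal_const_imp_one: "is_ideal I \<Longrightarrow> const c \<in> I \<Longrightarrow> c \<noteq> 0 \<Longrightarrow> 1 \<in> I"
  using ideal_mult[of I "const c" "const (1 / c)"] by (simp flip: const_mult)

lemma ideal_extend: "is_ideal I \<Longrightarrow> is_ideal {f + h * p | f h. f \<in> I}"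
proof -
  assume I: "is_ideal I"
  show ?thesis
    unfolding is_ideal_def
  proof (intro conjI ballI allI)
    show "0 \<in> {f + h * p | f h. f \<in> I}"
      using I by (auto simp: is_ideal_def intro!: exI[of _ 0])
  next
    fix x y assume "x \<in> {f + h * p | f h. f \<in> I}" "y \<in> {f + h * p | f h. f \<in> I}"
    then obtain f h f' h' where "x = f + h * p" "y = f' + h' * p" "f \<in> I" "f' \<in> I" by blast
    then show "x + y \<in> {f + h * p | f h. f \<in> I}"
      using ideal_add[OF I] by (intro CollectI exI[of _ "f + f'"] exI[of _ "h + h'"]) (simp add: algebra_simps)
  next
    fix x k assume "x \<in> {f + h * p | f h. f \<in> I}"
    then obtain f h where "x = f + h * p" "f \<in> I" by blast
    then show "k * x \<in> {f + h * p | f h. f \<in> I}"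
      using ideal_mult[OF I] by (intro CollectI exI[of _ "k * f"] exI[of _ "k * h"]) (simp add: algebra_simps)
  qed
qed

lemma const_diff: "const (a - b) = const a - const b"
  unfolding eq_diff_eq const_add[symmetric] by simp

definition upoly :: "'x \<Rightarrow> complex poly \<Rightarrow> 'x mpoly" where
  "upoly i q = poly (map_poly const q) (Var i)"

lemma upoly_pCons: "upoly i (pCons c q) = const c + Var i * upoly i q"
  unfolding upoly_def by (cases "c = 0 \<and> q = 0") (auto simp: map_poly_pCons)

lemma eval_upoly: "eval a (upoly i q) = poly q (a i)"
proof (induction q)
  case 0
  then show ?case by (simp add: upoly_def eval.insertion_zero)
next
  case (pCons c q)
  then show ?case by (simp add: upoly_pCons eval.insertion_add eval.insertion_mult)
qed

text \<open>Over the complex numbers q splits into factors x_i - r, each of them invertible modulo I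
  with inverse \<open>u r\<close>; cancelling them one by one leaves a nonzero constant in
  I.\<close>

lemma upoly_in_ideal_imp_one:
  fixes I :: "nat mpoly set"
  assumes I: "is_ideal I" and u: "\<And>c. 1 - u c * (Var i - const c) \<in> I"
    and "upoly i q \<in> I" "q \<noteq> 0"
  shows "1 \<in> I"
  using assms(3,4)
proof (induction "degree q" arbitrary: q)
  case 0
  then obtain c where c: "q = [:c:]" by (metis degree_eq_zeroE)
  then have "upoly i q = const c" by (simp add: upoly_pCons upoly_def[of i 0])
  then show ?case using 0 c ideal_const_imp_one[OF I, of c] by simp
next
  case (Suc k)
  have "\<not> constant (poly q)" using Suc.hyps(2) by (simp add: constant_degree)
  then obtain r where "poly q r = 0" using fundamental_theorem_of_algebra by blast
  then obtain q' where q': "q = [:- r, 1:] * q'" by (metis dvdE poly_eq_0_iff_dvd)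
  then have "q' \<noteq> 0" using Suc.prems by auto
  have deg: "k = degree q'"
    using Suc.hyps(2) \<open>q' \<noteq> 0\<close> unfolding q' by (subst (asm) degree_mult_eq) auto
  have fac: "upoly i q = (Var i - const r) * upoly i q'"
    by (rule mpoly_eqI) (simp add: eval_upoly q' eval.insertion_mult eval.insertion_diff algebra_simps)
  have "upoly i q' = (1 - u r * (Var i - const r)) * upoly i q' + u r * upoly i q"
    unfolding fac by (simp add: algebra_simps)
  also have "\<dots> \<in> I"
    by (intro ideal_add[OF I] ideal_mult[OF I] ideal_mult2[OF I] u Suc.prems)
  finally show ?case using Suc.hyps(1)[OF deg] \<open>q' \<noteq> 0\<close> by blast
qed

text \<open>This exhausts the polynomial ring by countably many finite-dimensional pieces;
  \<open>D\<close> bounds both the degree and the indices of the variables.\<close>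

lemma finite_support_union:
  "\<exists>D. keys (f :: nat mpoly) \<subseteq> (\<Union>k<D. monomials {..<D} k)"
proof -
  have 1: "\<exists>D. m \<in> (\<Union>k<D. monomials {..<D} k)" for m :: "nat \<Rightarrow>\<^sub>0 nat"
  proof -
    obtain B where "\<forall>i\<in>keys m. i < B"
      using finite_nat_set_iff_bounded[of "keys m"] by auto
    then have "m \<in> (\<Union>k<B + deg m + 1. monomials {..<B + deg m + 1} k)"
      by (auto simp: monomials_iff)
    then show ?thesis by blast
  qed
  have mono: "(\<Union>k<D. monomials {..<D} k) \<subseteq> (\<Union>k<D'. monomials {..<D'} k)" if "D \<le> D'" for D D' :: nat
    using that by (force simp: monomials_iff)
  have "\<exists>D. S \<subseteq> (\<Union>k<D. monomials {..<D} k)" if "finite S" for S :: "(nat \<Rightarrow>\<^sub>0 nat) set"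
    using that
  proof (induction S rule: finite_induct)
    case (insert m S)
    then obtain D where D: "S \<subseteq> (\<Union>k<D. monomials {..<D} k)" by blast
    obtain D' where D': "m \<in> (\<Union>k<D'. monomials {..<D'} k)" using 1 by blast
    have "insert m S \<subseteq> (\<Union>k<max D D'. monomials {..<max D D'} k)"
      using D D' mono[of D "max D D'"] mono[of D' "max D D'"] by (meson insert_subset max.cobounded1 max.cobounded2 subset_iff)
    then show ?case by blast
  qed simp
  then show ?thesis by simp
qed

text \<open>
  If every \<open>x\<^sub>i - c\<close> were invertible modulo \<open>I\<close>, the uncountably many inverses would be linearly
  dependent, since the polynomial ring has countable dimension; clearing denominators in a
  dependence relation would put a nonzero polynomial in \<open>x\<^sub>i\<close> alone into \<open>I\<close>.
\<close>

lemma ideal_extend_proper: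
  fixes I :: "nat mpoly set"
  assumes I: "is_ideal I" and one: "1 \<notin> I"
  shows "\<exists>c. 1 \<notin> {f + h * (Var i - const c) | f h. f \<in> I}"
proof (rule ccontr)
  assume "\<not> ?thesis"
  then have ext: "\<exists>f h. 1 = f + h * (Var i - const c) \<and> f \<in> I" for c by blast
  have "\<forall>c. \<exists>h. 1 - h * (Var i - const c) \<in> I"
  proof
    fix c
    obtain f h where "1 = f + h * (Var i - const c)" "f \<in> I" using ext by blast
    then have "1 - h * (Var i - const c) \<in> I" by (metis add_diff_cancel_right')
    then show "\<exists>h. 1 - h * (Var i - const c) \<in> I" ..
  qed
  then obtain u where u: "1 - u c * (Var i - const c) \<in> I" for c by metis
  \<comment> \<open>Infinitely many \<open>c\<close> must yield infinitely many vectors. If two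
    inverses coincided, subtracting would put (c - c') u_c into I, hence u_c, hence 1.\<close>
  have uinj: "inj u"
  proof (rule injI, rule ccontr)
    fix c c' assume eq: "u c = u c'" and "c \<noteq> c'"
    have "(1 - u c * (Var i - const c)) - (1 - u c' * (Var i - const c')) \<in> I"
      by (intro ideal_diff[OF I] u)
    also have "(1 - u c * (Var i - const c)) - (1 - u c' * (Var i - const c')) = const (c - c') * u c"
      unfolding eq const_diff by (simp add: algebra_simps)
    finally have "const (1 / (c - c')) * (const (c - c') * u c) \<in> I" by (rule ideal_mult[OF I])
    then have "u c \<in> I" using \<open>c \<noteq> c'\<close> by (simp flip: const_mult mult.assoc)
    then have "1 - u c * (Var i - const c) + u c * (Var i - const c) \<in> I"
      by (intro ideal_add[OF I] u ideal_mult2[OF I])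
    then show False using one by simp
  qed
  define T where "T D = (\<Union>k<D. monomials {..<D} k)" for D :: nat
  define C where "C D = {c. keys (u c) \<subseteq> T D}" for D
  \<comment> \<open>Otherwise the complex numbers would be a countable union of finite sets.\<close>
  have "\<exists>D. infinite (C D)"
  proof (rule ccontr)
    assume "\<not> (\<exists>D. infinite (C D))"
    then have "countable (\<Union>D. C D)" by (auto intro: countable_finite)
    moreover have "(\<Union>D. C D) = UNIV" using finite_support_union by (auto simp: C_def T_def)
    ultimately have "countable (UNIV :: complex set)" by simp
    then have "countable (range complex_of_real)" by (rule countable_subset[OF subset_UNIV])
    then have "countable (UNIV :: real set)"
      by (rule countable_image_inj_on) (simp add: inj_on_def)
    then show False using uncountable_UNIV_real by simp
  qed
  then obtain D where D: "infinite (C D)" by blast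
  have fT: "finite (T D)" by (simp add: T_def finite_monomials)
  have "u ` C D \<subseteq> mpoly.span ((\<lambda>m. single m 1) ` T D)"
  proof
    fix f assume "f \<in> u ` C D"
    then have k: "keys f \<subseteq> T D" by (auto simp: C_def)
    have s: "single m c = scale c (single m 1)" for m :: "nat \<Rightarrow>\<^sub>0 nat" and c
      by (simp add: scale_def const_def mult_single)
    have "scale c (single m 1) \<in> mpoly.span ((\<lambda>m. single m 1) ` T D)"
      if "m \<in> keys f" for m c
      using that k by (intro mpoly.span_scale mpoly.span_base) auto
    then have "(\<Sum>m\<in>keys f. single m (lookup f m))
        \<in> mpoly.span ((\<lambda>m. single m 1) ` T D)"
      using s by (intro mpoly.span_sum) metis
    then show "f \<in> mpoly.span ((\<lambda>m. single m 1) ` T D)"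
      by (simp flip: poly_mapping_eq_sum_single)
  qed
  moreover have "infinite (u ` C D)"
    using D inj_on_subset[OF uinj] by (simp add: finite_image_iff)
  ultimately have "mpoly.dependent (u ` C D)"
    using mpoly.independent_span_bound[OF finite_imageI[OF fT]] by blast
  then obtain S \<alpha> v where S: "finite S" "S \<subseteq> u ` C D" "(\<Sum>v\<in>S. scale (\<alpha> v) v) = 0" "v \<in> S" "\<alpha> v \<noteq> 0"
    unfolding mpoly.dependent_explicit by blast
  define C' where "C' = u -` S"
  have uC': "u ` C' = S" using S(2) by (auto simp: C'_def)
  have fC': "finite C'" unfolding C'_def using S(1) uinj by (rule finite_vimageI)
  define \<beta> where "\<beta> c = \<alpha> (u c)" for c
  have rel: "(\<Sum>c\<in>C'. const (\<beta> c) * u c) = 0"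
    using S(3) unfolding uC'[symmetric] \<beta>_def
    by (subst (asm) sum.reindex) (auto simp: scale_def intro: inj_on_subset[OF uinj])
  obtain c0 where c0: "c0 \<in> C'" "\<beta> c0 \<noteq> 0" using S(4,5) uC' by (auto simp: \<beta>_def)
  let ?w = "\<lambda>c. \<Prod>c'\<in>C' - {c}. Var i - const c'"
  \<comment> \<open>The numerator of the sum of all \<beta>_c / (x - c) over the common denominator;
    at c0 only the term of c0 survives.\<close>
  define q where "q = (\<Sum>c\<in>C'. Polynomial.smult (\<beta> c) (\<Prod>c'\<in>C' - {c}. [:- c', 1:]))"
  have "poly q c0 = (\<Sum>c\<in>C'. if c = c0 then \<beta> c0 * (\<Prod>c'\<in>C' - {c0}. c0 - c') else 0)"
    unfolding q_def poly_sum using fC' c0(1)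
    by (intro sum.cong refl) (auto simp: poly_prod)
  then have "poly q c0 \<noteq> 0" using fC' c0 by simp
  then have "q \<noteq> 0" by auto
  have w: "(Var i - const c) * ?w c = (\<Prod>c'\<in>C'. Var i - const c')" if "c \<in> C'" for c
    using prod.remove[OF fC' that, of "\<lambda>c'. Var i - const c'"] by simp
  have "upoly i q = (\<Sum>c\<in>C'. const (\<beta> c) * ?w c)"
    by (rule mpoly_eqI)
      (simp add: eval_upoly q_def poly_sum poly_prod eval.insertion_sum eval.insertion_mult
        eval.insertion_prod eval.insertion_diff)
  \<comment> \<open>Subtracting the dependence relation times the full product turns each summand
    into a multiple of 1 - u_c (x_i - c), which lies in I.\<close>
  also have "\<dots> = (\<Sum>c\<in>C'. const (\<beta> c) * ?w c) - (\<Sum>c\<in>C'. const (\<beta> c) * u c) * (\<Prod>c'\<in>C'. Var i - const c')"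
    by (simp add: rel)
  also have "\<dots> = (\<Sum>c\<in>C'. const (\<beta> c) * ?w c * (1 - u c * (Var i - const c)))"
    unfolding sum_distrib_right sum_subtractf[symmetric]
    by (intro sum.cong refl) (simp add: w[symmetric] algebra_simps)
  also have "\<dots> \<in> I"
    by (intro ideal_sum[OF I] ideal_mult[OF I] u)
  finally show False
    using upoly_in_ideal_imp_one[OF I u _ \<open>q \<noteq> 0\<close>] one by blast
qed

text \<open>The coordinates of a zero are found one at a time, adjoining x_i - c_i while the ideal
  stays proper.\<close>

lemma ideal_extend_point:
  fixes I :: "nat mpoly set"
  assumes "finite X" "is_ideal I" "1 \<notin> I"
  shows "\<exists>I' c. is_ideal I' \<and> I \<subseteq> I' \<and> 1 \<notin> I' \<and> (\<forall>i\<in>X. Var i - const (c i) \<in> I')"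
  using assms(1)
proof (induction X rule: finite_induct)
  case empty
  then show ?case using assms by blast
next
  case (insert i X)
  then obtain I' c where I': "is_ideal I'" "I \<subseteq> I'" "1 \<notin> I'" "\<forall>i\<in>X. Var i - const (c i) \<in> I'"
    by blast
  obtain c0 where c0: "1 \<notin> {f + h * (Var i - const c0) | f h. f \<in> I'}"
    using ideal_extend_proper[OF I'(1,3)] by blast
  let ?I = "{f + h * (Var i - const c0) | f h. f \<in> I'}"
  have sub: "I' \<subseteq> ?I" by (auto intro!: exI[of _ 0] exI)
  have "Var i - const c0 \<in> ?I"
    using I'(1) by (intro CollectI exI[of _ 0] exI[of _ 1]) (simp add: is_ideal_def)
  then have "\<forall>j\<in>insert i X. Var j - const ((c(i := c0)) j) \<in> ?I"
    using insert.hyps I'(4) sub by auto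
  moreover have "is_ideal ?I" by (rule ideal_extend[OF I'(1)])
  moreover have "I \<subseteq> ?I" using I'(2) sub by blast
  ultimately show ?case using c0 by blast
qed

text \<open>Congruence modulo I respects sums and products, and each x_i is congruent to
  c_i.\<close>

lemma form_congruent_eval:
  fixes I :: "nat mpoly set"
  assumes I: "is_ideal I" and c: "\<forall>i\<in>X. Var i - const (c i) \<in> I" and f: "f \<in> forms X d"
  shows "f - const (eval c f) \<in> I"
proof -
  have mul: "x * y - const (a * b) \<in> I" if "x - const a \<in> I" "y - const b \<in> I" for x y a b
  proof -
    have "x * y - const (a * b) = x * (y - const b) + (x - const a) * const b"
      by (simp add: const_mult algebra_simps)
    also have "\<dots> \<in> I" by (intro ideal_add[OF I] ideal_mult[OF I] ideal_mult2[OF I] that)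
    finally show ?thesis .
  qed
  have z: "0 \<in> I" using I by (simp add: is_ideal_def)
  have pw: "x ^ k - const (a ^ k) \<in> I" if "x - const a \<in> I" for x a k
    by (induction k) (use z mul that in auto)
  have pr: "(\<Prod>i\<in>S. h i) - const (\<Prod>i\<in>S. a i) \<in> I" if "finite S" "\<And>i. i \<in> S \<Longrightarrow> h i - const (a i) \<in> I"
    for S :: "nat set" and h :: "nat \<Rightarrow> nat mpoly" and a
    using that by (induction S rule: finite_induct) (use z mul in auto)
  have mon: "const b * monom_eval Var m - const (b * monom_eval c m) \<in> I"
    if "keys m \<subseteq> X" for m b
    unfolding monom_eval_def by (intro mul pr pw) (use that c z in auto)
  have "const (sum h S) = (\<Sum>i\<in>S. const (h i))" for h :: "(nat \<Rightarrow>\<^sub>0 nat) \<Rightarrow> complex" and S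
    by (induction S rule: infinite_finite_induct) (simp_all add: const_add)
  then have "subst Var f - const (eval c f) = (\<Sum>m\<in>keys f.
      const (lookup f m) * monom_eval Var m - const (lookup f m * monom_eval c m))"
    by (simp add: subst_eq_insertion eval_eq_insertion insertion_def sum_subtractf)
  also have "\<dots> \<in> I"
    using f by (intro ideal_sum[OF I] mon) (auto simp: forms_def monomials_def)
  finally show ?thesis by simp
qed

section \<open>Homogeneous components and homogeneous ideals\<close>

definition hom_part :: "nat \<Rightarrow> 'x mpoly \<Rightarrow> 'x mpoly" where
  "hom_part k f = Poly_Mapping.mapp (\<lambda>m c. c when deg m = k) f"

lemma lookup_hom_part:
  "lookup (hom_part k f) m = (if deg m = k then lookup f m else 0)"
  by (simp add: hom_part_def lookup_mapp when_def in_keys_iff)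

lemma hom_part_add: "hom_part k (f + g) = hom_part k f + hom_part k g"
  by (rule poly_mapping_eqI) (simp add: lookup_hom_part lookup_add)

lemma hom_part_diff: "hom_part k (f - g) = hom_part k f - hom_part k g"
  by (rule poly_mapping_eqI) (simp add: lookup_hom_part lookup_minus)

lemma hom_part_scale: "hom_part k (scale c f) = scale c (hom_part k f)"
  by (rule poly_mapping_eqI) (simp add: lookup_hom_part)

lemma hom_part_0 [simp]: "hom_part k 0 = 0"
  by (rule poly_mapping_eqI) (simp add: lookup_hom_part)

lemma hom_part_sum: "hom_part k (sum h S) = (\<Sum>i\<in>S. hom_part k (h i))"
  by (induction S rule: infinite_finite_induct) (simp_all add: hom_part_add)

lemma hom_part_single:
  "hom_part k (single m c) = (if deg m = k then single m c else 0)"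
  by (rule poly_mapping_eqI) (simp add: lookup_hom_part lookup_single when_def)

lemma hom_part_one: "hom_part k 1 = (if k = 0 then 1 else 0)"
  by (rule poly_mapping_eqI) (simp add: lookup_hom_part lookup_one when_def)

lemma hom_part_form: "f \<in> forms X e \<Longrightarrow> hom_part k f = (if k = e then f else 0)"
  by (rule poly_mapping_eqI) (auto simp: lookup_hom_part forms_iff monomials_iff)

lemma hom_part_Var_mult:
  "hom_part k (Var i * h) = (case k of 0 \<Rightarrow> 0 | Suc k' \<Rightarrow> Var i * hom_part k' h)"
proof -
  have s: "hom_part k (Var i * single m c) =
    (case k of 0 \<Rightarrow> 0 | Suc k' \<Rightarrow> Var i * hom_part k' (single m c))" for m c
    by (simp add: Var_def mult_single hom_part_single deg_add split: nat.split)
  have "hom_part k (Var i * (\<Sum>m\<in>keys h. single m (lookup h m))) =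
    (case k of 0 \<Rightarrow> 0 | Suc k' \<Rightarrow>
      Var i * hom_part k' (\<Sum>m\<in>keys h. single m (lookup h m)))"
    unfolding sum_distrib_left hom_part_sum s by (simp split: nat.split)
  then show ?thesis unfolding poly_mapping_eq_sum_single[of h, symmetric] .
qed

lemma hom_part_eventually_0: "\<exists>k. hom_part k f = 0"
proof -
  have "finite (deg ` keys f)" by simp
  then obtain k where "k \<notin> deg ` keys f" using ex_new_if_finite infinite_UNIV_nat by blast
  then have "hom_part k f = 0"
    by (intro poly_mapping_eqI) (auto simp: lookup_hom_part in_keys_iff)
  then show ?thesis ..
qed

text \<open>Taking the linear span of monomial multiples, instead of sums with polynomial
  coefficients, reduces statements on homogeneous components and on linear functionals to single
  generators.\<close>

definition gen_ideal :: "'x mpoly set \<Rightarrow> 'x mpoly set" where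
  "gen_ideal Q = mpoly.span {single \<beta> 1 * q | \<beta> q. q \<in> Q}"

lemma gen_ideal_is_ideal: "is_ideal (gen_ideal Q)"
proof -
  let ?G = "{single \<beta> 1 * q | \<beta> q. q \<in> Q}"
  have single: "single m c * f \<in> mpoly.span ?G" if "f \<in> mpoly.span ?G" for m c f
    using that
  proof (induction rule: mpoly.span_induct_alt)
    case base
    then show ?case by (simp add: mpoly.span_zero)
  next
    case (step b x y)
    then obtain \<beta> q where x: "x = single \<beta> 1 * q" "q \<in> Q" by blast
    have "single (m + \<beta>) 1 * q \<in> ?G" using x(2) by blast
    then have "scale (b * c) (single (m + \<beta>) 1 * q) \<in> mpoly.span ?G"
      by (intro mpoly.span_scale mpoly.span_base)
    moreover have "scale (b * c) (single (m + \<beta>) 1 * q) =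
        single m c * scale b x"
    proof -
      have "single 0 (b * c) * single (m + \<beta>) (1::complex) =
        single m c * (single 0 b * single \<beta> 1)"
        by (simp add: mult_single mult.commute add.commute)
      then show ?thesis by (simp add: x scale_def const_def flip: mult.assoc)
    qed
    ultimately show ?case
      using step by (simp add: distrib_left mpoly.span_add)
  qed
  have "(\<Sum>m\<in>keys h. single m (lookup h m)) * f \<in> mpoly.span ?G"
    if "f \<in> mpoly.span ?G" for h f
    unfolding sum_distrib_right by (intro mpoly.span_sum single that)
  then show ?thesis
    unfolding is_ideal_def gen_ideal_def
    by (auto simp: mpoly.span_zero mpoly.span_add simp flip: poly_mapping_eq_sum_single)
qed

lemma gen_ideal_superset: "q \<in> Q \<Longrightarrow> q \<in> gen_ideal Q"
  unfolding gen_ideal_def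
  by (rule mpoly.span_base) (auto intro!: exI[of _ 0] exI[of _ q])

lemma gen_ideal_hom_part:
  assumes Q: "\<And>q. q \<in> Q \<Longrightarrow> q \<in> forms X e" and f: "f \<in> gen_ideal Q"
  shows "hom_part k f \<in> gen_ideal Q"
  using f unfolding gen_ideal_def
proof (induction rule: mpoly.span_induct_alt)
  case base
  then show ?case by (simp add: mpoly.span_zero)
next
  case (step c x y)
  then obtain \<beta> q where x: "x = single \<beta> 1 * q" "q \<in> Q" by blast
  have "single \<beta> (1::complex) \<in> forms UNIV (deg \<beta>)"
    by (rule forms_single) (simp add: monomials_iff)
  then have "x \<in> forms UNIV (deg \<beta> + e)"
    unfolding x(1) using forms_mono[OF _ Q[OF x(2)], of UNIV] by (intro forms_mult) auto
  then have hx: "hom_part k x = (if k = deg \<beta> + e then x else 0)" by (rule hom_part_form)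
  have "x \<in> mpoly.span {single \<beta> 1 * q | \<beta> q. q \<in> Q}"
    using step(1) by (rule mpoly.span_base)
  then have "hom_part k x \<in> mpoly.span {single \<beta> 1 * q | \<beta> q. q \<in> Q}"
    unfolding hx by (simp only: mpoly.span_zero split: if_split) simp
  then show ?case
    using step(2) by (simp add: hom_part_add hom_part_scale mpoly.span_add mpoly.span_scale)
qed

text \<open>Dehomogenise by x_i = 1: a common zero of I and x_i - 1 would be a projective zero of Q,
  so 1 = f + h (x_i - 1) with f in I. Comparing homogeneous components, h_k is congruent to -x_i^k
  modulo I, and h_k = 0 for some k.\<close>

lemma Var_power_in_gen_ideal:
  fixes Q :: "nat mpoly set"
  assumes Q: "\<And>q. q \<in> Q \<Longrightarrow> q \<in> forms {..n} e"
    and no_zero: "\<And>a. proj_point n a \<Longrightarrow> \<exists>q\<in>Q. eval a q \<noteq> 0" and i: "i \<le> n"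
  shows "\<exists>D. Var i ^ D \<in> gen_ideal Q"
proof -
  let ?I = "gen_ideal Q"
  note I = gen_ideal_is_ideal[of Q]
  let ?J = "{f + h * (Var i - 1) | f h. f \<in> ?I}"
  have J: "is_ideal ?J" by (rule ideal_extend[OF I])
  have "1 \<in> ?J"
  proof (rule ccontr)
    assume "1 \<notin> ?J"
    then obtain I' c where I': "is_ideal I'" "?J \<subseteq> I'" "1 \<notin> I'" "\<forall>j\<in>{..n}. Var j - const (c j) \<in> I'"
      using ideal_extend_point[OF finite_atMost[of n] J] by blast
    have IJ: "?I \<subseteq> ?J" by (auto intro!: exI[of _ 0] exI)
    have "eval c q = 0" if "q \<in> Q" for q
    proof (rule ccontr)
      assume nz: "eval c q \<noteq> 0"
      have "q \<in> I'" using gen_ideal_superset[OF that] IJ I'(2) by blast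
      then have "q - (q - const (eval c q)) \<in> I'"
        by (intro ideal_diff[OF I'(1)] form_congruent_eval[OF I'(1,4) Q[OF that]])
      then show False using ideal_const_imp_one[OF I'(1) _ nz] I'(3) by simp
    qed
    moreover have "c i = 1"
    proof (rule ccontr)
      assume "c i \<noteq> 1"
      have "Var i - 1 \<in> ?J"
        using I by (intro CollectI exI[of _ 0] exI[of _ 1]) (simp add: is_ideal_def)
      then have "Var i - 1 \<in> I'" using I'(2) by blast
      moreover have "Var i - const (c i) \<in> I'" using I'(4) i by blast
      ultimately have "(Var i - 1) - (Var i - const (c i)) \<in> I'" by (rule ideal_diff[OF I'(1)])
      then have "const (c i - 1) \<in> I'" by (simp add: const_diff)
      then show False using ideal_const_imp_one[OF I'(1)] I'(3) \<open>c i \<noteq> 1\<close> by force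
    qed
    ultimately show False using no_zero[of c] i by (force simp: proj_point_def)
  qed
  then obtain f h where fh: "1 = f + h * (Var i - 1)" "f \<in> ?I" by blast
  have fh': "h = f + Var i * h - 1" using fh(1) by (simp add: algebra_simps)
  have rec: "hom_part k h + Var i ^ k \<in> ?I" for k
  proof (induction k)
    case 0
    have "hom_part 0 h = hom_part 0 f - 1"
      by (subst fh') (simp add: hom_part_add hom_part_diff hom_part_Var_mult hom_part_one)
    then show ?case using gen_ideal_hom_part[OF Q fh(2)] by simp
  next
    case (Suc k)
    have "hom_part (Suc k) h = hom_part (Suc k) f + Var i * hom_part k h"
      by (subst fh') (simp add: hom_part_add hom_part_diff hom_part_Var_mult hom_part_one)
    then have "hom_part (Suc k) h + Var i ^ Suc k = hom_part (Suc k) f + Var i * (hom_part k h + Var i ^ k)"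
      by (simp add: algebra_simps)
    also have "\<dots> \<in> ?I"
      by (intro ideal_add[OF I] ideal_mult[OF I] Suc gen_ideal_hom_part[OF Q fh(2)])
    finally show ?case .
  qed
  obtain k where "hom_part k h = 0" using hom_part_eventually_0 by blast
  then show ?thesis using rec[of k] by auto
qed

text \<open>
  Stated dually: \<open>l\<close> is a linear functional on the forms of degree \<open>k + e\<close> that vanishes on the
  degree \<open>k + e\<close> part of the ideal generated by \<open>Q\<close>.
\<close>

lemma projective_nullstellensatz:
  fixes Q :: "nat mpoly set"
  assumes Q: "\<And>q. q \<in> Q \<Longrightarrow> q \<in> forms {..n} e"
    and no_zero: "\<And>a. proj_point n a \<Longrightarrow> \<exists>q\<in>Q. eval a q \<noteq> 0"
  shows "\<exists>k. \<forall>l. (\<forall>\<beta>\<in>monomials {..n} k. \<forall>q\<in>Q.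
      (\<Sum>m\<in>keys q. lookup q m * l (\<beta> + m)) = 0) \<longrightarrow>
    (\<forall>\<mu>\<in>monomials {..n} (k + e). l \<mu> = 0)"
proof -
  let ?I = "gen_ideal Q"
  note I = gen_ideal_is_ideal[of Q]
  have "\<forall>i\<le>n. \<exists>D. Var i ^ D \<in> ?I" using Var_power_in_gen_ideal[OF assms] by blast
  then obtain D0 where D0: "\<forall>i\<le>n. Var i ^ D0 i \<in> ?I" by metis
  define D where "D = (\<Sum>i\<le>n. D0 i)"
  have D: "Var i ^ D \<in> ?I" if "i \<le> n" for i
  proof -
    have "D0 i \<le> D" unfolding D_def using that by (intro member_le_sum) auto
    then have "Var i ^ D = Var i ^ (D - D0 i) * Var i ^ D0 i" by (simp flip: power_add)
    then show ?thesis using ideal_mult[OF I] D0 that by simp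
  qed
  \<comment> \<open>By the pigeonhole principle a monomial of at least this degree contains some x_i
    with exponent at least \<open>D\<close>.\<close>
  define k where "k = Suc n * D"
  have mon: "single \<mu> 1 \<in> ?I" if \<mu>: "\<mu> \<in> monomials {..n} (k + e)" for \<mu>
  proof -
    have "\<exists>i\<le>n. D \<le> lookup \<mu> i"
    proof (rule ccontr)
      assume "\<not> ?thesis"
      then have lt: "lookup \<mu> i < D" if "i \<le> n" for i using that by (meson not_le)
      have "deg \<mu> = (\<Sum>i\<le>n. lookup \<mu> i)"
        using \<mu> by (intro deg_superset) (auto simp: monomials_iff)
      also have "\<dots> < (\<Sum>i\<le>n. D)" by (rule sum_strict_mono) (use lt in auto)
      finally show False using \<mu> by (simp add: monomials_iff k_def)
    qed
    then obtain i where i: "i \<le> n" "D \<le> lookup \<mu> i" by blast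
    have "\<mu> = (\<mu> - single i D) + single i D"
      using i(2) by (intro poly_mapping_eqI) (auto simp: lookup_add lookup_minus lookup_single when_def)
    then have "single \<mu> (1::complex) = single (\<mu> - single i D) 1 * Var i ^ D"
      by (simp add: Var_power mult_single)
    then show ?thesis using ideal_mult[OF I D[OF i(1)]] by simp
  qed
  have "l \<mu> = 0"
    if l: "\<forall>\<beta>\<in>monomials {..n} k. \<forall>q\<in>Q. (\<Sum>m\<in>keys q. lookup q m * l (\<beta> + m)) = 0"
      and \<mu>: "\<mu> \<in> monomials {..n} (k + e)" for l :: "(nat \<Rightarrow>\<^sub>0 nat) \<Rightarrow> complex" and \<mu>
  proof -
    define J where "J = monomials {..n} (k + e)"
    have fJ: "finite J" by (simp add: J_def finite_monomials)
    \<comment> \<open>The linear extension of \<open>l\<close>, blind to monomials outside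
      \<open>J\<close>; multiples of generators that fall outside \<open>J\<close> are therefore
      annihilated automatically.\<close>
    define L where "L f = (\<Sum>\<mu>\<in>J. lookup f \<mu> * l \<mu>)" for f
    have Ladd: "L (f + g) = L f + L g" for f g
      by (simp add: L_def lookup_add distrib_right sum.distrib)
    have Lscale: "L (scale c f) = c * L f" for c f
      by (simp add: L_def sum_distrib_left mult.assoc)
    have Lsum: "L (sum h S) = (\<Sum>i\<in>S. L (h i))" for h :: "(nat \<Rightarrow>\<^sub>0 nat) \<Rightarrow> nat mpoly" and S
      by (induction S rule: infinite_finite_induct) (simp_all add: Ladd, simp_all add: L_def)
    have Lsingle: "L (single m c) = (if m \<in> J then c * l m else 0)" for m c
    proof -
      have "L (single m c) = (\<Sum>\<mu>\<in>J. if \<mu> = m then c * l m else 0)"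
        unfolding L_def by (intro sum.cong refl) (auto simp: lookup_single when_def)
      then show ?thesis using fJ by simp
    qed
    have gen: "L (single \<beta> 1 * q) = 0" if q: "q \<in> Q" for \<beta> q
    proof -
      have ex: "single \<beta> 1 * q =
        (\<Sum>m\<in>keys q. single (\<beta> + m) (lookup q m))"
      proof -
        have "single \<beta> 1 * q = single \<beta> 1 *
          (\<Sum>m\<in>keys q. single m (lookup q m))"
          by (simp flip: poly_mapping_eq_sum_single)
        then show ?thesis by (simp add: sum_distrib_left mult_single)
      qed
      have mq: "m \<in> monomials {..n} e" if "m \<in> keys q" for m
        using Q[OF q] that by (auto simp: forms_def)
      show ?thesis
      proof (cases "\<beta> \<in> monomials {..n} k")
        case True
        then have "\<beta> + m \<in> J" if "m \<in> keys q" for m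
          unfolding J_def using mq[OF that] by (rule monomials_add)
        then show ?thesis using l True q by (simp add: ex Lsum Lsingle)
      next
        case False
        then have "\<beta> + m \<notin> J" if "m \<in> keys q" for m
          using mq[OF that] by (auto simp: J_def monomials_iff keys_add_nat deg_add)
        then show ?thesis by (simp add: ex Lsum Lsingle)
      qed
    qed
    have "L f = 0" if "f \<in> ?I" for f
      using that unfolding gen_ideal_def
    proof (induction rule: mpoly.span_induct_alt)
      case base
      then show ?case by (simp add: L_def)
    next
      case (step c x y)
      then show ?case using gen by (auto simp: Ladd Lscale)
    qed
    from this[OF mon[OF \<mu>]] show "l \<mu> = 0" using \<mu> by (simp add: Lsingle J_def)
  qed
  then show ?thesis by blast
qed

section \<open>Equations of the exceptional locus\<close>

text \<open>A linear form in indeterminate coefficients; at the coefficients of g its value is the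
  coefficient of \<open>m\<close> in the (i, j) entry of the Hessian of g.\<close>

definition hess :: "nat \<Rightarrow> nat \<Rightarrow> (nat \<Rightarrow>\<^sub>0 nat) \<Rightarrow> (nat \<Rightarrow>\<^sub>0 nat) mpoly" where
  "hess i j m = scale (of_nat (lookup m i + 1) *
      of_nat (lookup (m + single i 1) j + 1))
    (Var (m + single i 1 + single j 1))"

lemma eval_hess: "eval (lookup g) (hess i j m) = lookup (partial i (partial j g)) m"
  unfolding hess_def eval.insertion_scale eval.insertion_Var lookup_partial by (simp only: mult.assoc)

lemma monomials_add_two:
  assumes "m \<in> monomials {..n} k" "i \<le> n" "j \<le> n"
  shows "m + single i 1 + single j 1 \<in> monomials {..n} (k + 2)"
proof -
  have "m + single i 1 + single j 1 \<in> monomials {..n} (k + 1 + 1)"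
    using assms by (intro monomials_add single_in_monomials) auto
  then show ?thesis by simp
qed

lemma hess_in_forms:
  assumes "m \<in> monomials {..n} (d - 2)" "i \<le> n" "j \<le> n" "d \<ge> 2"
  shows "hess i j m \<in> forms (monomials {..n} d) 1"
proof -
  have "m + single i 1 + single j 1 \<in> monomials {..n} d"
    using monomials_add_two[OF assms(1-3)] unfolding le_add_diff_inverse2[OF assms(4)] .
  then show ?thesis unfolding hess_def by (intro forms_scale forms_Var)
qed

lemma lookup_Dir_Dir:
  "lookup (Dir n a (Dir n a g)) m =
    (\<Sum>i\<le>n. \<Sum>j\<le>n. lookup (partial i (partial j g)) m * (a i * a j))"
  unfolding Dir_def
  by (simp add: lookup_sum partial_sum partial_scale sum_distrib_left mult_ac)

text \<open>Let q_m be the quadric whose value at a is the coefficient of \<open>m\<close> in D_a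
  D_a g. A solution of the k-th system is a functional on forms of degree k + 2 that annihilates all
  products of q_m with monomials of degree k. A common zero a provides evaluation at a; if there is
  none, the Nullstellensatz gives a k for which only the zero functional is left.\<close>

lemma isotropic_iff_solvable:
  assumes g: "g \<in> forms {..n} d"
  shows "(\<exists>a. proj_point n a \<and> Dir n a (Dir n a g) = 0) \<longleftrightarrow>
    (\<forall>k. solvable (monomials {..n} k \<times> monomials {..n} (d - 2)) (monomials {..n} (k + 2))
      (\<lambda>(\<beta>, m) \<mu>. \<Sum>i\<le>n. \<Sum>j\<le>n.
        if \<beta> + single i 1 + single j 1 = \<mu>
        then lookup (partial i (partial j g)) m else 0))"
    (is "_ \<longleftrightarrow> (\<forall>k. solvable (?Rows k) (?Cols k) ?M)")
proof -
  let ?e = "\<lambda>i::nat. single i (1::nat)"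
  let ?c = "\<lambda>m i j. lookup (partial i (partial j g)) m"
  have row: "(\<Sum>\<mu>\<in>monomials {..n} (k + 2). (\<Sum>i\<le>n. \<Sum>j\<le>n. if \<beta> + ?e i + ?e j = \<mu> then ?c m i j else 0) * l \<mu>)
      = (\<Sum>i\<le>n. \<Sum>j\<le>n. ?c m i j * l (\<beta> + ?e i + ?e j))" (is "?L = ?R")
    if \<beta>: "\<beta> \<in> monomials {..n} k" for k \<beta> m l
  proof -
    have "?L = (\<Sum>i\<le>n. \<Sum>j\<le>n. \<Sum>\<mu>\<in>monomials {..n} (k + 2). (if \<beta> + ?e i + ?e j = \<mu> then ?c m i j else 0) * l \<mu>)"
      unfolding sum_distrib_right
      by (subst sum.swap, intro sum.cong refl, rule sum.swap)
    also have "\<dots> = (\<Sum>i\<le>n. \<Sum>j\<le>n. \<Sum>\<mu>\<in>monomials {..n} (k + 2). if \<beta> + ?e i + ?e j = \<mu> then ?c m i j * l (\<beta> + ?e i + ?e j) else 0)"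
      by (intro sum.cong refl) auto
    also have "\<dots> = ?R"
    proof (intro sum.cong refl)
      fix i j assume "i \<in> {..n}" "j \<in> {..n}"
      then have "\<beta> + ?e i + ?e j \<in> monomials {..n} (k + 2)"
        using monomials_add_two[OF \<beta>, of i j] by simp
      then show "(\<Sum>\<mu>\<in>monomials {..n} (k + 2). if \<beta> + ?e i + ?e j = \<mu> then ?c m i j * l (\<beta> + ?e i + ?e j) else 0)
          = ?c m i j * l (\<beta> + ?e i + ?e j)"
        by (simp add: sum.delta' finite_monomials)
    qed
    finally show ?thesis .
  qed
  show ?thesis
  proof
    assume "\<exists>a. proj_point n a \<and> Dir n a (Dir n a g) = 0"
    then obtain a i0 where a: "Dir n a (Dir n a g) = 0" and i0: "i0 \<le> n" "a i0 \<noteq> 0"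
      by (auto simp: proj_point_def)
    show "\<forall>k. solvable (?Rows k) (?Cols k) ?M"
      unfolding solvable_def
    proof (intro allI exI[of _ "monom_eval a"] conjI ballI)
      fix k
      have "single i0 (k + 2) \<in> monomials {..n} (k + 2)"
        using i0 by (intro single_in_monomials) simp
      moreover have "monom_eval a (single i0 (k + 2)) \<noteq> 0"
        using i0 by (simp add: monom_eval_single del: add_2_eq_Suc')
      ultimately show "\<exists>\<mu>\<in>monomials {..n} (k + 2). monom_eval a \<mu> \<noteq> 0" by blast
    next
      fix k r assume r: "r \<in> ?Rows k"
      obtain \<beta> m where \<beta>: "r = (\<beta>, m)" "\<beta> \<in> monomials {..n} k" using r by auto
      have "(\<Sum>i\<le>n. \<Sum>j\<le>n. ?c m i j * monom_eval a (\<beta> + ?e i + ?e j)) =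
        monom_eval a \<beta> * lookup (Dir n a (Dir n a g)) m"
        unfolding lookup_Dir_Dir sum_distrib_left
        by (intro sum.cong refl) (simp add: monom_eval_add mult_ac)
      then show "(\<Sum>\<mu>\<in>monomials {..n} (k + 2). ?M r \<mu> * monom_eval a \<mu>) = 0"
        unfolding \<beta>(1) prod.case row[OF \<beta>(2)] a by simp
    qed
  next
    assume sol: "\<forall>k. solvable (?Rows k) (?Cols k) ?M"
    define q where "q m = (\<Sum>i\<le>n. \<Sum>j\<le>n. single (?e i + ?e j) (?c m i j))" for m
    have qf: "q m \<in> forms {..n} 2" for m
      unfolding q_def
    proof (intro forms_sum forms_single)
      fix i j assume "i \<in> {..n}" "j \<in> {..n}"
      then show "?e i + ?e j \<in> monomials {..n} 2"
        using monomials_add_two[of 0 n 0 i j] by (simp add: monomials_iff)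
    qed
    have evq: "eval a (q m) = lookup (Dir n a (Dir n a g)) m" for a m
      unfolding q_def lookup_Dir_Dir eval.insertion_sum
      by (intro sum.cong refl) (simp add: eval_eq_insertion eval.insertion_single[unfolded eval_eq_insertion] monom_eval_add)
    have lq: "(\<Sum>m'\<in>keys (q m). lookup (q m) m' * l (\<beta> + m')) =
      (\<Sum>i\<le>n. \<Sum>j\<le>n. ?c m i j * l (\<beta> + ?e i + ?e j))" for m \<beta> and l :: "(nat \<Rightarrow>\<^sub>0 nat) \<Rightarrow> complex"
    proof -
      let ?S = "monomials {..n} 2"
      have "(\<Sum>m'\<in>keys (q m). lookup (q m) m' * l (\<beta> + m')) =
        (\<Sum>m'\<in>?S. lookup (q m) m' * l (\<beta> + m'))"
        by (rule sum.mono_neutral_left)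
          (use qf[of m] in \<open>auto simp: finite_monomials forms_def in_keys_iff\<close>)
      also have "\<dots> = (\<Sum>m'\<in>?S. \<Sum>i\<le>n. \<Sum>j\<le>n. lookup (single (?e i + ?e j) (?c m i j)) m' * l (\<beta> + m'))"
        by (simp add: q_def lookup_sum sum_distrib_right)
      also have "\<dots> = (\<Sum>i\<le>n. \<Sum>j\<le>n. \<Sum>m'\<in>?S. lookup (single (?e i + ?e j) (?c m i j)) m' * l (\<beta> + m'))"
        by (subst sum.swap, intro sum.cong refl, rule sum.swap)
      also have "\<dots> = (\<Sum>i\<le>n. \<Sum>j\<le>n. ?c m i j * l (\<beta> + ?e i + ?e j))"
      proof (intro sum.cong refl)
        fix i j assume "i \<in> {..n}" "j \<in> {..n}"
        then have "?e i + ?e j \<in> ?S"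
          using monomials_add_two[of 0 n 0 i j] by (simp add: monomials_iff)
        moreover have "(\<Sum>m'\<in>?S. lookup (single (?e i + ?e j) (?c m i j)) m' * l (\<beta> + m'))
          = (\<Sum>m'\<in>?S. if ?e i + ?e j = m' then ?c m i j * l (\<beta> + (?e i + ?e j)) else 0)"
          by (intro sum.cong refl) (auto simp: lookup_single when_def)
        ultimately show "(\<Sum>m'\<in>?S. lookup (single (?e i + ?e j) (?c m i j)) m' * l (\<beta> + m'))
          = ?c m i j * l (\<beta> + ?e i + ?e j)"
          by (simp add: sum.delta' finite_monomials add.assoc)
      qed
      finally show ?thesis .
    qed
    let ?Q = "q ` monomials {..n} (d - 2)"
    show "\<exists>a. proj_point n a \<and> Dir n a (Dir n a g) = 0"
    proof (rule ccontr)
      assume no: "\<not> (\<exists>a. proj_point n a \<and> Dir n a (Dir n a g) = 0)"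
      have nz: "\<exists>p\<in>?Q. eval a p \<noteq> 0" if "proj_point n a" for a
      proof (rule ccontr)
        assume "\<not> (\<exists>p\<in>?Q. eval a p \<noteq> 0)"
        then have z: "lookup (Dir n a (Dir n a g)) m = 0" if "m \<in> monomials {..n} (d - 2)" for m
          using that evq by auto
        have "Dir n a (Dir n a g) \<in> forms {..n} (d - 1 - 1)" by (intro forms_Dir g)
        then have "Dir n a (Dir n a g) \<in> forms {..n} (d - 2)" by (simp add: numeral_2_eq_2)
        then have "Dir n a (Dir n a g) = 0"
          using z by (intro poly_mapping_eqI) (auto simp: forms_iff)
        then show False using no that by blast
      qed
      obtain k where k: "\<forall>l. (\<forall>\<beta>\<in>monomials {..n} k. \<forall>p\<in>?Q.
          (\<Sum>m\<in>keys p. lookup p m * l (\<beta> + m)) = 0) \<longrightarrow>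
        (\<forall>\<mu>\<in>monomials {..n} (k + 2). l \<mu> = 0)"
        using projective_nullstellensatz[of ?Q n 2] nz qf by blast
      obtain l \<mu> where l: "\<mu> \<in> monomials {..n} (k + 2)" "l \<mu> \<noteq> 0"
        "\<forall>r\<in>?Rows k. (\<Sum>\<mu>\<in>monomials {..n} (k + 2).
          ?M r \<mu> * l \<mu>) = 0"
        using sol[rule_format, of k] unfolding solvable_def by blast
      have "\<forall>\<beta>\<in>monomials {..n} k. \<forall>p\<in>?Q.
          (\<Sum>m\<in>keys p. lookup p m * l (\<beta> + m)) = 0"
      proof (intro ballI)
        fix \<beta> p assume \<beta>: "\<beta> \<in> monomials {..n} k" and "p \<in> ?Q"
        then obtain m where m: "p = q m" "m \<in> monomials {..n} (d - 2)" by blast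
        show "(\<Sum>m\<in>keys p. lookup p m * l (\<beta> + m)) = 0"
          unfolding m(1) lq using l(3)[rule_format, of "(\<beta>, m)"] \<beta> m(2)
          by (simp only: prod.case row[OF \<beta>] mem_Times_iff fst_conv snd_conv)
      qed
      with k l(1,2) show False by blast
    qed
  qed
qed

lemma self_adjoint_iff_coeffs:
  assumes g: "g \<in> forms {..n} d"
  shows "self_adjoint n A g \<longleftrightarrow> (\<forall>i\<le>n. \<forall>j\<le>n. \<forall>m\<in>monomials {..n} (d - 2).
    (\<Sum>k\<le>n. A i k * lookup (partial j (partial k g)) m) =
    (\<Sum>k\<le>n. A j k * lookup (partial i (partial k g)) m))"
proof -
  have l: "lookup (partial j (Dir n (A i) g)) m =
    (\<Sum>k\<le>n. A i k * lookup (partial j (partial k g)) m)" for i j m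
    by (simp add: Dir_def partial_sum partial_scale lookup_sum)
  have f: "partial j (Dir n (A i) g) \<in> forms {..n} (d - 2)" for i j
    using forms_partial[OF forms_Dir[OF g, of n "A i"], of j] by (simp add: numeral_2_eq_2)
  have z: "lookup F m = 0"
    if "F \<in> forms {..n} (d - 2)" "m \<notin> monomials {..n} (d - 2)" for F :: "nat mpoly" and m
    using that by (auto simp: forms_iff)
  have "partial j (Dir n (A i) g) = partial i (Dir n (A j) g) \<longleftrightarrow>
    (\<forall>m\<in>monomials {..n} (d - 2). lookup (partial j (Dir n (A i) g)) m =
      lookup (partial i (Dir n (A j) g)) m)" for i j
  proof
    assume eq: "\<forall>m\<in>monomials {..n} (d - 2). lookup (partial j (Dir n (A i) g)) m =
      lookup (partial i (Dir n (A j) g)) m"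
    show "partial j (Dir n (A i) g) = partial i (Dir n (A j) g)"
    proof (rule poly_mapping_eqI)
      fix m
      show "lookup (partial j (Dir n (A i) g)) m = lookup (partial i (Dir n (A j) g)) m"
        using eq f by (cases "m \<in> monomials {..n} (d - 2)") (simp_all add: z[OF f])
    qed
  qed simp
  then show ?thesis by (simp add: self_adjoint_def l)
qed

text \<open>The unknown (0, 0) is omitted because scalar matrices are always self-adjoint:
  subtracting one achieves \<open>A 0 0 = 0\<close>, and then being nonscalar means having another
  nonzero entry.\<close>

lemma self_adjoint_iff_solvable:
  assumes g: "g \<in> forms {..n} d"
  shows "(\<exists>A. self_adjoint n A g \<and> \<not> scalar_matrix n A) \<longleftrightarrow>
    solvable ({..n} \<times> {..n} \<times> monomials {..n} (d - 2)) ({..n} \<times> {..n} - {(0, 0)})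
      (\<lambda>(i, j, m) (p, k). (if p = i then lookup (partial j (partial k g)) m else 0) -
        (if p = j then lookup (partial i (partial k g)) m else 0))"
    (is "_ \<longleftrightarrow> solvable ?R ?J ?M")
proof -
  let ?c = "\<lambda>m i j. lookup (partial i (partial j g)) m"
  have row: "(\<Sum>s\<in>?J. ?M (i, j, m) s * x s) = (\<Sum>k\<le>n. x (i, k) * ?c m j k) - (\<Sum>k\<le>n. x (j, k) * ?c m i k)"
    if "i \<le> n" "j \<le> n" "x (0, 0) = 0" for i j m and x :: "nat \<times> nat \<Rightarrow> complex"
  proof -
    have "(\<Sum>s\<in>?J. ?M (i, j, m) s * x s) = (\<Sum>s\<in>{..n} \<times> {..n}. ?M (i, j, m) s * x s)"
      by (rule sum.mono_neutral_left) (use that(3) in auto)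
    also have "\<dots> = (\<Sum>p\<le>n. \<Sum>k\<le>n. (if p = i then x (i, k) * ?c m j k else 0) - (if p = j then x (j, k) * ?c m i k else 0))"
      unfolding sum.cartesian_product' by (intro sum.cong refl) (auto simp: algebra_simps)
    also have "\<dots> = (\<Sum>p\<le>n. (if p = i then \<Sum>k\<le>n. x (i, k) * ?c m j k else 0) - (if p = j then \<Sum>k\<le>n. x (j, k) * ?c m i k else 0))"
      by (intro sum.cong refl) (auto simp: sum_subtractf sum_negf)
    also have "\<dots> = (\<Sum>k\<le>n. x (i, k) * ?c m j k) - (\<Sum>k\<le>n. x (j, k) * ?c m i k)"
      using that by (simp add: sum_subtractf)
    finally show ?thesis .
  qed
  show ?thesis
  proof
    assume "\<exists>A. self_adjoint n A g \<and> \<not> scalar_matrix n A"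
    then obtain A where A: "self_adjoint n A g" "\<not> scalar_matrix n A" by blast
    define A' where "A' i j = A i j - (if i = j then A 0 0 else 0)" for i j
    have sa: "self_adjoint n A' g"
      unfolding A'_def[abs_def] by (rule self_adjoint_shift[OF A(1)])
    have "\<exists>i\<le>n. \<exists>j\<le>n. A i j \<noteq> (if i = j then A 0 0 else 0)"
      using A(2) unfolding scalar_matrix_def by blast
    then obtain i j where "i \<le> n" "j \<le> n" "A i j \<noteq> (if i = j then A 0 0 else 0)"
      by blast
    then have ij: "i \<le> n" "j \<le> n" "A' i j \<noteq> 0"
      by (simp_all only: A'_def right_minus_eq not_False_eq_True)
    have "(i, j) \<noteq> (0, 0)" using ij(3) by (cases "i = 0"; cases "j = 0") (simp_all add: A'_def)
    show "solvable ?R ?J ?M"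
      unfolding solvable_def
    proof (intro exI[of _ "case_prod A'"] conjI ballI)
      show "\<exists>s\<in>?J. case_prod A' s \<noteq> 0"
        using ij \<open>(i, j) \<noteq> (0, 0)\<close> by (intro bexI[of _ "(i, j)"]) auto
    next
      fix r assume "r \<in> ?R"
      then obtain i j m where r: "r = (i, j, m)" "i \<le> n" "j \<le> n" "m \<in> monomials {..n} (d - 2)" by auto
      have "case_prod A' (0, 0) = 0" by (simp add: A'_def)
      from row[of i j "case_prod A'" m, OF r(2,3) this]
      show "(\<Sum>s\<in>?J. ?M r s * case_prod A' s) = 0"
        unfolding r(1) using sa r(2-4) by (simp add: self_adjoint_iff_coeffs[OF g])
    qed
  next
    assume "solvable ?R ?J ?M"
    then obtain x s where x: "s \<in> ?J" "x s \<noteq> 0" "\<forall>r\<in>?R. (\<Sum>s\<in>?J. ?M r s * x s) = 0"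
      unfolding solvable_def by blast
    \<comment> \<open>A solution says nothing about the omitted unknown, so its value is set to
      0.\<close>
    define x' where "x' = x((0, 0) := 0)"
    define A where "A i j = x' (i, j)" for i j
    have A00: "x' (0, 0) = 0" by (simp add: x'_def)
    have x': "(\<Sum>s\<in>?J. ?M r s * x' s) = 0" if "r \<in> ?R" for r
    proof -
      have "(\<Sum>s\<in>?J. ?M r s * x' s) = (\<Sum>s\<in>?J. ?M r s * x s)"
        by (intro sum.cong refl) (auto simp: x'_def)
      then show ?thesis using x(3) that by simp
    qed
    have "self_adjoint n A g"
      unfolding self_adjoint_iff_coeffs[OF g]
    proof (intro allI impI ballI)
      fix i j m assume ij: "i \<le> n" "j \<le> n" and m: "m \<in> monomials {..n} (d - 2)"
      have "(\<Sum>k\<le>n. x' (i, k) * ?c m j k) - (\<Sum>k\<le>n. x' (j, k) * ?c m i k) = 0"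
        unfolding row[of i j x' m, OF ij A00, symmetric] by (rule x') (use ij m in simp)
      then show "(\<Sum>k\<le>n. A i k * ?c m j k) = (\<Sum>k\<le>n. A j k * ?c m i k)"
        by (simp add: A_def)
    qed
    moreover have "\<not> scalar_matrix n A"
    proof
      assume "scalar_matrix n A"
      then obtain c where c: "\<And>i j. i \<le> n \<Longrightarrow> j \<le> n \<Longrightarrow> A i j = (if i = j then c else 0)"
        unfolding scalar_matrix_def by blast
      have "c = 0" using c[of 0 0] A00 by (simp add: A_def)
      obtain p k where s: "s = (p, k)" by (cases s)
      have pk: "p \<le> n" "k \<le> n" "(p, k) \<noteq> (0, 0)" using x(1) s by simp_all
      then have "x' s = x s" unfolding x'_def s by (intro fun_upd_other)
      then show False using c[OF pk(1,2)] x(2) \<open>c = 0\<close> s by (simp add: A_def split: if_splits)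
    qed
    ultimately show "\<exists>A. self_adjoint n A g \<and> \<not> scalar_matrix n A" by blast
  qed
qed

lemma exceptional_equations:
  assumes d: "d \<ge> 2"
  obtains \<Phi> where "\<forall>P\<in>\<Phi>. \<exists>k. P \<in> forms (monomials {..n} d) k"
    "\<forall>g\<in>forms {..n} d. (\<forall>P\<in>\<Phi>. eval (lookup g) P = 0) \<longleftrightarrow> exceptional n g"
proof -
  let ?X = "monomials {..n} d"
  let ?P1 = "\<lambda>(i, j, m) (p, k). (if p = i then hess j k m else 0) - (if p = j then hess i k m else 0)"
  let ?P2 = "\<lambda>(\<beta>, m) \<mu>. \<Sum>i\<le>n. \<Sum>j\<le>n.
        if \<beta> + single i 1 + single j 1 = \<mu> then hess i j m else 0"
  let ?S1 = "\<lambda>b. solvable ({..n} \<times> {..n} \<times> monomials {..n} (d - 2)) ({..n} \<times> {..n} - {(0, 0)})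
    (\<lambda>r j. eval b (?P1 r j))"
  let ?S2 = "\<lambda>k b. solvable (monomials {..n} k \<times> monomials {..n} (d - 2)) (monomials {..n} (k + 2))
    (\<lambda>r j. eval b (?P2 r j))"
  have fd: "f - g \<in> forms ?X 1" if "f \<in> forms ?X 1" "g \<in> forms ?X 1" for f g
    using forms_add[OF that(1) forms_uminus[OF that(2)]] by simp
  have hz: "(if b then hess i j m else 0) \<in> forms ?X 1"
    if "m \<in> monomials {..n} (d - 2)" "i \<le> n" "j \<le> n" for b i j m
    using hess_in_forms[OF that d] by (simp del: One_nat_def)
  obtain \<Phi>1 where \<Phi>1: "\<forall>F\<in>\<Phi>1. \<exists>k. F \<in> forms ?X k"
    "\<forall>b. (\<forall>F\<in>\<Phi>1. eval b F = 0) \<longleftrightarrow> ?S1 b"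
  proof (rule solvable_system_equations[of "{..n} \<times> {..n} - {(0, 0)}" "{..n} \<times> {..n} \<times> monomials {..n} (d - 2)" ?P1 ?X])
    show "?P1 r s \<in> forms ?X 1"
      if "r \<in> {..n} \<times> {..n} \<times> monomials {..n} (d - 2)" "s \<in> {..n} \<times> {..n} - {(0, 0)}" for r s
      using that d by (auto intro!: fd hz simp del: One_nat_def)
  qed auto
  have "\<exists>\<Phi>2. (\<forall>F\<in>\<Phi>2. \<exists>k. F \<in> forms ?X k) \<and> (\<forall>b. (\<forall>F\<in>\<Phi>2. eval b F = 0) \<longleftrightarrow> ?S2 k b)" for k
  proof (rule solvable_system_equations[of "monomials {..n} (k + 2)" "monomials {..n} k \<times> monomials {..n} (d - 2)" ?P2 ?X])
    show "?P2 r s \<in> forms ?X 1"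
      if "r \<in> monomials {..n} k \<times> monomials {..n} (d - 2)" "s \<in> monomials {..n} (k + 2)" for r s
      using that d by (auto intro!: forms_sum hess_in_forms simp del: One_nat_def)
  qed (auto simp: finite_monomials)
  then have "\<forall>k. \<exists>\<Phi>2. (\<forall>F\<in>\<Phi>2. \<exists>k. F \<in> forms ?X k) \<and> (\<forall>b. (\<forall>F\<in>\<Phi>2. eval b F = 0) \<longleftrightarrow> ?S2 k b)" ..
  from choice[OF this] obtain \<Phi>2 where \<Phi>2: "\<forall>k. (\<forall>F\<in>\<Phi>2 k. \<exists>k. F \<in> forms ?X k) \<and>
    (\<forall>b. (\<forall>F\<in>\<Phi>2 k. eval b F = 0) \<longleftrightarrow> ?S2 k b)" ..
  \<comment> \<open>All products vanish iff one of the two families vanishes. The second family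
    comprises the minors for every k, so its vanishing means solvability in all degrees.\<close>
  define \<Phi> where "\<Phi> = {F * G | F G k. F \<in> \<Phi>1 \<and> G \<in> \<Phi>2 k}"
  show thesis
  proof (rule that[of \<Phi>])
    show "\<forall>P\<in>\<Phi>. \<exists>k. P \<in> forms ?X k"
      unfolding \<Phi>_def using \<Phi>1(1) \<Phi>2 forms_mult by blast
    show "\<forall>g\<in>forms {..n} d. (\<forall>P\<in>\<Phi>. eval (lookup g) P = 0) \<longleftrightarrow> exceptional n g"
    proof
      fix g assume g: "g \<in> forms {..n} d"
      let ?b = "lookup g"
      have e0: "(\<forall>P\<in>\<Phi>. eval ?b P = 0) \<longleftrightarrow> (\<forall>F\<in>\<Phi>1. eval ?b F = 0) \<or> (\<forall>k. \<forall>G\<in>\<Phi>2 k. eval ?b G = 0)"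
      proof
        assume van: "\<forall>P\<in>\<Phi>. eval ?b P = 0"
        show "(\<forall>F\<in>\<Phi>1. eval ?b F = 0) \<or> (\<forall>k. \<forall>G\<in>\<Phi>2 k. eval ?b G = 0)"
        proof (rule disjCI)
          assume "\<not> (\<forall>k. \<forall>G\<in>\<Phi>2 k. eval ?b G = 0)"
          then obtain k G where G: "G \<in> \<Phi>2 k" "eval ?b G \<noteq> 0" by blast
          show "\<forall>F\<in>\<Phi>1. eval ?b F = 0"
          proof
            fix F assume "F \<in> \<Phi>1"
            then have "F * G \<in> \<Phi>" unfolding \<Phi>_def using G(1) by blast
            then have "eval ?b (F * G) = 0" using van by blast
            then show "eval ?b F = 0" using G(2) by (simp add: eval.insertion_mult)
          qed
        qed
      qed (auto simp: \<Phi>_def eval.insertion_mult)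
      have e1: "(\<lambda>r j. eval ?b (?P1 r j)) =
        (\<lambda>(i, j, m) (p, k). (if p = i then lookup (partial j (partial k g)) m else 0) -
          (if p = j then lookup (partial i (partial k g)) m else 0))"
        by (auto simp: fun_eq_iff eval.insertion_diff eval_hess eval.insertion_zero)
      have e2: "(\<lambda>r j. eval ?b (?P2 r j)) = (\<lambda>(\<beta>, m) \<mu>. \<Sum>i\<le>n. \<Sum>j\<le>n.
        if \<beta> + single i 1 + single j 1 = \<mu>
        then lookup (partial i (partial j g)) m else 0)"
        by (auto simp: fun_eq_iff eval.insertion_sum eval_hess eval.insertion_zero intro!: sum.cong)
      have s1: "(\<forall>F\<in>\<Phi>1. eval ?b F = 0) \<longleftrightarrow> ?S1 ?b"
        using \<Phi>1(2) by (rule spec)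
      have s2: "(\<forall>F\<in>\<Phi>2 k. eval ?b F = 0) \<longleftrightarrow> ?S2 k ?b" for k
        by (rule \<Phi>2[THEN spec, THEN conjunct2, THEN spec])
      show "(\<forall>P\<in>\<Phi>. eval ?b P = 0) \<longleftrightarrow> exceptional n g"
        unfolding exceptional_def self_adjoint_iff_solvable[OF g] isotropic_iff_solvable[OF g]
          e0 s1 s2 e1 e2 by (rule refl)
    qed
  qed
qed

section \<open>A form outside the exceptional locus\<close>

text \<open>Without x_0^d the first unit vector would be isotropic, since the remaining terms have
  degree at most 1 in x_0.\<close>

definition chain_form :: "nat \<Rightarrow> nat \<Rightarrow> nat mpoly" where
  "chain_form n d = Var 0 ^ d + (\<Sum>j<n. Var j * Var (Suc j) ^ (d - 1))"

lemma chain_form_in_forms: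
  assumes "d \<ge> 1"
  shows "chain_form n d \<in> forms {..n} d"
proof -
  have "Var 0 ^ d \<in> forms {..n} (d * 1)" by (intro forms_power forms_Var) simp
  moreover have "Var j * Var (Suc j) ^ (d - 1) \<in> forms {..n} (1 + (d - 1) * 1)" if "j < n" for j
    using that by (intro forms_mult forms_power forms_Var) auto
  ultimately show ?thesis
    unfolding chain_form_def using assms by (intro forms_add forms_sum) auto
qed

lemma chain_form_nonzero:
  assumes "d \<ge> 2"
  shows "chain_form n d \<noteq> 0"
proof -
  have "eval (\<lambda>i. if i = 0 then 1 else 0) (chain_form n d) = 1"
    using assms by (simp add: chain_form_def eval.insertion_add eval.insertion_sum eval.insertion_mult
        eval.insertion_power power_0_left)
  then show ?thesis by (auto simp: eval.insertion_zero)
qed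

lemma Dir_Var: "i \<le> n \<Longrightarrow> Dir n u (Var i) = const (u i)"
  by (simp add: Dir_def partial_Var scale_def if_distrib cong: if_cong)

lemma Dir_const [simp]: "Dir n u (const c) = 0"
  by (simp add: Dir_def)

lemma Dir_Var_power:
  assumes "i \<le> n"
  shows "Dir n u (Var i ^ k) = const (of_nat k * u i) * Var i ^ (k - 1)"
proof (induction k)
  case 0
  then show ?case using Dir_const[of n u 1] by simp
next
  case (Suc k)
  have "Var i * (const (of_nat k * u i) * Var i ^ (k - 1)) = const (of_nat k * u i) * Var i ^ k"
    by (cases k) (simp_all add: mult_ac)
  then have "Dir n u (Var i ^ Suc k) = (const (u i) + const (of_nat k * u i)) * Var i ^ k"
    by (simp add: Dir_mult Dir_Var[OF assms] Suc distrib_right)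
  also have "const (u i) + const (of_nat k * u i) = const (of_nat (Suc k) * u i)"
    by (simp add: distrib_right const_add)
  finally show ?case by simp
qed

text \<open>\<open>chain_diag\<close> and \<open>chain_next\<close> are the coefficients of
  x_m^(d-2) and of x_j x_(j+1)^(d-3) in D_u D_v applied to the chain form. For d = 3 these monomials
  coincide when m = j.\<close>

definition chain_diag :: "nat \<Rightarrow> (nat \<Rightarrow> complex) \<Rightarrow> (nat \<Rightarrow> complex) \<Rightarrow> nat \<Rightarrow> complex" where
  "chain_diag d u v m = (case m of 0 \<Rightarrow> of_nat d * of_nat (d - 1) * (u 0 * v 0)
    | Suc j \<Rightarrow> of_nat (d - 1) * (u j * v (Suc j) + u (Suc j) * v j))"

definition chain_next :: "nat \<Rightarrow> (nat \<Rightarrow> complex) \<Rightarrow> (nat \<Rightarrow> complex) \<Rightarrow> nat \<Rightarrow> complex" where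
  "chain_next d u v j = of_nat (d - 1) * of_nat (d - 2) * (u (Suc j) * v (Suc j))"

lemma eval_Dir_Dir_chain_form:
  assumes "d \<ge> 2"
  shows "eval x (Dir n u (Dir n v (chain_form n d))) =
    (\<Sum>m\<le>n. x m ^ (d - 2) * chain_diag d u v m) +
    (\<Sum>j<n. x j * x (Suc j) ^ (d - 3) * chain_next d u v j)"
proof -
  define e where "e = d - 2"
  have d: "d = Suc (Suc e)" using assms by (simp add: e_def)
  have 0: "eval x (Dir n u (Dir n v (Var 0 ^ d))) = x 0 ^ (d - 2) * chain_diag d u v 0"
  proof -
    have "Dir n u (Dir n v (Var 0 ^ Suc (Suc e))) =
      const (of_nat (Suc (Suc e)) * v 0) * (const (of_nat (Suc e) * u 0) * Var 0 ^ e)"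
      unfolding Dir_Var_power[OF le0] Dir_mult Dir_const diff_Suc_1 mult_zero_left add_0_left ..
    then show ?thesis
      unfolding d by (simp add: chain_diag_def eval.insertion_mult eval.insertion_power del: power_Suc)
  qed
  have S: "eval x (Dir n u (Dir n v (Var j * Var (Suc j) ^ (d - 1)))) =
    x (Suc j) ^ (d - 2) * chain_diag d u v (Suc j) + x j * x (Suc j) ^ (d - 3) * chain_next d u v j"
    if "j < n" for j
  proof -
    have j: "j \<le> n" "Suc j \<le> n" using that by simp_all
    have "Dir n u (Dir n v (Var j * Var (Suc j) ^ Suc e)) =
      const (v j) * (const (of_nat (Suc e) * u (Suc j)) * Var (Suc j) ^ e) +
      (const (u j) * (const (of_nat (Suc e) * v (Suc j)) * Var (Suc j) ^ e) +
       Var j * (const (of_nat (Suc e) * v (Suc j)) * (const (of_nat e * u (Suc j)) * Var (Suc j) ^ (e - 1))))"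
      unfolding Dir_mult Dir_add Dir_Var[OF j(1)] Dir_Var_power[OF j(2)] Dir_const diff_Suc_1
        mult_zero_left add_0_left ..
    then show ?thesis
      unfolding d
      by (simp add: chain_diag_def chain_next_def eval.insertion_mult eval.insertion_add
          eval.insertion_power numeral_3_eq_3 del: power_Suc)
        (simp add: algebra_simps)
  qed
  have "eval x (Dir n u (Dir n v (chain_form n d))) = x 0 ^ (d - 2) * chain_diag d u v 0 +
    (\<Sum>j<n. x (Suc j) ^ (d - 2) * chain_diag d u v (Suc j) + x j * x (Suc j) ^ (d - 3) * chain_next d u v j)"
    unfolding chain_form_def Dir_add Dir_sum eval.insertion_add eval.insertion_sum 0
    by (intro arg_cong2[where f = "(+)"] sum.cong refl S) simp
  then show ?thesis
    by (simp add: sum.distrib sum.atMost_shift add.assoc)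
qed

text \<open>Unit vectors isolate the \<alpha>; sums of two neighbouring ones then isolate the
  \<gamma>. For d >= 4 the factor x_(j+1)^(d-3) vanishes with x_(j+1), and for n = 0 there are no
  \<gamma>.\<close>

lemma chain_coeffs_high_degree:
  fixes \<alpha> \<gamma> :: "nat \<Rightarrow> complex"
  assumes z: "\<And>x. (\<Sum>m\<le>n. x m ^ (d - 2) * \<alpha> m) + (\<Sum>j<n. x j * x (Suc j) ^ (d - 3) * \<gamma> j) = 0"
    and d: "d \<ge> 4 \<or> n = 0 \<and> d \<ge> 3"
  shows "m \<le> n \<Longrightarrow> \<alpha> m = 0" and "j < n \<Longrightarrow> \<gamma> j = 0"
proof -
  show \<alpha>: "\<alpha> m = 0" if "m \<le> n" for m
  proof -
    let ?x = "\<lambda>i. if i = m then 1 else 0 :: complex"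
    have "(\<Sum>i\<le>n. ?x i ^ (d - 2) * \<alpha> i) = (\<Sum>i\<le>n. if i = m then \<alpha> m else 0)"
      using d by (intro sum.cong refl) auto
    moreover have "(\<Sum>j<n. ?x j * ?x (Suc j) ^ (d - 3) * \<gamma> j) = 0"
      using d by (intro sum.neutral) auto
    ultimately show ?thesis using z[of ?x] that by simp
  qed
  show "\<gamma> j = 0" if j: "j < n"
  proof -
    let ?x = "\<lambda>i. if i = j \<or> i = Suc j then 1 else 0 :: complex"
    have "(\<Sum>i<n. ?x i * ?x (Suc i) ^ (d - 3) * \<gamma> i) = (\<Sum>i<n. if i = j then \<gamma> j else 0)"
      using d j by (intro sum.cong refl) auto
    then show ?thesis using z[of ?x] \<alpha> j by simp
  qed
qed

text \<open>Here x_m carries both \<alpha>_m and \<gamma>_m, so only their sum can be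
  recovered.\<close>

lemma chain_coeffs_cubic:
  fixes \<alpha> \<gamma> :: "nat \<Rightarrow> complex"
  assumes z: "\<And>x. (\<Sum>m\<le>n. x m * \<alpha> m) + (\<Sum>j<n. x j * \<gamma> j) = 0" and m: "m \<le> n"
  shows "\<alpha> m + (if m < n then \<gamma> m else 0) = 0"
proof -
  let ?x = "\<lambda>i. if i = m then 1 else 0 :: complex"
  have "(\<Sum>i\<le>n. ?x i * \<alpha> i) = \<alpha> m"
    using m by (simp add: if_distrib[where f = "\<lambda>x. x * _"] cong: if_cong)
  moreover have "(\<Sum>i<n. ?x i * \<gamma> i) = (if m < n then \<gamma> m else 0)"
    by (simp add: if_distrib[where f = "\<lambda>x. x * _"] cong: if_cong)
  ultimately show ?thesis using z[of ?x] by simp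
qed

text \<open>For d >= 4 or n = 0 each a_k^2 is read off from a single coefficient. For d = 3 and n >=
  2 the vanishing expressions are 3 a_0^2 + a_1^2, 2 a_m a_(m+1) + a_(m+2)^2 and a_(n-1) a_n. The
  last one forces a zero entry, which is carried down to a_0 and from there up to all
  entries.\<close>

lemma chain_form_isotropic_eq_0:
  assumes d: "d \<ge> 3" "(n, d) \<noteq> (1, 3)" and a: "Dir n a (Dir n a (chain_form n d)) = 0" and k: "k \<le> n"
  shows "a k = 0"
proof -
  have z: "(\<Sum>m\<le>n. x m ^ (d - 2) * chain_diag d a a m) +
    (\<Sum>j<n. x j * x (Suc j) ^ (d - 3) * chain_next d a a j) = 0" for x
    using eval_Dir_Dir_chain_form[of d x n a a] a d by (simp add: eval.insertion_zero)
  show ?thesis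
  proof (cases "d \<ge> 4 \<or> n = 0")
    case True
    then have d': "d \<ge> 4 \<or> n = 0 \<and> d \<ge> 3" using d by simp
    show ?thesis
    proof (cases k)
      case 0
      have "chain_diag d a a 0 = 0" by (rule chain_coeffs_high_degree(1)[OF z d']) simp
      then show ?thesis using d 0 by (simp add: chain_diag_def)
    next
      case (Suc j)
      have "chain_next d a a j = 0"
        by (rule chain_coeffs_high_degree(2)[OF z d']) (use k Suc in simp)
      moreover have "complex_of_nat d \<noteq> 2" using d of_nat_eq_iff[of d 2, where 'a = complex] by auto
      ultimately show ?thesis using d Suc by (simp add: chain_next_def)
    qed
  next
    case False
    then have d3: "d = 3" and n: "n \<ge> 2" using d by (auto simp: not_le)
    have e: "chain_diag 3 a a m + (if m < n then chain_next 3 a a m else 0) = 0" if "m \<le> n" for m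
      by (rule chain_coeffs_cubic[OF _ that]) (use z in \<open>simp add: d3\<close>)
    have "2 * (3 * (a 0)\<^sup>2 + (a 1)\<^sup>2) = 0"
      using e[of 0] n by (simp add: chain_diag_def chain_next_def power2_eq_square algebra_simps)
    then have e0: "3 * (a 0)\<^sup>2 + (a 1)\<^sup>2 = 0" by (simp only: mult_eq_0_iff) simp
    have em: "2 * a m * a (Suc m) + (a (Suc (Suc m)))\<^sup>2 = 0" if "Suc m < n" for m
    proof -
      have "2 * (2 * a m * a (Suc m) + (a (Suc (Suc m)))\<^sup>2) = 0"
        using e[of "Suc m"] that by (simp add: chain_diag_def chain_next_def power2_eq_square algebra_simps)
      then show ?thesis by (simp only: mult_eq_0_iff) simp
    qed
    have en: "a (n - 1) * a n = 0"
      using e[of n] n by (cases n) (simp_all add: chain_diag_def algebra_simps)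
    have up: "a (Suc j) = 0" if "a j = 0" "j < n" for j
      using e0 em[of "j - 1"] that by (cases j) simp_all
    have down: "a i = 0 \<Longrightarrow> i \<le> n \<Longrightarrow> a 0 = 0" for i
    proof (induction i rule: less_induct)
      case (less i)
      consider "i = 0" | "i = 1" | j where "i = Suc (Suc j)" by (metis One_nat_def not0_implies_Suc)
      then show ?case
      proof cases
        case 2
        then show ?thesis using e0 less.prems by simp
      next
        case (3 j)
        then have "a j = 0 \<or> a (Suc j) = 0" using em[of j] less.prems by simp
        then show ?thesis using less.IH[of j] less.IH[of "Suc j"] less.prems 3 by auto
      qed (use less.prems in simp)
    qed
    have "a 0 = 0" using en down[of n] down[of "n - 1"] by auto
    then show ?thesis
      using k by (induction k) (auto intro: up)
  qed
qed

text \<open>Self-adjointness is tested on pairs of unit vectors e_p, e_q; comparing coefficients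
  kills the off-diagonal entries and identifies neighbouring diagonal ones.\<close>

lemma chain_form_self_adjoint_imp_scalar:
  assumes d: "d \<ge> 3" "(n, d) \<noteq> (1, 3)" and A: "self_adjoint n A (chain_form n d)"
  shows "scalar_matrix n A"
proof -
  define e where "e p i = (if i = p then 1 else 0 :: complex)" for p i :: nat
  have ve: "vecmul n A (e p) i = A p i" if "p \<le> n" "i \<le> n" for p i
    using that by (simp add: vecmul_def e_def if_distrib[where f = "\<lambda>x. x * _"] cong: if_cong)
  have cong: "Dir n (vecmul n A (e p)) f = Dir n (A p) f" if "p \<le> n" for p f
    using that by (intro Dir_cong) (simp add: ve)
  have sym: "Dir n (A p) (Dir n (e q) (chain_form n d)) = Dir n (e p) (Dir n (A q) (chain_form n d))"
    if "p \<le> n" "q \<le> n" for p q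
    using self_adjoint_Dir[OF A, of "e p" "e q"] that by (simp add: cong)
  have z: "(\<Sum>m\<le>n. x m ^ (d - 2) * (chain_diag d (A p) (e q) m - chain_diag d (e p) (A q) m)) +
    (\<Sum>j<n. x j * x (Suc j) ^ (d - 3) * (chain_next d (A p) (e q) j - chain_next d (e p) (A q) j)) = 0"
    if "p \<le> n" "q \<le> n" for p q x
    using arg_cong[OF sym[OF that], of "eval x"] d
    by (simp add: eval_Dir_Dir_chain_form right_diff_distrib sum_subtractf algebra_simps)
  have main: "A p p = A 0 0 \<and> (\<forall>q\<le>n. p \<noteq> q \<longrightarrow> A p q = 0)" if p: "p \<le> n" for p
  proof (cases "d \<ge> 4 \<or> n = 0")
    case True
    then have d': "d \<ge> 4 \<or> n = 0 \<and> d \<ge> 3" using d by simp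
    have D: "chain_diag d (A p) (e q) m = chain_diag d (e p) (A q) m" if "p \<le> n" "q \<le> n" "m \<le> n" for p q m
      using chain_coeffs_high_degree(1)[OF z[OF that(1,2)] d' that(3)] by simp
    have N: "chain_next d (A p) (e q) j = chain_next d (e p) (A q) j" if "p \<le> n" "q \<le> n" "j < n" for p q j
      using chain_coeffs_high_degree(2)[OF z[OF that(1,2)] d' that(3)] by simp
    have off: "A p q = 0" if "p \<le> n" "q \<le> n" "p \<noteq> q" for p q
    proof (cases q)
      case 0
      then show ?thesis using D[of p q 0] that d by (simp add: chain_diag_def e_def)
    next
      case (Suc j)
      moreover have "complex_of_nat d \<noteq> 2" using d of_nat_eq_iff[of d 2, where 'a = complex] by auto
      ultimately show ?thesis using N[of p q j] that d by (simp add: chain_next_def e_def)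
    qed
    have dg: "A j j = A 0 0" if "j \<le> n" for j
      using that
    proof (induction j)
      case (Suc j)
      then have "A j j = A (Suc j) (Suc j)"
        using D[of j "Suc j" "Suc j"] d by (simp add: chain_diag_def e_def)
      with Suc show ?case by simp
    qed simp
    show ?thesis using dg[OF p] off[OF p] by simp
  next
    case False
    then have d3: "d = 3" and n: "n \<ge> 2" using d by (auto simp: not_le)
    have E: "(chain_diag 3 (A p) (e q) m - chain_diag 3 (e p) (A q) m) +
      (if m < n then chain_next 3 (A p) (e q) m - chain_next 3 (e p) (A q) m else 0) = 0"
      if "p \<le> n" "q \<le> n" "m \<le> n" for p q m
      by (rule chain_coeffs_cubic[OF _ that(3)]) (use z[OF that(1,2)] in \<open>simp add: d3\<close>)
    have E0: "3 * (A p 0 * e q 0 - e p 0 * A q 0) + (A p 1 * e q 1 - e p 1 * A q 1) = 0"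
      if "p \<le> n" "q \<le> n" for p q
    proof -
      have "2 * (3 * (A p 0 * e q 0 - e p 0 * A q 0) + (A p 1 * e q 1 - e p 1 * A q 1)) = 0"
        using E[OF that, of 0] n by (simp add: chain_diag_def chain_next_def algebra_simps)
      then show ?thesis by (simp only: mult_eq_0_iff) simp
    qed
    have Em: "(A p m * e q (Suc m) + A p (Suc m) * e q m - e p m * A q (Suc m) - e p (Suc m) * A q m) +
        (if Suc m < n then A p (Suc (Suc m)) * e q (Suc (Suc m)) - e p (Suc (Suc m)) * A q (Suc (Suc m)) else 0) = 0"
      (is "?X = 0") if "p \<le> n" "q \<le> n" "Suc m \<le> n" for p q m
    proof -
      have "2 * ?X = 0"
        using E[OF that] by (cases "Suc m < n") (simp_all add: chain_diag_def chain_next_def algebra_simps)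
      then show ?thesis by (simp only: mult_eq_0_iff) simp
    qed
    \<comment> \<open>In each case the coefficient is chosen so that \<open>A p q\<close> is the
      only entry left in the equation.\<close>
    have low: "A p q = 0" if "q < p" "p \<le> n" "2 \<le> p" for p q
    proof -
      consider "q = 0" | "q = 1" | j where "q = Suc (Suc j)" by (metis One_nat_def not0_implies_Suc)
      then show ?thesis
      proof cases
        case 1
        then show ?thesis using E0[of p 0] that by (simp add: e_def cong: if_cong)
      next
        case 2
        then show ?thesis using E0[of p 1] that by (simp add: e_def cong: if_cong)
      next
        case (3 j)
        then show ?thesis using Em[of p q j] that by (simp add: e_def cong: if_cong)
      qed
    qed
    have up: "A p q = 0" if "p < q" "q < n" for p q
      using Em[of p "Suc q" q] that by (simp add: e_def cong: if_cong)
    define r where "r = n - 2"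
    have nr: "n = Suc (Suc r)" using n by (simp add: r_def)
    \<comment> \<open>In the last column p = n - 1 is special: the equation only relates
      \<open>A p n\<close> to the entry (n, n - 2), which is known to be 0 since n >= 2.\<close>
    have last: "A p n = 0" if "p < n" for p
    proof (cases "p = Suc r")
      case False
      then show ?thesis using Em[of p "Suc r" "Suc r"] that by (simp add: e_def nr)
    next
      case True
      then have "A p n = A n r"
        using Em[of p "Suc (Suc r)" r] by (simp add: e_def nr)
      then show ?thesis using low[of r n] by (simp add: nr)
    qed
    \<comment> \<open>The coefficient of x_0 gives 3 A_10 = A_01, and A_01 lies above the
      diagonal.\<close>
    have "A 1 0 = 0" using E0[of 0 1] up[of 0 1] last[of 0] n by (cases "n = 1") (simp_all add: e_def cong: if_cong)
    have off: "A p q = 0" if "p \<le> n" "q \<le> n" "p \<noteq> q" for p q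
    proof -
      have "p < q \<and> q < n \<or> p < q \<and> q = n \<or> q < p \<and> 2 \<le> p \<or> p = 1 \<and> q = 0"
        using that by arith
      then consider "p < q" "q < n" | "p < q" "q = n" | "q < p" "2 \<le> p" | "p = 1" "q = 0"
        by blast
      then show ?thesis
        using low[of q p] up[of p q] last[of p] \<open>A 1 0 = 0\<close> that by cases simp_all
    qed
    have dg: "A j j = A 0 0" if "j \<le> n" for j
      using that
    proof (induction j)
      case (Suc j)
      then have "A j j = A (Suc j) (Suc j)"
        using Em[of j "Suc j" j] by (simp add: e_def cong: if_cong)
      with Suc show ?case by simp
    qed simp
    show ?thesis using dg[OF p] off[OF p] by simp
  qed
  show ?thesis
    unfolding scalar_matrix_def
  proof (intro exI[of _ "A 0 0"] allI impI)
    fix i j assume "i \<le> n" "j \<le> n"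
    then show "A i j = (if i = j then A 0 0 else 0)"
      using main[of i] by (cases "i = j") simp_all
  qed
qed

lemma chain_form_not_exceptional:
  assumes "d \<ge> 3" "(n, d) \<noteq> (1, 3)"
  shows "\<not> exceptional n (chain_form n d)"
  using chain_form_isotropic_eq_0[OF assms] chain_form_self_adjoint_imp_scalar[OF assms]
  unfolding exceptional_def proj_point_def by blast

section \<open>The main theorem\<close>

lemma exceptional_scale: "exceptional n g \<Longrightarrow> exceptional n (scale c g)"
  unfolding exceptional_def self_adjoint_def by (auto simp: Dir_scale partial_scale)

lemma locus_G_eq:
  assumes "d \<ge> 3"
  shows "locus_G n d = proj_class ` {g \<in> forms {..n} d - {0}. exceptional n g}"
  unfolding locus_G_def using exceptional_iff[OF _ _ assms] by (intro arg_cong[where f = "image proj_class"]) auto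

lemma mem_proj_class: "g \<in> proj_class g"
  unfolding proj_class_def by (intro CollectI exI[of _ 1]) simp

lemma proj_class_eq:
  assumes "h \<in> proj_class g"
  shows "proj_class h = proj_class g"
proof -
  obtain c where c: "h = scale c g" "c \<noteq> 0" using assms by (auto simp: proj_class_def)
  show ?thesis
  proof (intro Set.set_eqI iffI)
    fix f assume "f \<in> proj_class h"
    then obtain b where "f = scale b h" "b \<noteq> 0" by (auto simp: proj_class_def)
    then show "f \<in> proj_class g"
      unfolding proj_class_def using c by (intro CollectI exI[of _ "b * c"]) simp
  next
    fix f assume "f \<in> proj_class g"
    then obtain b where "f = scale b g" "b \<noteq> 0" by (auto simp: proj_class_def)
    then show "f \<in> proj_class h"
      unfolding proj_class_def using c by (intro CollectI exI[of _ "b / c"]) simp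
  qed
qed

lemma locus_U_rep:
  assumes "d \<ge> 3" "\<gamma> \<in> locus_U n d" "g \<in> \<gamma>"
  shows "g \<in> forms {..n} d" "\<not> exceptional n g"
proof -
  obtain g0 where g0: "\<gamma> = proj_class g0" "g0 \<in> forms {..n} d" "g0 \<noteq> 0"
    using assms(2) by (auto simp: locus_U_def proj_forms_def)
  obtain c where c: "g = scale c g0" "c \<noteq> 0" using assms(3) g0 by (auto simp: proj_class_def)
  show g: "g \<in> forms {..n} d" unfolding c by (rule forms_scale[OF g0(2)])
  have "g \<noteq> 0" using c g0 by simp
  moreover have "proj_class g = \<gamma>" using proj_class_eq assms(3) g0(1) by blast
  ultimately show "\<not> exceptional n g"
    using assms(2) g unfolding locus_U_def locus_G_eq[OF assms(1)] by blast
qed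

lemma zariski_open_locus_U:
  assumes d: "d \<ge> 3"
  shows "zariski_open n d (locus_U n d)"
proof -
  have "d \<ge> 2" using d by simp
  then obtain \<Phi> where \<Phi>: "\<forall>P\<in>\<Phi>. \<exists>k. P \<in> forms (monomials {..n} d) k"
    "\<forall>g\<in>forms {..n} d. (\<forall>P\<in>\<Phi>. eval (lookup g) P = 0) \<longleftrightarrow> exceptional n g"
    by (rule exceptional_equations)
  have "locus_G n d \<subseteq> proj_forms n d"
    unfolding locus_G_def proj_forms_def by blast
  then have "proj_forms n d - locus_U n d = locus_G n d"
    unfolding locus_U_def by blast
  also have "\<dots> = {\<gamma> \<in> proj_forms n d. \<forall>g\<in>\<gamma>. \<forall>P\<in>\<Phi>. eval (lookup g) P = 0}"
  proof (intro Set.set_eqI iffI)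
    fix \<gamma> assume "\<gamma> \<in> locus_G n d"
    then obtain g where g: "\<gamma> = proj_class g" "g \<in> forms {..n} d" "g \<noteq> 0" "exceptional n g"
      unfolding locus_G_eq[OF d] by blast
    have "\<forall>P\<in>\<Phi>. eval (lookup h) P = 0" if "h \<in> \<gamma>" for h
    proof -
      obtain c where "h = scale c g" using \<open>h \<in> \<gamma>\<close> unfolding g(1) proj_class_def by blast
      then show ?thesis
        using \<Phi>(2) exceptional_scale[OF g(4), of c] forms_scale[OF g(2), of c] by blast
    qed
    then show "\<gamma> \<in> {\<gamma> \<in> proj_forms n d. \<forall>g\<in>\<gamma>. \<forall>P\<in>\<Phi>. eval (lookup g) P = 0}"
      using g unfolding proj_forms_def by blast
  next
    fix \<gamma> assume "\<gamma> \<in> {\<gamma> \<in> proj_forms n d. \<forall>g\<in>\<gamma>. \<forall>P\<in>\<Phi>. eval (lookup g) P = 0}"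
    then obtain g where g: "\<gamma> = proj_class g" "g \<in> forms {..n} d - {0}"
      and van: "\<forall>g\<in>\<gamma>. \<forall>P\<in>\<Phi>. eval (lookup g) P = 0"
      unfolding proj_forms_def by blast
    have "exceptional n g" using van \<Phi>(2) g mem_proj_class[of g] by blast
    then show "\<gamma> \<in> locus_G n d" unfolding locus_G_eq[OF d] using g by blast
  qed
  finally have eq: "proj_forms n d - locus_U n d =
    {\<gamma> \<in> proj_forms n d. \<forall>g\<in>\<gamma>. \<forall>P\<in>\<Phi>. eval (lookup g) P = 0}" .
  show ?thesis
    unfolding zariski_open_def zariski_closed_def
  proof (intro conjI exI[of _ \<Phi>])
    show "locus_U n d \<subseteq> proj_forms n d" by (auto simp: locus_U_def)
  qed (use \<Phi>(1) eq in auto)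
qed

lemma locus_U_nonempty:
  assumes "d \<ge> 3" "(n, d) \<noteq> (1, 3)"
  shows "locus_U n d \<noteq> {}"
proof -
  let ?g = "chain_form n d"
  have g: "?g \<in> forms {..n} d - {0}"
    using assms(1) chain_form_in_forms chain_form_nonzero by simp
  have "proj_class ?g \<notin> locus_G n d"
  proof
    assume "proj_class ?g \<in> locus_G n d"
    then obtain h where h: "proj_class ?g = proj_class h" "exceptional n h"
      unfolding locus_G_eq[OF assms(1)] by blast
    have "?g \<in> proj_class h" using h(1) mem_proj_class by blast
    then have "exceptional n ?g" using h(2) exceptional_scale by (auto simp: proj_class_def)
    then show False using chain_form_not_exceptional[OF assms] by simp
  qed
  then show ?thesis using g unfolding locus_U_def proj_forms_def by blast
qed

section \<open>Symmetric bases of the space of partial derivatives\<close>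

lemma jacobian_ordered_basis:
  assumes "\<not> exceptional n g"
  shows "ordered_basis n (\<lambda>i. partial i g) (jacobian_space n g)"
proof -
  let ?F = "\<lambda>i. partial i g"
  have indep: "c i = 0" if "(\<Sum>i\<le>n. scale (c i) (?F i)) = 0" "i \<le> n" for c i
  proof (rule ccontr)
    assume "c i \<noteq> 0"
    moreover have "Dir n c g = 0" using that(1) by (simp add: Dir_def)
    ultimately show False
      using assms that(2) unfolding exceptional_def proj_point_def by auto
  qed
  \<comment> \<open>Independence of the image as a set would still allow two partial derivatives to
    coincide; the relation with coefficients 1 at i and -1 at j excludes this.\<close>
  have inj: "inj_on ?F {..n}"
  proof (rule inj_onI, rule ccontr)
    fix i j assume ij: "i \<in> {..n}" "j \<in> {..n}" "partial i g = partial j g" "i \<noteq> j"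
    let ?c = "\<lambda>k. (if k = i then 1 else 0) - (if k = j then 1 else 0) :: complex"
    have "(\<Sum>k\<le>n. scale (?c k) (?F k)) = (\<Sum>k\<le>n. if k = i then ?F k else 0) - (\<Sum>k\<le>n. if k = j then ?F k else 0)"
      unfolding sum_subtractf[symmetric]
      by (intro sum.cong refl) (auto simp: mpoly.scale_left_diff_distrib)
    also have "\<dots> = 0" using ij by simp
    finally have "?c i = 0" by (rule indep) (use ij in simp)
    then show False using ij(4) by simp
  qed
  have "mpoly.independent (?F ` {..n})"
  proof (rule mpoly.independent_if_scalars_zero)
    fix c x assume s: "(\<Sum>x\<in>?F ` {..n}. scale (c x) x) = 0" and "x \<in> ?F ` {..n}"
    then obtain i where i: "x = ?F i" "i \<le> n" by blast
    show "c x = 0"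
      unfolding i(1) using s unfolding sum_scale_reindex[OF inj]
      by (rule indep[where c = "\<lambda>i. c (?F i)"]) (rule i(2))
  qed simp
  then show ?thesis using inj by (simp add: ordered_basis_def jacobian_space_def)
qed

text \<open>Each \<open>G i\<close> lies in the span of the partial derivatives, so G = A grad g for
  some matrix A. The symmetry makes A self-adjoint, hence scalar, and the scalar is nonzero because
  an independent set does not contain 0.\<close>

lemma jacobian_symmetric_basis_unique:
  assumes ne: "\<not> exceptional n g" and G: "ordered_basis n G (jacobian_space n g)"
    and sym: "\<forall>i j. i < j \<and> j \<le> n \<longrightarrow> partial j (G i) = partial i (G j)"
  shows "\<exists>c. c \<noteq> 0 \<and> (\<forall>i\<le>n. G i = scale c (partial i g))"
proof -
  let ?F = "\<lambda>i. partial i g"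
  have inj: "inj_on ?F {..n}" using jacobian_ordered_basis[OF ne] by (simp add: ordered_basis_def)
  have "\<exists>a. G i = Dir n a g" if "i \<le> n" for i
  proof -
    have "G i \<in> mpoly.span (G ` {..n})" using that by (intro mpoly.span_base) simp
    then have "G i \<in> mpoly.span (?F ` {..n})"
      using G by (simp add: ordered_basis_def jacobian_space_def)
    then obtain u where "G i = (\<Sum>v\<in>?F ` {..n}. scale (u v) v)"
      by (auto simp: mpoly.span_finite)
    then have "G i = Dir n (\<lambda>j. u (?F j)) g"
      by (simp add: sum_scale_reindex[OF inj] Dir_def)
    then show ?thesis by (rule exI[of _ "\<lambda>j. u (?F j)"])
  qed
  then have "\<forall>i. \<exists>a. i \<le> n \<longrightarrow> G i = Dir n a g" by blast
  from choice[OF this] obtain A where A: "\<forall>i. i \<le> n \<longrightarrow> G i = Dir n (A i) g" ..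
  have "partial j (G i) = partial i (G j)" if "i \<le> n" "j \<le> n" for i j
    using sym[rule_format, of i j] sym[rule_format, of j i] that
    by (cases i j rule: linorder_cases) simp_all
  then have "self_adjoint n A g" using A by (simp add: self_adjoint_def)
  then have "scalar_matrix n A" using ne by (auto simp: exceptional_def)
  then obtain c where c: "\<forall>i\<le>n. \<forall>j\<le>n. A i j = (if i = j then c else 0)"
    unfolding scalar_matrix_def ..
  have Gc: "G i = scale c (?F i)" if i: "i \<le> n" for i
  proof -
    have "G i = Dir n (\<lambda>j. c * (if j = i then 1 else 0)) g"
      using A c i by (auto intro!: Dir_cong)
    also have "\<dots> = scale c (Dir n (\<lambda>j. if j = i then 1 else 0) g)"
      by (simp add: Dir_def mpoly.scale_sum_right)
    finally show ?thesis by (simp add: Dir_unit[OF i])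
  qed
  have "c \<noteq> 0"
  proof
    assume "c = 0"
    then have "0 \<in> G ` {..n}" using Gc[of 0] by (intro image_eqI[of _ _ 0]) simp_all
    then have "mpoly.dependent (G ` {..n})" by (rule mpoly.dependent_zero)
    then show False using G by (simp add: ordered_basis_def)
  qed
  with Gc show ?thesis by blast
qed

theorem corollary6p1:
  fixes n d :: nat
  assumes "d \<ge> 3"
  shows "zariski_open n d (locus_U n d) \<and>
    ((n, d) \<noteq> (1, 3) \<longrightarrow> locus_U n d \<noteq> {}) \<and>
    (\<forall>\<gamma> \<in> locus_U n d. \<forall>g \<in> \<gamma>.
      \<exists>F. ordered_basis n F (jacobian_space n g) \<and>
          (\<forall>i j. i < j \<and> j \<le> n \<longrightarrow> partial j (F i) = partial i (F j)) \<and>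
          (\<forall>G. ordered_basis n G (jacobian_space n g) \<and>
               (\<forall>i j. i < j \<and> j \<le> n \<longrightarrow> partial j (G i) = partial i (G j)) \<longrightarrow>
               (\<exists>c. c \<noteq> 0 \<and> (\<forall>i\<le>n. G i = scale c (F i)))))"
proof (intro conjI impI ballI)
  show "zariski_open n d (locus_U n d)" by (rule zariski_open_locus_U[OF assms])
  show "locus_U n d \<noteq> {}" if "(n, d) \<noteq> (1, 3)" using that by (rule locus_U_nonempty[OF assms])
  fix \<gamma> g assume "\<gamma> \<in> locus_U n d" "g \<in> \<gamma>"
  then have ne: "\<not> exceptional n g" by (rule locus_U_rep[OF assms])
  show "\<exists>F. ordered_basis n F (jacobian_space n g) \<and>
          (\<forall>i j. i < j \<and> j \<le> n \<longrightarrow> partial j (F i) = partial i (F j)) \<and>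
          (\<forall>G. ordered_basis n G (jacobian_space n g) \<and>
               (\<forall>i j. i < j \<and> j \<le> n \<longrightarrow> partial j (G i) = partial i (G j)) \<longrightarrow>
               (\<exists>c. c \<noteq> 0 \<and> (\<forall>i\<le>n. G i = scale c (F i))))"
  \<comment> \<open>The gradient of g itself serves as the symmetric basis.\<close>
  proof (intro exI[of _ "\<lambda>i. partial i g"] conjI allI impI)
    show "ordered_basis n (\<lambda>i. partial i g) (jacobian_space n g)"
      by (rule jacobian_ordered_basis[OF ne])
    show "partial j (partial i g) = partial i (partial j g)" for i j
      by (rule partial_commute)
    fix G assume "ordered_basis n G (jacobian_space n g) \<and>
      (\<forall>i j. i < j \<and> j \<le> n \<longrightarrow> partial j (G i) = partial i (G j))"
    then show "\<exists>c. c \<noteq> 0 \<and> (\<forall>i\<le>n. G i = scale c (partial i g))"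
      by (elim conjE) (rule jacobian_symmetric_basis_unique[OF ne])
  qed
qed

end
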